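(* Let $(X,G,\alpha)$ be an $\mathcal{F}$-dynamical system with $G$ a compact group. Then $$\Gamma_{\mathcal{F}}(\alpha)=\bigcap\left\{sp_{\mathcal{F}}\bigl(\alpha|_{\overline{JXJ}^{\sigma}}\bigr): J\subset X^{\alpha}\text{ a non-zero } \mathcal{F}\text{-closed two-sided ideal of } X^{\alpha}\right\}.$$
   Context: **Dual pairs.** A dual pair of Banach spaces $(X,\mathcal{F})$ consists of Banach spaces such that: (a) $\mathcal{F}$ is a Banach subspace of the dual $X^{*}$; (b) $\|x\|=\sup\{|\varphi(x)|:\varphi\in\mathcal{F},\|\varphi\|\le 1\}$ for $x\in X$; (c) $\|\varphi\|=\sup\{|\varphi(x)|:x\in X,\|x\|\le 1\}$ for $\varphi\in\mathcal{F}$; (d) the convex hull of every relatively $\mathcal{F}$-compact subset of $X$ is relatively $\mathcal{F}$-compact; (e) the convex hull of every relatively $X$-compact subset of $\mathcal{F}$ is relatively $X$-compact. Here the $\mathcal{F}$-topology on $X$ is the weak topology $\sigma(X,\mathcal{F})$, and the $X$-topology on $\mathcal{F}$ is $\sigma(\mathcal{F},X)$. Throughout, $X$ is a C*-algebra and (f) the involution of $X$ is $\mathcal{F}$-continuous and the multiplication of $X$ is separately $\mathcal{F}$-continuous. **$\mathcal{F}$-dynamical systems.** $(X,G,\alpha)$ is an $\mathcal{F}$-dynamical system with $G$ compact if $(X,\mathcal{F})$ is a dual pair of Banach spaces with $X$ a C*-algebra whose involution is $\mathcal{F}$-continuous and whose multiplication is separately $\mathcal{F}$-continuous, $G$ is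 a compact group, $\alpha:G\to Aut(X)$ is a homomorphism into the group of $*$-automorphisms of $X$, and $g\mapsto\varphi(\alpha_g(x))$ is continuous for every $x\in X$, $\varphi\in\mathcal{F}$. $X^{\alpha}=\{x\in X:\alpha_g(x)=x\ \forall g\in G\}$ is the fixed point algebra. $\widehat{G}$ is the set of unitary equivalence classes of irreducible representations of $G$; for $\pi\in\widehat{G}$ a representative, also denoted $\pi$, on the finite-dimensional Hilbert space $H_\pi$ of dimension $d_\pi$ is fixed, with matrix coefficients $\pi_{ij}$. With $dg$ the normalized Haar measure and the integral taken weakly (i.e. $\varphi(\int f\,dg)=\int\varphi(f(g))\,dg$ for all $\varphi\in\mathcal{F}$), put $(P_\alpha)_{ij}(\pi)(x)=\int_G\overline{\pi_{ji}(g)}\alpha_g(x)\,dg$; the paper records (following Arveson, J. Funct. Anal. 15 (1974), Proposition 1.4) that these maps are $\mathcal{F}$-continuous on $X$. **Notation.** For subsets $Y,Z$ of an algebra, $Y^*=\{y^*:y\in Y\}$, $YZ$ is the linear span of $\{yz:y\in Y,z\in Z\}$ (similarly for triple products), and $\overline{Y}^{\sigma}$ is the closure of $Y$ in the $\mathcal{F}$-topology. On $X\otimes B(H_\pi)$ (i.e. $d_\pi\times d_\pi$ matrices over $X$) the topology used is that given by $\mathcal{F}\otimes B(H_\pi)^*$ (entrywise $\mathcal{F}$-topology), and closures there are also denoted $\overline{\,\cdot\,}^{\sigma}$. **Spectral subspaces and action.** $X_2(\pi)=\{a\in X\otimes B(H_\pi):(\alpha_g\otimes\iota)(a)=a(1\otimes\pi_g)\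 \forall g\in G\}$, where $\iota$ is the identity automorphism of $B(H_\pi)$. The action $\alpha\otimes ad\,\pi$ of $G$ on $X\otimes B(H_\pi)$ is $(\alpha_g\otimes ad\,\pi_g)(a)=(1\otimes\pi_g)[\alpha_g(a_{ij})](1\otimes\pi_{g^{-1}})$, and $(X\otimes B(H_\pi))^{\alpha\otimes ad\,\pi}$ is its fixed point algebra. $X_2(\pi)^*X_2(\pi)$ is a two-sided ideal of it. **Spectra.** $sp_{\mathcal{F}}(\alpha)=\{\pi\in\widehat{G}:\overline{X_2(\pi)^*X_2(\pi)}^{\sigma}\text{ is essential in }(X\otimes B(H_\pi))^{\alpha\otimes ad\,\pi}\}$, where an ideal is essential if its annihilator is $\{0\}$. $\mathcal{H}^{\alpha}_{\sigma}(X)$ is the set of all non-zero globally $\alpha$-invariant $\mathcal{F}$-closed hereditary C*-subalgebras of $X$. For $Y\in\mathcal{H}^{\alpha}_{\sigma}(X)$, $\alpha|_Y$ is the restricted action and $sp_{\mathcal{F}}(\alpha|_Y)=\{\pi\in\widehat{G}:\overline{Y_2(\pi)^*Y_2(\pi)}^{\sigma}\text{ is essential in }(Y\otimes B(H_\pi))^{\alpha\otimes ad\,\pi}\}$, where $Y_2(\pi)=X_2(\pi)\cap(Y\otimes B(H_\pi))$. The Connes spectrum is $\Gamma_{\mathcal{F}}(\alpha)=\bigcap\{sp_{\mathcal{F}}(\alpha|_Y):Y\in\mathcal{H}^{\alpha}_{\sigma}(X)\}$. For $J$ a non-zero $\mathcal{F}$-closed two-sided ideal of $X^{\alpha}$,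 $\overline{JXJ}^{\sigma}\in\mathcal{H}^{\alpha}_{\sigma}(X)$. *)

theory Defs
  imports
    "HOL-Analysis.Analysis"
    "HOL-Probability.Probability_Measure"
    "HOL-Algebra.Group"
    "Jordan_Normal_Form.Matrix"
    "Jordan_Normal_Form.Schur_Decomposition"
begin

section \<open>Complex Banach spaces and C*-algebras\<close>

class complex_banach = banach +
  fixes scaleC :: "complex \<Rightarrow> 'a \<Rightarrow> 'a" (infixr "*\<^sub>C" 75)
  assumes scaleC_add_right: "c *\<^sub>C (x + y) = c *\<^sub>C x + c *\<^sub>C y"
    and scaleC_add_left: "(c + d) *\<^sub>C x = c *\<^sub>C x + d *\<^sub>C x"
    and scaleC_scaleC: "c *\<^sub>C (d *\<^sub>C x) = (c * d) *\<^sub>C x"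
    and scaleC_one: "1 *\<^sub>C x = x"
    and scaleC_of_real: "complex_of_real r *\<^sub>C x = r *\<^sub>R x"
    and norm_scaleC: "norm (c *\<^sub>C x) = cmod c * norm x"

text \<open>No unit is required.\<close>

class cstar_algebra = complex_banach + real_normed_algebra +
  fixes star :: "'a \<Rightarrow> 'a"
  assumes mult_scaleC_left: "(c *\<^sub>C x) * y = c *\<^sub>C (x * y)"
    and mult_scaleC_right: "x * (c *\<^sub>C y) = c *\<^sub>C (x * y)"
    and star_star: "star (star x) = x"
    and star_add: "star (x + y) = star x + star y"
    and star_scaleC: "star (c *\<^sub>C x) = cnj c *\<^sub>C star x"
    and star_mult: "star (x * y) = star y * star x"
    and cstar_identity: "norm (star x * x) = (norm x)\<^sup>2"

interpretation complex_space: vector_space "scaleC :: complex \<Rightarrow> 'a::complex_banach \<Rightarrow> 'a"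
  by unfold_locales
    (simp_all add: scaleC_add_right scaleC_add_left scaleC_scaleC scaleC_one)

abbreviation csubspace :: "'a::complex_banach set \<Rightarrow> bool"
  where "csubspace \<equiv> Modules.module.subspace scaleC"

abbreviation cspan :: "'a::complex_banach set \<Rightarrow> 'a set"
  where "cspan \<equiv> Modules.module.span scaleC"

definition star_automorphism :: "('a::cstar_algebra \<Rightarrow> 'a) \<Rightarrow> bool" where
  "star_automorphism f \<longleftrightarrow> bij f \<and>
     (\<forall>x y. f (x + y) = f x + f y) \<and> (\<forall>c x. f (c *\<^sub>C x) = c *\<^sub>C f x) \<and>
     (\<forall>x y. f (x * y) = f x * f y) \<and> (\<forall>x. f (star x) = star (f x))"

definition positive :: "'a::cstar_algebra \<Rightarrow> bool" where
  "positive x \<longleftrightarrow> (\<exists>z. x = star z * z)"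

definition cstar_subalgebra :: "'a::cstar_algebra set \<Rightarrow> bool" where
  "cstar_subalgebra Y \<longleftrightarrow> csubspace Y \<and> closed Y \<and>
     (\<forall>x\<in>Y. \<forall>y\<in>Y. x * y \<in> Y) \<and> (\<forall>x\<in>Y. star x \<in> Y)"

text \<open>In the last line, \<open>0 \<le> x \<le> y\<close> with \<open>y \<in> Y\<close> forces \<open>x \<in> Y\<close>.\<close>

definition hereditary_cstar_subalgebra :: "'a::cstar_algebra set \<Rightarrow> bool" where
  "hereditary_cstar_subalgebra Y \<longleftrightarrow> cstar_subalgebra Y \<and>
     (\<forall>x. \<forall>y\<in>Y. positive x \<and> positive (y - x) \<longrightarrow> x \<in> Y)"

section \<open>Dual pairs\<close>

text \<open>
  A functional on \<open>X\<close> is an element of \<open>'a \<Rightarrow>\<^sub>L complex\<close>. That type contains all bounded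
  real-linear maps, so complex linearity is demanded separately in \<open>dual_pair\<close>.
\<close>

definition weak_topology :: "('a::real_normed_vector \<Rightarrow>\<^sub>L complex) set \<Rightarrow> 'a topology" where
  "weak_topology F = topology_generated_by
     {{x. blinfun_apply \<phi> x \<in> U} | \<phi> U. \<phi> \<in> F \<and> open U}"

definition point_topology ::
    "('a::real_normed_vector \<Rightarrow>\<^sub>L complex) set \<Rightarrow> ('a \<Rightarrow>\<^sub>L complex) topology" where
  "point_topology F = topology_generated_by
     {{\<phi> \<in> F. blinfun_apply \<phi> x \<in> U} | x U. open U}"

definition relatively_compactin :: "'a topology \<Rightarrow> 'a set \<Rightarrow> bool" where
  "relatively_compactin T S \<longleftrightarrow> S \<subseteq> topspace T \<and> compactin T (T closure_of S)"

text \<open>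
  By the second norm formula the norm of \<open>F\<close> is the dual norm, so a Banach subspace of the dual
  is a norm-closed complex subspace.
\<close>

definition dual_pair :: "('a::complex_banach \<Rightarrow>\<^sub>L complex) set \<Rightarrow> bool" where
  "dual_pair F \<longleftrightarrow>
     (\<forall>\<phi>\<in>F. \<forall>c x. blinfun_apply \<phi> (c *\<^sub>C x) = c * blinfun_apply \<phi> x) \<and>
     0 \<in> F \<and> (\<forall>\<phi>\<in>F. \<forall>\<psi>\<in>F. \<phi> + \<psi> \<in> F) \<and>
     (\<forall>c. \<forall>\<phi>\<in>F. blinfun_mult_right c o\<^sub>L \<phi> \<in> F) \<and> closed F \<and>
     (\<forall>x. norm x = (SUP \<phi>\<in>{\<phi>\<in>F. norm \<phi> \<le> 1}. cmod (blinfun_apply \<phi> x))) \<and>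
     (\<forall>\<phi>\<in>F. norm \<phi> = (SUP x\<in>{x. norm x \<le> 1}. cmod (blinfun_apply \<phi> x))) \<and>
     (\<forall>S. relatively_compactin (weak_topology F) S \<longrightarrow>
          relatively_compactin (weak_topology F) (convex hull S)) \<and>
     (\<forall>S. relatively_compactin (point_topology F) S \<longrightarrow>
          relatively_compactin (point_topology F) (convex hull S))"

definition cstar_dual_pair :: "('a::cstar_algebra \<Rightarrow>\<^sub>L complex) set \<Rightarrow> bool" where
  "cstar_dual_pair F \<longleftrightarrow> dual_pair F \<and>
     continuous_map (weak_topology F) (weak_topology F) star \<and>
     (\<forall>a. continuous_map (weak_topology F) (weak_topology F) (\<lambda>x. a * x)) \<and>
     (\<forall>a. continuous_map (weak_topology F) (weak_topology F) (\<lambda>x. x * a))"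

section \<open>Compact groups and their duals\<close>

locale compact_topological_group = group G for G (structure) +
  fixes T :: "'a topology"
  assumes topspace_carrier: "topspace T = carrier G"
    and continuous_mult: "continuous_map (prod_topology T T) T (\<lambda>(g, h). g \<otimes> h)"
    and continuous_inv: "continuous_map T T (\<lambda>g. inv g)"
    and is_compact: "compact_space T"
    and is_Hausdorff: "Hausdorff_space T"

definition normalized_haar_measure ::
    "('g, 'm) monoid_scheme \<Rightarrow> 'g topology \<Rightarrow> 'g measure \<Rightarrow> bool" where
  "normalized_haar_measure G T \<mu> \<longleftrightarrow> prob_space \<mu> \<and> space \<mu> = carrier G \<and>
     sets \<mu> = sigma_sets (carrier G) {U. openin T U} \<and>
     (\<forall>g\<in>carrier G. \<forall>A\<in>sets \<mu>. emeasure \<mu> ((\<lambda>h. g \<otimes>\<^bsub>G\<^esub> h) ` A) = emeasure \<mu> A) \<and>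
     (\<forall>A\<in>sets \<mu>. emeasure \<mu> A = (SUP K\<in>{K. compactin T K \<and> K \<subseteq> A}. emeasure \<mu> K))"

definition unitary_mat :: "nat \<Rightarrow> complex mat \<Rightarrow> bool" where
  "unitary_mat d U \<longleftrightarrow> U \<in> carrier_mat d d \<and>
     U * mat_adjoint U = 1\<^sub>m d \<and> mat_adjoint U * U = 1\<^sub>m d"

text \<open>
  Representation spaces are the Hilbert spaces \<open>\<complex>\<^sup>d\<close>, and \<open>\<pi> g $$ (i, j)\<close> are the
  matrix coefficients. Irreducible unitary representations of a compact group are
  finite-dimensional, so nothing is lost.
\<close>

definition rep_dim :: "('g, 'm) monoid_scheme \<Rightarrow> ('g \<Rightarrow> complex mat) \<Rightarrow> nat" where
  "rep_dim G \<pi> = dim_row (\<pi> \<one>\<^bsub>G\<^esub>)"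

definition unitary_rep ::
    "('g, 'm) monoid_scheme \<Rightarrow> 'g topology \<Rightarrow> ('g \<Rightarrow> complex mat) \<Rightarrow> bool" where
  "unitary_rep G T \<pi> \<longleftrightarrow>
     (\<forall>g\<in>carrier G. unitary_mat (rep_dim G \<pi>) (\<pi> g)) \<and>
     (\<forall>g\<in>carrier G. \<forall>h\<in>carrier G. \<pi> (g \<otimes>\<^bsub>G\<^esub> h) = \<pi> g * \<pi> h) \<and>
     (\<forall>i<rep_dim G \<pi>. \<forall>j<rep_dim G \<pi>. continuous_map T euclidean (\<lambda>g. \<pi> g $$ (i, j)))"

definition subspace_vec :: "nat \<Rightarrow> complex vec set \<Rightarrow> bool" where
  "subspace_vec d W \<longleftrightarrow> W \<subseteq> carrier_vec d \<and> 0\<^sub>v d \<in> W \<and>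
     (\<forall>v\<in>W. \<forall>w\<in>W. v + w \<in> W) \<and> (\<forall>c. \<forall>v\<in>W. c \<cdot>\<^sub>v v \<in> W)"

definition irreducible_rep ::
    "('g, 'm) monoid_scheme \<Rightarrow> 'g topology \<Rightarrow> ('g \<Rightarrow> complex mat) \<Rightarrow> bool" where
  "irreducible_rep G T \<pi> \<longleftrightarrow> unitary_rep G T \<pi> \<and> rep_dim G \<pi> > 0 \<and>
     (\<forall>W. subspace_vec (rep_dim G \<pi>) W \<and> (\<forall>g\<in>carrier G. \<forall>w\<in>W. \<pi> g *\<^sub>v w \<in> W) \<longrightarrow>
          W = {0\<^sub>v (rep_dim G \<pi>)} \<or> W = carrier_vec (rep_dim G \<pi>))"

definition unitary_equivalence ::
    "('g, 'm) monoid_scheme \<Rightarrow> 'g topology \<Rightarrow> (('g \<Rightarrow> complex mat) \<times> ('g \<Rightarrow> complex mat)) set" where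
  "unitary_equivalence G T = {(\<pi>, \<rho>). irreducible_rep G T \<pi> \<and> irreducible_rep G T \<rho> \<and>
     rep_dim G \<pi> = rep_dim G \<rho> \<and>
     (\<exists>U. unitary_mat (rep_dim G \<pi>) U \<and> (\<forall>g\<in>carrier G. \<rho> g = U * \<pi> g * mat_adjoint U))}"

definition dual_group ::
    "('g, 'm) monoid_scheme \<Rightarrow> 'g topology \<Rightarrow> ('g \<Rightarrow> complex mat) set set" where
  "dual_group G T = {\<pi>. irreducible_rep G T \<pi>} // unitary_equivalence G T"

section \<open>Dynamical systems\<close>

definition dynamical_system ::
    "('a::cstar_algebra \<Rightarrow>\<^sub>L complex) set \<Rightarrow> ('g, 'm) monoid_scheme \<Rightarrow> 'g topology \<Rightarrow>
     ('g \<Rightarrow> 'a \<Rightarrow> 'a) \<Rightarrow> bool" where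
  "dynamical_system F G T \<alpha> \<longleftrightarrow> cstar_dual_pair F \<and> compact_topological_group G T \<and>
     (\<forall>g\<in>carrier G. star_automorphism (\<alpha> g)) \<and>
     (\<forall>g\<in>carrier G. \<forall>h\<in>carrier G. \<alpha> (g \<otimes>\<^bsub>G\<^esub> h) = \<alpha> g \<circ> \<alpha> h) \<and>
     (\<forall>x. \<forall>\<phi>\<in>F. continuous_map T euclidean (\<lambda>g. blinfun_apply \<phi> (\<alpha> g x)))"

definition fixed_points :: "('g, 'm) monoid_scheme \<Rightarrow> ('g \<Rightarrow> 'a \<Rightarrow> 'a) \<Rightarrow> 'a set" where
  "fixed_points G \<alpha> = {x. \<forall>g\<in>carrier G. \<alpha> g x = x}"

text \<open>
  \<open>P\<close> is the map \<open>(P\<^sub>\<alpha>)\<^sub>i\<^sub>j(\<pi>)\<close>, i.e. \<open>P x\<close> is the weak integral of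
  \<open>cnj (\<pi>\<^sub>j\<^sub>i g) *\<^sub>C \<alpha> g x\<close>. It is unique, since \<open>F\<close> separates points.
\<close>

definition is_spectral_map ::
    "('a::cstar_algebra \<Rightarrow>\<^sub>L complex) set \<Rightarrow> 'g measure \<Rightarrow> ('g \<Rightarrow> 'a \<Rightarrow> 'a) \<Rightarrow>
     ('g \<Rightarrow> complex mat) \<Rightarrow> nat \<Rightarrow> nat \<Rightarrow> ('a \<Rightarrow> 'a) \<Rightarrow> bool" where
  "is_spectral_map F \<mu> \<alpha> \<pi> i j P \<longleftrightarrow>
     (\<forall>x. \<forall>\<phi>\<in>F. blinfun_apply \<phi> (P x) =
        (\<integral>g. blinfun_apply \<phi> (cnj (\<pi> g $$ (j, i)) *\<^sub>C \<alpha> g x) \<partial>\<mu>))"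

section \<open>Matrices over the algebra\<close>

text \<open>
  \<open>Y \<otimes> B(\<complex>\<^sup>d)\<close> is the set of \<open>d \<times> d\<close> matrices with entries in \<open>Y\<close>; the product is
  that of the library, and \<open>a (1 \<otimes> U)\<close>, \<open>(1 \<otimes> U) a\<close> are \<open>mat_rmult a U\<close>, \<open>mat_lmult U a\<close>.
\<close>

definition mats_over :: "nat \<Rightarrow> 'a set \<Rightarrow> 'a mat set" where
  "mats_over d Y = {a \<in> carrier_mat d d. \<forall>i<d. \<forall>j<d. a $$ (i, j) \<in> Y}"

definition mat_star :: "'a::cstar_algebra mat \<Rightarrow> 'a mat" where
  "mat_star a = mat (dim_col a) (dim_row a) (\<lambda>(i, j). star (a $$ (j, i)))"

definition mat_rmult :: "'a::complex_banach mat \<Rightarrow> complex mat \<Rightarrow> 'a mat" where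
  "mat_rmult a U = mat (dim_row a) (dim_col U)
     (\<lambda>(i, j). \<Sum>k<dim_row U. (U $$ (k, j)) *\<^sub>C (a $$ (i, k)))"

definition mat_lmult :: "complex mat \<Rightarrow> 'a::complex_banach mat \<Rightarrow> 'a mat" where
  "mat_lmult U a = mat (dim_row U) (dim_col a)
     (\<lambda>(i, j). \<Sum>k<dim_col U. (U $$ (i, k)) *\<^sub>C (a $$ (k, j)))"

text \<open>The complex linear span of a set of \<open>d \<times> d\<close> matrices.\<close>

inductive_set mat_span :: "nat \<Rightarrow> 'a::complex_banach mat set \<Rightarrow> 'a mat set"
  for d :: nat and S :: "'a mat set" where
  zero: "0\<^sub>m d d \<in> mat_span d S"
| step: "A \<in> S \<Longrightarrow> B \<in> mat_span d S \<Longrightarrow> map_mat (scaleC c) A + B \<in> mat_span d S"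

definition mat_weak_topology ::
    "nat \<Rightarrow> ('a::complex_banach \<Rightarrow>\<^sub>L complex) set \<Rightarrow> 'a mat topology" where
  "mat_weak_topology d F = topology_generated_by
     {{a \<in> carrier_mat d d. blinfun_apply \<phi> (a $$ (i, j)) \<in> U} | \<phi> i j U.
        \<phi> \<in> F \<and> i < d \<and> j < d \<and> open U}"

section \<open>Spectra\<close>

definition spectral_subspace ::
    "('g, 'm) monoid_scheme \<Rightarrow> ('g \<Rightarrow> 'a::cstar_algebra \<Rightarrow> 'a) \<Rightarrow> ('g \<Rightarrow> complex mat) \<Rightarrow>
     'a mat set" where
  "spectral_subspace G \<alpha> \<pi> = {a \<in> carrier_mat (rep_dim G \<pi>) (rep_dim G \<pi>).
     \<forall>g\<in>carrier G. map_mat (\<alpha> g) a = mat_rmult a (\<pi> g)}"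

definition ad_action ::
    "('g, 'm) monoid_scheme \<Rightarrow> ('g \<Rightarrow> 'a::cstar_algebra \<Rightarrow> 'a) \<Rightarrow> ('g \<Rightarrow> complex mat) \<Rightarrow>
     'g \<Rightarrow> 'a mat \<Rightarrow> 'a mat" where
  "ad_action G \<alpha> \<pi> g a = mat_rmult (mat_lmult (\<pi> g) (map_mat (\<alpha> g) a)) (\<pi> (inv\<^bsub>G\<^esub> g))"

definition ad_fixed_algebra ::
    "('g, 'm) monoid_scheme \<Rightarrow> ('g \<Rightarrow> 'a::cstar_algebra \<Rightarrow> 'a) \<Rightarrow> ('g \<Rightarrow> complex mat) \<Rightarrow>
     'a set \<Rightarrow> 'a mat set" where
  "ad_fixed_algebra G \<alpha> \<pi> Y =
     {a \<in> mats_over (rep_dim G \<pi>) Y. \<forall>g\<in>carrier G. ad_action G \<alpha> \<pi> g a = a}"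

definition essential_in :: "'a::cstar_algebra mat set \<Rightarrow> nat \<Rightarrow> 'a mat set \<Rightarrow> bool" where
  "essential_in I d B \<longleftrightarrow> {b \<in> B. \<forall>a\<in>I. a * b = 0\<^sub>m d d \<and> b * a = 0\<^sub>m d d} = {0\<^sub>m d d}"

text \<open>
  \<open>rep\<close> selects the fixed representative of each class in the dual of \<open>G\<close>. For \<open>Y = UNIV\<close>
  this is the spectrum of \<open>\<alpha>\<close>; otherwise it is the spectrum of the restriction of \<open>\<alpha>\<close> to \<open>Y\<close>.
\<close>

definition action_spectrum ::
    "('a::cstar_algebra \<Rightarrow>\<^sub>L complex) set \<Rightarrow> ('g, 'm) monoid_scheme \<Rightarrow> 'g topology \<Rightarrow>
     ('g \<Rightarrow> 'a \<Rightarrow> 'a) \<Rightarrow> (('g \<Rightarrow> complex mat) set \<Rightarrow> 'g \<Rightarrow> complex mat) \<Rightarrow> 'a set \<Rightarrow>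
     ('g \<Rightarrow> complex mat) set set" where
  "action_spectrum F G T \<alpha> rep Y = {c \<in> dual_group G T.
     let \<pi> = rep c; d = rep_dim G \<pi>;
         Y2 = spectral_subspace G \<alpha> \<pi> \<inter> mats_over d Y
     in essential_in
          (mat_weak_topology d F closure_of mat_span d {mat_star a * b | a b. a \<in> Y2 \<and> b \<in> Y2})
          d (ad_fixed_algebra G \<alpha> \<pi> Y)}"

definition invariant_hereditary_subalgebras ::
    "('a::cstar_algebra \<Rightarrow>\<^sub>L complex) set \<Rightarrow> ('g, 'm) monoid_scheme \<Rightarrow> ('g \<Rightarrow> 'a \<Rightarrow> 'a) \<Rightarrow>
     'a set set" where
  "invariant_hereditary_subalgebras F G \<alpha> = {Y. hereditary_cstar_subalgebra Y \<and> Y \<noteq> {0} \<and>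
     closedin (weak_topology F) Y \<and> (\<forall>g\<in>carrier G. \<alpha> g ` Y = Y)}"

text \<open>
  The intersection is taken inside the dual of \<open>G\<close>; this only matters for \<open>X = 0\<close>, where the
  family of subalgebras is empty.
\<close>

definition connes_spectrum ::
    "('a::cstar_algebra \<Rightarrow>\<^sub>L complex) set \<Rightarrow> ('g, 'm) monoid_scheme \<Rightarrow> 'g topology \<Rightarrow>
     ('g \<Rightarrow> 'a \<Rightarrow> 'a) \<Rightarrow> (('g \<Rightarrow> complex mat) set \<Rightarrow> 'g \<Rightarrow> complex mat) \<Rightarrow>
     ('g \<Rightarrow> complex mat) set set" where
  "connes_spectrum F G T \<alpha> rep =
     dual_group G T \<inter> (\<Inter>Y\<in>invariant_hereditary_subalgebras F G \<alpha>. action_spectrum F G T \<alpha> rep Y)"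

definition closed_fixed_ideals ::
    "('a::cstar_algebra \<Rightarrow>\<^sub>L complex) set \<Rightarrow> ('g, 'm) monoid_scheme \<Rightarrow> ('g \<Rightarrow> 'a \<Rightarrow> 'a) \<Rightarrow>
     'a set set" where
  "closed_fixed_ideals F G \<alpha> = {J. J \<subseteq> fixed_points G \<alpha> \<and> csubspace J \<and> J \<noteq> {0} \<and>
     (\<forall>x\<in>fixed_points G \<alpha>. \<forall>y\<in>J. x * y \<in> J \<and> y * x \<in> J) \<and>
     closedin (weak_topology F) J}"

definition generated_hereditary ::
    "('a::cstar_algebra \<Rightarrow>\<^sub>L complex) set \<Rightarrow> 'a set \<Rightarrow> 'a set" where
  "generated_hereditary F J =
     weak_topology F closure_of cspan {j * x * k | j x k. j \<in> J \<and> k \<in> J}"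

end

theory Submission
  imports Defs
begin

text \<open>
  Write \<open>X\<close> for the algebra, \<open>X\<^sup>\<alpha>\<close> for its fixed points, and \<open>Z = generated_hereditary F J\<close>.
  By the C*-identity for matrices, \<open>\<pi>\<close> lies in the spectrum of the restriction to \<open>Y\<close> exactly if an
  element \<open>b\<close> of the fixed algebra over \<open>Y\<close> vanishes as soon as \<open>a b = 0\<close> and \<open>b a* = 0\<close> for all
  \<open>a\<close> in \<open>Y\<^sub>2(\<pi>)\<close> (lemma \<open>essential_iff\<close>). So everything is a question about annihilators.

  The automorphisms \<open>\<alpha> g\<close> are not assumed to be \<open>F\<close>-continuous, so it is not clear at the outset that the
  closure \<open>Z\<close> is invariant. The proof therefore compares \<open>Z\<close> with a double annihilator. For
  \<open>K \<subseteq> X\<^sup>\<alpha>\<close> let \<open>K'\<close> be the set of all \<open>s\<close> in \<open>X\<^sup>\<alpha>\<close> with \<open>s x k = 0 = k x s\<close> for all \<open>x\<close> in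
  \<open>X\<^sup>\<alpha>\<close> and \<open>k\<close> in \<open>K\<close>, and let \<open>K''\<close> be the set of all \<open>x\<close> in \<open>X\<close> with \<open>s x = 0 = x s\<close> for all \<open>s\<close>
  in \<open>K'\<close>. Then \<open>K''\<close> is a weakly closed, invariant, hereditary C*-subalgebra that contains \<open>K\<close>.
  Both inclusions rest on one observation (lemma \<open>product_eq_0\<close>): let \<open>M = a b\<close> with \<open>a\<close> in
  \<open>X\<^sub>2(\<pi>)\<close>, the entries of \<open>a\<close> annihilated by \<open>K'\<close>, and \<open>b\<close> fixed by \<open>\<alpha> \<otimes> ad \<pi>\<close>. If \<open>K X\<^sup>\<alpha> M = 0\<close>
  then \<open>M = 0\<close>. Indeed the diagonal entries of \<open>M M*\<close> are fixed points that lie in \<open>K'\<close>; hence they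
  annihilate \<open>a\<close> and \<open>M\<close>, and their squares vanish.

  Let \<open>\<pi>\<close> be in the spectrum for all \<open>Y\<close>, let \<open>J\<close> be an ideal, and let \<open>b\<close> over \<open>Z\<close> annihilate
  \<open>Z\<^sub>2(\<pi>)\<close>. For \<open>a\<close> in \<open>V\<^sub>2(\<pi>)\<close>, where \<open>V = J''\<close>, and \<open>j\<close>, \<open>k\<close> in \<open>J\<close> the matrix \<open>j a k\<close> belongs
  to \<open>Z\<^sub>2(\<pi>)\<close>, so \<open>j (a k b) = 0\<close> and the observation gives \<open>a k b = 0\<close>. Thus \<open>(k b) (k b)*\<close>, whose
  entries are in \<open>V\<close>, annihilates \<open>V\<^sub>2(\<pi>)\<close> and vanishes, and \<open>J b = 0\<close>. The trace of \<open>b b*\<close> then lies in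
  \<open>J'\<close>, which annihilates \<open>Z\<close>; so its square vanishes and \<open>b = 0\<close>.

  Let conversely \<open>\<pi>\<close> be in the spectrum for all \<open>Z\<close>, and let \<open>b\<close> over \<open>Y\<close> annihilate \<open>Y\<^sub>2(\<pi>)\<close>. Let
  \<open>t\<close> be the trace of \<open>b b*\<close>, put \<open>K = Y \<inter> X\<^sup>\<alpha>\<close> and \<open>J = X\<^sup>\<alpha> \<inter> K''\<close>. For \<open>a\<close> in \<open>Z\<^sub>2(\<pi>)\<close>,
  \<open>k\<close> in \<open>K\<close> and \<open>x\<close> in \<open>X\<^sup>\<alpha>\<close> the matrix \<open>k x a t\<close> belongs to \<open>Y\<^sub>2(\<pi>)\<close>, because \<open>Y X Y \<subseteq> Y\<close>. Hence
  \<open>k x (a t b) = 0\<close>, so \<open>a t b = 0\<close> by the observation, \<open>(t b) (t b)*\<close> annihilates \<open>Z\<^sub>2(\<pi>)\<close>, and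
  \<open>t b = 0\<close>, which forces \<open>b = 0\<close>.

  For \<open>J\<close> to be closed here, \<open>X\<^sup>\<alpha>\<close> has to be weakly closed. This uses the continuity of the spectral map
  of the trivial representation and the convex hull axiom of a dual pair: see \<open>fixed_points_weakly_closed\<close>.

  The algebra need not have a unit, so positivity is handled by norm estimates for the
  multiplication operators \<open>z \<mapsto> t z - y z\<close>; the tool is the binomial series for \<open>(1 - h)\<^bsup>1/2\<^esup>\<close>.
\<close>

section \<open>Complex scalars and the involution\<close>

lemma scaleC_eq_scaleR: "r *\<^sub>R x = complex_of_real r *\<^sub>C (x :: 'a::complex_banach)"
  by (simp add: scaleC_of_real)

lemma scaleC_minus_right: "c *\<^sub>C (- x :: 'a::complex_banach) = - (c *\<^sub>C x)"
  by (rule complex_space.scale_minus_right)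

lemma scaleC_minus_left: "(- c) *\<^sub>C (x :: 'a::complex_banach) = - (c *\<^sub>C x)"
  by (rule complex_space.scale_minus_left)

lemma scaleC_diff_right: "c *\<^sub>C (x - y :: 'a::complex_banach) = c *\<^sub>C x - c *\<^sub>C y"
  by (rule complex_space.scale_right_diff_distrib)

lemma scaleC_sum_right: "c *\<^sub>C (\<Sum>i\<in>I. f i :: 'a::complex_banach) = (\<Sum>i\<in>I. c *\<^sub>C f i)"
  by (rule complex_space.scale_sum_right)

lemma scaleC_sum_left: "(\<Sum>i\<in>I. f i) *\<^sub>C (x :: 'a::complex_banach) = (\<Sum>i\<in>I. f i *\<^sub>C x)"
  by (rule complex_space.scale_sum_left)

lemma scaleC_i_i: "\<i> *\<^sub>C (\<i> *\<^sub>C x) = - (x :: 'a::complex_banach)"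
  using scaleC_scaleC[of \<i> \<i> x] scaleC_minus_left[of 1 x] by (simp add: scaleC_one)

lemma star_0 [simp]: "star (0 :: 'a::cstar_algebra) = 0"
  using star_add[of "0::'a" 0] by simp

lemma star_uminus: "star (- x :: 'a::cstar_algebra) = - star x"
  using star_add[of x "- x"] by (simp add: eq_neg_iff_add_eq_0 add.commute)

lemma star_diff: "star (x - y :: 'a::cstar_algebra) = star x - star y"
  using star_add[of x "- y"] by (simp add: star_uminus)

lemma star_sum: "star (\<Sum>i\<in>I. f i :: 'a::cstar_algebra) = (\<Sum>i\<in>I. star (f i))"
  by (induction I rule: infinite_finite_induct) (simp_all add: star_add)

lemma star_scaleR: "star (r *\<^sub>R x :: 'a::cstar_algebra) = r *\<^sub>R star x"
  by (simp add: scaleC_eq_scaleR star_scaleC)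

lemmas star_simps = star_add star_diff star_uminus star_mult star_star star_scaleC star_scaleR

lemma norm_star: "norm (star x :: 'a::cstar_algebra) = norm x"
proof -
  have le: "norm y \<le> norm (star y)" for y :: 'a
  proof (cases "norm y = 0")
    case False
    have "(norm y)\<^sup>2 \<le> norm (star y) * norm y"
      unfolding cstar_identity[symmetric] by (rule norm_mult_ineq)
    then show ?thesis using False by (simp add: power2_eq_square)
  qed auto
  show ?thesis using le[of x] le[of "star x"] by (simp add: star_star)
qed

lemma bounded_linear_star: "bounded_linear (star :: 'a::cstar_algebra \<Rightarrow> 'a)"
  by (rule bounded_linear_intro[of _ 1]) (simp_all add: star_add star_scaleR norm_star)

lemma star_mult_self_eq_0: "star x * x = 0 \<longleftrightarrow> (x :: 'a::cstar_algebra) = 0"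
  using cstar_identity[of x] by auto

lemma mult_star_self_eq_0: "x * star x = 0 \<longleftrightarrow> (x :: 'a::cstar_algebra) = 0"
  using star_mult_self_eq_0[of "star x"] by (metis star_star star_0)

lemma norm_self_adjoint_square: "star a = a \<Longrightarrow> norm (a * a) = (norm (a :: 'a::cstar_algebra))\<^sup>2"
  using cstar_identity[of a] by simp

section \<open>Square roots and positivity without a unit\<close>

text \<open>
  The element \<open>1 + d\<close> of the unitization is \<open>(1 - h)\<^bsup>1/2\<^esup>\<close>. The binomial series without its constant
  term converges in the algebra itself, and the Vandermonde identity
  shows that \<open>1 + d\<close> squares to \<open>1 - h\<close>.
\<close>

lemma sqrt_one_minus:
  fixes h :: "'a::cstar_algebra"
  assumes small: "norm h < 1" and sa: "star h = h"
  obtains d where "star d = d" "d + d + d * d = - h" "\<And>x. x * h = h * x \<Longrightarrow> x * d = d * x"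
proof -
  define p where "p n = ((*) h ^^ n) h" for n
  define \<gamma> :: "nat \<Rightarrow> real" where "\<gamma> n = (-1) ^ n * ((1/2) gchoose n)" for n
  \<comment> \<open>The constant term of the series is \<open>1\<close> and is left out.\<close>
  define D where "D n = (case n of 0 \<Rightarrow> 0 | Suc m \<Rightarrow> \<gamma> n *\<^sub>R p m)" for n
  have p_Suc: "p (Suc n) = h * p n" and p_0: "p 0 = h" for n
    by (simp_all add: p_def)
  have p_add: "p m * p n = p (Suc (m + n))" for m n
    by (induction m) (simp_all add: p_Suc p_0 mult.assoc)
  have p_norm: "norm (p n) \<le> norm h ^ Suc n" for n
  proof (induction n)
    case (Suc n)
    have "norm (p (Suc n)) \<le> norm h * norm (p n)" by (simp add: p_Suc norm_mult_ineq)
    also have "\<dots> \<le> norm h * norm h ^ Suc n" using Suc by (intro mult_left_mono) auto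
    finally show ?case by simp
  qed (simp add: p_0)
  have D_norm: "norm (D n) \<le> \<bar>(1/2) gchoose n\<bar> * norm h ^ n" for n
  proof (cases n)
    case (Suc m)
    have "\<bar>\<gamma> n\<bar> = \<bar>(1/2) gchoose n\<bar>" by (simp add: \<gamma>_def abs_mult power_abs)
    moreover have "\<bar>\<gamma> n\<bar> * norm (p m) \<le> \<bar>\<gamma> n\<bar> * norm h ^ n"
      using p_norm[of m] Suc by (intro mult_left_mono) auto
    ultimately show ?thesis using Suc by (simp add: D_def)
  qed (simp add: D_def)
  have "summable (\<lambda>n. norm (((1/2) gchoose n) * norm h ^ n :: real))"
  proof -
    define r where "r = (norm h + 1) / 2"
    have r: "norm h < r" "\<bar>r\<bar> < 1" using small norm_ge_zero[of h] by (auto simp: r_def field_simps abs_less_iff simp del: norm_ge_zero)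
    have "summable (\<lambda>n. ((1/2) gchoose n) * r ^ n :: real)"
      using gen_binomial_real[OF r(2)] by (rule sums_summable)
    then show ?thesis by (rule powser_insidea) (use r in auto)
  qed
  then have D_summable: "summable (\<lambda>n. norm (D n))"
    by (rule summable_comparison_test'[where N = 0]) (simp add: D_norm abs_mult)
  have D_sums: "D sums suminf D" using D_summable by (rule summable_sums[OF summable_norm_cancel])
  define d where "d = suminf D"
  define e where "e n = (if n = (1::nat) then - h else 0)" for n
  have vandermonde: "(\<Sum>i\<le>n. \<gamma> i * \<gamma> (n - i)) = (-1) ^ n * (1 gchoose n)" for n
  proof -
    have "(\<Sum>i\<le>n. \<gamma> i * \<gamma> (n - i)) = (\<Sum>i\<le>n. (-1) ^ n * (((1/2) gchoose i) * ((1/2) gchoose (n - i))))"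
    proof (intro sum.cong refl)
      fix i assume "i \<in> {..n}"
      then have "(-1::real) ^ n = (-1) ^ i * (-1) ^ (n - i)" by (simp flip: power_add)
      then show "\<gamma> i * \<gamma> (n - i) = (-1) ^ n * (((1/2) gchoose i) * ((1/2) gchoose (n - i)))"
        by (simp add: \<gamma>_def mult_ac)
    qed
    also have "\<dots> = (-1) ^ n * (1 gchoose n)"
      using gbinomial_Vandermonde[of "1/2 :: real" "1/2" n] by (simp add: sum_distrib_left[symmetric] atMost_atLeast0)
    finally show ?thesis .
  qed
  have one_gchoose: "(1::real) gchoose n = (if n \<le> 1 then 1 else 0)" for n
  proof -
    have "(1::real) gchoose n = of_nat (1 choose n)" by (metis binomial_gbinomial of_nat_1)
    then show ?thesis by (cases n) (auto simp: binomial_eq_0)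
  qed
  have coeff: "(\<Sum>i\<le>n. D i * D (n - i)) = e n - 2 *\<^sub>R D n" for n
  proof (cases n)
    case 0
    then show ?thesis by (simp add: D_def e_def)
  next
    case (Suc m)
    \<comment> \<open>Without the constant term the convolution loses the terms with \<open>i = 0\<close> and \<open>i = n\<close>.\<close>
    define \<gamma>' where "\<gamma>' i = (if i = 0 then 0 else \<gamma> i)" for i
    have "D i * D (n - i) = (\<gamma>' i * \<gamma>' (n - i)) *\<^sub>R p m" if i: "i \<le> n" for i
    proof (cases "i = 0 \<or> i = n")
      case True
      then show ?thesis by (auto simp: D_def \<gamma>'_def)
    next
      case False
      then obtain k l where k: "i = Suc k" and l: "n - i = Suc l"
        using i by (metis diff_is_0_eq le_antisym not0_implies_Suc)
      then have "m = Suc (k + l)" using i Suc by simp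
      note k l this
      then show ?thesis by (simp add: D_def \<gamma>'_def p_add del: Suc_diff_le)
    qed
    then have "(\<Sum>i\<le>n. D i * D (n - i)) = (\<Sum>i\<le>n. \<gamma>' i * \<gamma>' (n - i)) *\<^sub>R p m"
      by (simp add: scaleR_sum_left)
    also have "(\<Sum>i\<le>n. \<gamma>' i * \<gamma>' (n - i)) = (\<Sum>i\<le>n. \<gamma> i * \<gamma> (n - i)) - 2 * \<gamma> n"
    proof -
      have "\<gamma> i * \<gamma> (n - i) - \<gamma>' i * \<gamma>' (n - i) = (if i = 0 then \<gamma> n else 0) + (if i = n then \<gamma> n else 0)" if "i \<le> n" for i
        using that Suc by (auto simp: \<gamma>'_def \<gamma>_def)
      then have "(\<Sum>i\<le>n. \<gamma> i * \<gamma> (n - i) - \<gamma>' i * \<gamma>' (n - i)) = 2 * \<gamma> n"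
        by (simp add: sum.distrib)
      then show ?thesis by (simp add: sum_subtractf)
    qed
    also have "\<dots> *\<^sub>R p m = e n - 2 *\<^sub>R D n"
      using Suc p_0 by (auto simp: vandermonde one_gchoose e_def D_def scaleR_diff_left)
    finally show ?thesis .
  qed
  have "(\<lambda>n. e n - 2 *\<^sub>R D n) sums (d * d)"
    using Cauchy_product_sums[OF D_summable D_summable] unfolding coeff d_def .
  moreover have "(\<lambda>n. e n - 2 *\<^sub>R D n) sums (- h - 2 *\<^sub>R d)"
    unfolding d_def
    by (intro sums_diff bounded_linear.sums[OF bounded_linear_scaleR_right] D_sums)
      (use sums_single[of 1 "\<lambda>_. - h"] in \<open>simp add: e_def[abs_def]\<close>)
  ultimately have "d * d = - h - 2 *\<^sub>R d" by (rule sums_unique2)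
  then have square: "d + d + d * d = - h" by (simp add: scaleR_2)
  have transfer: "f d = g d" if "bounded_linear f" "bounded_linear g" "\<And>n. f (p n) = g (p n)" for f g :: "'a \<Rightarrow> 'a"
  proof -
    have "f (D n) = g (D n)" for n
      using that by (auto simp: D_def linear_simps bounded_linear.linear linear_cmul linear_0 split: nat.split)
    then show ?thesis
      using bounded_linear.sums[OF that(1) D_sums] bounded_linear.sums[OF that(2) D_sums]
      unfolding d_def by (simp add: sums_unique2)
  qed
  have p_commute: "x * p n = p n * x" if "x * h = h * x" for x n
  proof (induction n)
    case (Suc n)
    have "x * p (Suc n) = (x * h) * p n" by (simp add: p_Suc mult.assoc)
    also have "\<dots> = h * (x * p n)" by (simp add: that mult.assoc)
    also have "\<dots> = p (Suc n) * x" by (simp add: Suc p_Suc mult.assoc)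
    finally show ?case .
  qed (simp add: p_0 that)
  have "star (p n) = p n" for n
    by (induction n) (simp_all add: p_0 p_Suc star_mult sa p_commute)
  then have sa_d: "star d = d"
    using transfer[OF bounded_linear_star bounded_linear_ident] by simp
  have commute: "x * d = d * x" if "x * h = h * x" for x
    using transfer[OF bounded_linear_mult_right[of x] bounded_linear_mult_left[of x]] p_commute[OF that]
    by simp
  show thesis by (rule that[OF sa_d square commute])
qed

text \<open>
  The hypotheses say that \<open>p \<plusminus> \<i> q\<close> has the same absolute square as \<open>z\<close>.
\<close>

lemma norm_add_i:
  fixes p q z :: "'a::cstar_algebra"
  assumes "star p * p + star q * q = star z * z" "star p * q = star q * p"
  shows "norm (p + \<i> *\<^sub>C q) = norm z" "norm (p - \<i> *\<^sub>C q) = norm z"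
proof -
  have "star (p + \<i> *\<^sub>C q) * (p + \<i> *\<^sub>C q) = star z * z"
    "star (p - \<i> *\<^sub>C q) * (p - \<i> *\<^sub>C q) = star z * z"
    using assms by (auto simp: star_simps algebra_simps scaleC_minus_left scaleC_minus_right scaleC_add_right
       scaleC_diff_right mult_scaleC_left mult_scaleC_right scaleC_i_i)
  then have "(norm (p + \<i> *\<^sub>C q))\<^sup>2 = (norm z)\<^sup>2" "(norm (p - \<i> *\<^sub>C q))\<^sup>2 = (norm z)\<^sup>2"
    by (metis cstar_identity)+
  then show "norm (p + \<i> *\<^sub>C q) = norm z" "norm (p - \<i> *\<^sub>C q) = norm z"
    by (simp_all add: power2_eq_iff_nonneg)
qed

text \<open>
  With \<open>c = 1 + d\<close> the hypotheses read \<open>a\<^sup>2 + c\<^sup>2 = 1\<close>, so \<open>u = a + \<i> c\<close> is unitary. The operators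
  \<open>a\<close>, \<open>c\<close> and \<open>2 a c\<close> are the real and imaginary parts of \<open>u\<close> and the imaginary part of \<open>u\<^sup>2\<close>;
  hence they are contractions.
\<close>

lemma unitary_contractions:
  fixes a d :: "'a::cstar_algebra"
  assumes sa: "star a = a" "star d = d" and commute: "a * d = d * a"
    and one: "d + d + d * d = - (a * a)"
  shows "norm (a * z) \<le> norm z" "norm (z + d * z) \<le> norm z"
    "norm (a * (z + d * z)) \<le> norm z / 2"
proof -
  define c where "c z = z + d * z" for z
  have c_add: "c (x + y) = c x + c y" "c (x - y) = c x - c y" "c (r *\<^sub>C x) = r *\<^sub>C c x" for x y r
    by (simp_all add: c_def algebra_simps mult_scaleC_right scaleC_add_right)
  have a_c: "c (a * x) = a * c x" for x
    by (simp add: c_def algebra_simps commute flip: mult.assoc)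
  have one': "x + d * x + (d * x + d * (d * x)) = x - a * (a * x)" for x
    using arg_cong[OF one, of "\<lambda>y. y * x"] by (simp add: algebra_simps)
  have "star (a * z) * (a * z) + star (c z) * c z = star z * z" for z
  proof -
    have "star (a * z) * (a * z) + star (c z) * c z = star z * (a * (a * z) + (z + d * z + (d * z + d * (d * z))))"
      by (simp add: c_def star_simps sa algebra_simps)
    then show ?thesis unfolding one' by simp
  qed
  moreover have "star (a * z) * c z = star (c z) * (a * z)" for z
  proof -
    have "a * (d * z) = d * (a * z)" using commute by (simp flip: mult.assoc)
    then show ?thesis by (simp add: c_def star_simps sa algebra_simps)
  qed
  ultimately have u: "norm (a * z + \<i> *\<^sub>C c z) = norm z" and v: "norm (a * z - \<i> *\<^sub>C c z) = norm z" for z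
    using norm_add_i by blast+
  have half: "norm x \<le> norm z / 2" if "norm p \<le> norm z" "norm q \<le> norm z" "k *\<^sub>C x = p - q" "cmod k = 4"
    for x p q :: 'a and k
  proof -
    have "4 * norm x = norm (p - q)" using that norm_scaleC[of k x] by simp
    also have "\<dots> \<le> norm p + norm q" by (rule norm_triangle_ineq4)
    finally show ?thesis using that by simp
  qed
  have two: "(2 * k) *\<^sub>C x = k *\<^sub>C x + k *\<^sub>C x" for x :: 'a and k
    by (metis mult_2 scaleC_add_left)
  have "2 * norm (a * z) = norm ((a * z + \<i> *\<^sub>C c z) + (a * z - \<i> *\<^sub>C c z))"
    using norm_scaleR[of 2 "a * z"] by (simp add: scaleR_2)
  also have "\<dots> \<le> 2 * norm z" using norm_triangle_ineq[of "a * z + \<i> *\<^sub>C c z" "a * z - \<i> *\<^sub>C c z"] u v by simp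
  finally show "norm (a * z) \<le> norm z" by simp
  have "2 * norm (c z) = norm ((a * z + \<i> *\<^sub>C c z) - (a * z - \<i> *\<^sub>C c z))"
    using norm_scaleC[of "2 * \<i>" "c z"] two[of \<i> "c z"] by simp
  also have "\<dots> \<le> 2 * norm z" using norm_triangle_ineq4[of "a * z + \<i> *\<^sub>C c z" "a * z - \<i> *\<^sub>C c z"] u v by simp
  finally show "norm (z + d * z) \<le> norm z" by (simp add: c_def)
  \<comment> \<open>Apply \<open>u\<close> and its adjoint once more: the difference of the two results is \<open>4 \<i> a c z\<close>.\<close>
  define U where "U = a * z + \<i> *\<^sub>C c z"
  define V where "V = a * z - \<i> *\<^sub>C c z"
  have "(4 * \<i>) *\<^sub>C (a * c z) = (a * U + \<i> *\<^sub>C c U) - (a * V - \<i> *\<^sub>C c V)"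
    using two[of "2 * \<i>" "a * c z"] two[of "\<i>" "a * c z"]
    by (simp add: U_def V_def c_add a_c scaleC_i_i algebra_simps mult_scaleC_right scaleC_add_right scaleC_diff_right)
  then show "norm (a * (z + d * z)) \<le> norm z / 2"
    using half[of "a * U + \<i> *\<^sub>C c U" "a * V - \<i> *\<^sub>C c V" "4 * \<i>" "a * c z"] u v
    by (simp add: c_def U_def V_def norm_mult)
qed

text \<open>
  Both follow from \<open>unitary_contractions\<close>, as \<open>1 - a\<^sup>2 = c\<^sup>2\<close> and \<open>a\<^sup>2 (1 - a\<^sup>2) = (a c)\<^sup>2\<close>.
\<close>

lemma self_adjoint_square_contraction:
  fixes a z :: "'a::cstar_algebra"
  assumes "star a = a" "norm a < 1"
  shows "norm (z - a * (a * z)) \<le> norm z" "norm (a * (a * (z - a * (a * z)))) \<le> norm z / 4"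
proof -
  have "norm (a * a) < 1"
    using assms by (simp add: norm_self_adjoint_square abs_square_less_1)
  then obtain d where d: "star d = d" "d + d + d * d = - (a * a)" "a * d = d * a"
    using sqrt_one_minus[of "a * a"] assms by (metis star_mult mult.assoc)
  define c where "c z = z + d * z" for z
  have cc: "c (c z) = z - a * (a * z)" for z
    using arg_cong[OF d(2), of "\<lambda>y. y * z"] by (simp add: c_def algebra_simps)
  have a_c: "c (a * x) = a * c x" for x
    by (simp add: c_def algebra_simps d(3) flip: mult.assoc)
  note contr = unitary_contractions[OF assms(1) d(1,3,2), folded c_def]
  show "norm (z - a * (a * z)) \<le> norm z"
    using contr(2)[of "c z"] contr(2)[of z] unfolding cc by linarith
  have "a * (a * (z - a * (a * z))) = a * c (a * c z)"
    by (simp add: a_c flip: cc)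
  then show "norm (a * (a * (z - a * (a * z)))) \<le> norm z / 4"
    using contr(3)[of "a * c z"] contr(3)[of z] by simp
qed


text \<open>
  This norm inequality characterizes positivity of a self-adjoint \<open>y\<close> of norm at most \<open>t\<close>: it says that
  the operator \<open>t - y\<close> has norm at most \<open>t\<close>. Unlike order conditions stated by squares, it is stable
  under sums and, for fixed \<open>t\<close>, under weak limits.
\<close>

definition pos_bound :: "real \<Rightarrow> 'a::cstar_algebra \<Rightarrow> bool" where
  "pos_bound t y \<longleftrightarrow> (\<forall>z. norm (t *\<^sub>R z - y * z) \<le> t * norm z)"

lemma pos_boundD: "pos_bound t y \<Longrightarrow> norm (t *\<^sub>R z - y * z) \<le> t * norm z"
  by (simp add: pos_bound_def)

lemma pos_bound_add: "pos_bound s x \<Longrightarrow> pos_bound t y \<Longrightarrow> pos_bound (s + t) (x + y)"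
  unfolding pos_bound_def
proof safe
  fix z assume *: "\<forall>z. norm (s *\<^sub>R z - x * z) \<le> s * norm z" "\<forall>z. norm (t *\<^sub>R z - y * z) \<le> t * norm z"
  have "(s + t) *\<^sub>R z - (x + y) * z = (s *\<^sub>R z - x * z) + (t *\<^sub>R z - y * z)"
    by (simp add: algebra_simps)
  then have "norm ((s + t) *\<^sub>R z - (x + y) * z) \<le> norm (s *\<^sub>R z - x * z) + norm (t *\<^sub>R z - y * z)"
    by (metis norm_triangle_ineq)
  then show "norm ((s + t) *\<^sub>R z - (x + y) * z) \<le> (s + t) * norm z"
    using *[THEN spec[of _ z]] by (simp add: distrib_right)
qed

lemma pos_bound_scaleR: "0 \<le> r \<Longrightarrow> pos_bound t x \<Longrightarrow> pos_bound (r * t) (r *\<^sub>R x)"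
  unfolding pos_bound_def
  by (simp add: mult_left_mono mult.assoc flip: scaleR_scaleR scaleR_diff_right)

lemma pos_bound_zero: "0 \<le> t \<Longrightarrow> pos_bound t 0"
  by (simp add: pos_bound_def)

lemma pos_bound_square:
  assumes "star a = a" "(norm a)\<^sup>2 < t"
  shows "pos_bound t (a * a)"
proof -
  have t: "t > 0" using assms(2) by (metis le_less_trans zero_le_power2)
  define b where "b = (1 / sqrt t) *\<^sub>R a"
  have "norm a < sqrt t" using assms by (simp add: real_less_rsqrt)
  then have "norm b < 1" using t by (simp add: b_def)
  moreover have "star b = b" using assms by (simp add: b_def star_scaleR)
  ultimately have "pos_bound 1 (b * b)"
    using self_adjoint_square_contraction(1)[of b] by (simp add: pos_bound_def mult.assoc)
  then have "pos_bound (t * 1) (t *\<^sub>R (b * b))" using t by (intro pos_bound_scaleR) auto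
  then show ?thesis using t by (simp add: b_def)
qed

text \<open>
  The hypothesis says \<open>-a\<^sup>2 \<ge> 0\<close>. It implies that \<open>1 - s a\<^sup>2\<close> does not shrink any vector for \<open>s \<ge> 0\<close>.
  If \<open>a\<close> were not zero, it could be scaled to \<open>b\<close> with norm \<open>3/4\<close>; then \<open>b\<^sup>2 (1 - b\<^sup>2)\<close>, of norm at most
  \<open>1/4\<close>, would have to be at least as large as \<open>b\<^sup>2\<close>, of norm \<open>9/16\<close>.
\<close>

lemma pos_bound_minus_square:
  assumes "star a = a" "pos_bound t (- (a * a))" "0 \<le> t"
  shows "a = 0"
proof (rule ccontr)
  assume "a \<noteq> 0"
  define s where "s = 3 / (4 * norm a)"
  define b where "b = s *\<^sub>R a"
  have s: "s > 0" using \<open>a \<noteq> 0\<close> by (simp add: s_def)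
  have b: "star b = b" "norm b = 3 / 4"
    using \<open>a \<noteq> 0\<close> assms(1) by (simp_all add: b_def s_def star_scaleR)
  have bb: "norm (b * b) = 9 / 16" unfolding norm_self_adjoint_square[OF b(1)] b(2) by (simp add: power2_eq_square)
  have "star (b * b) = b * b" using b by (simp add: star_mult)
  then have bbbb: "norm ((b * b) * (b * b)) = 81 / 256" 
    by (subst norm_self_adjoint_square) (simp_all add: bb power2_eq_square)
  define w where "w = b * (b * (b * b))"
  define T where "T = s * s * t"
  have "pos_bound T (- (b * b))"
    using pos_bound_scaleR[OF _ assms(2), of "s * s"] s by (simp add: b_def T_def mult.assoc)
  then have le: "norm (T *\<^sub>R w + b * (b * w)) \<le> T * norm w"
    using pos_boundD[of T "- (b * b)" w] by (simp add: mult.assoc)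
  have "T \<ge> 0" using assms s by (simp add: T_def)
  \<comment> \<open>The lower bound \<open>norm w \<le> norm ((1 - b\<^sup>2) w)\<close>.\<close>
  have "(1 + T) * norm w = norm ((1 + T) *\<^sub>R w)" using \<open>T \<ge> 0\<close> by simp
  also have "(1 + T) *\<^sub>R w = (w - b * (b * w)) + (T *\<^sub>R w + b * (b * w))"
    by (simp add: algebra_simps)
  also have "norm \<dots> \<le> norm (w - b * (b * w)) + T * norm w"
    using le norm_triangle_ineq[of "w - b * (b * w)" "T *\<^sub>R w + b * (b * w)"] by linarith
  finally have "norm w \<le> norm (w - b * (b * w))" by (simp add: algebra_simps)
  also have "w - b * (b * w) = b * (b * (b * b - b * (b * (b * b))))"
    by (simp add: w_def algebra_simps)
  also have "norm \<dots> \<le> norm (b * b) / 4"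
    using self_adjoint_square_contraction(2)[of b "b * b"] b by simp
  finally show False using bb bbbb by (simp add: w_def mult.assoc)
qed

text \<open>
  Averaging the squares of the contractions \<open>1 + h/t\<close> and \<open>1 - h/t\<close> shows that \<open>1 + (h/t)\<^sup>2\<close> is a
  contraction, and the preceding lemma applies.
\<close>

lemma pos_bound_antisym:
  assumes "star h = h" "pos_bound t h" "pos_bound t (- h)" "0 \<le> t"
  shows "h = 0"
proof (rule pos_bound_minus_square[OF assms(1)])
  show "pos_bound (t * t) (- (h * h))"
    unfolding pos_bound_def
  proof
    fix z
    have "norm (t *\<^sub>R (t *\<^sub>R z - h * z) - h * (t *\<^sub>R z - h * z)) \<le> t * norm (t *\<^sub>R z - h * z)"
      by (rule pos_boundD[OF assms(2)])
    also have "\<dots> \<le> t * (t * norm z)" by (intro mult_left_mono pos_boundD assms)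
    finally have 1: "norm (t *\<^sub>R (t *\<^sub>R z - h * z) - h * (t *\<^sub>R z - h * z)) \<le> t * (t * norm z)" .
    have "norm (t *\<^sub>R (t *\<^sub>R z + h * z) + h * (t *\<^sub>R z + h * z)) \<le> t * norm (t *\<^sub>R z + h * z)"
      using pos_boundD[OF assms(3), of "t *\<^sub>R z + h * z"] by simp
    also have "\<dots> \<le> t * (t * norm z)" using pos_boundD[OF assms(3), of z] assms(4) by (intro mult_left_mono) auto
    finally have 2: "norm (t *\<^sub>R (t *\<^sub>R z + h * z) + h * (t *\<^sub>R z + h * z)) \<le> t * (t * norm z)" .
    define x where "x = (t * t) *\<^sub>R z - (- (h * h)) * z"
    have "x + x = (t *\<^sub>R (t *\<^sub>R z - h * z) - h * (t *\<^sub>R z - h * z)) + (t *\<^sub>R (t *\<^sub>R z + h * z) + h * (t *\<^sub>R z + h * z))"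
      by (simp add: x_def algebra_simps)
    then have "2 * norm x \<le> 2 * (t * (t * norm z))"
      using 1 2 norm_triangle_ineq[of "t *\<^sub>R (t *\<^sub>R z - h * z) - h * (t *\<^sub>R z - h * z)" "t *\<^sub>R (t *\<^sub>R z + h * z) + h * (t *\<^sub>R z + h * z)"]
        norm_scaleR[of 2 x] by (simp add: scaleR_2)
    then show "norm ((t * t) *\<^sub>R z - (- (h * h)) * z) \<le> (t * t) * norm z" by (simp add: x_def)
  qed
qed simp

text \<open>
  One square is minus the sum of the others, which has the positivity bound.
\<close>

lemma sum_squares_eq_0:
  assumes "finite I" "\<And>i. i \<in> I \<Longrightarrow> star (a i) = (a i :: 'a::cstar_algebra)"
    and "(\<Sum>i\<in>I. a i * a i) = 0" and "i \<in> I"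
  shows "a i = 0"
proof -
  \<comment> \<open>Partial sums have a positivity bound, by induction.\<close>
  have "\<exists>t\<ge>0. pos_bound t (\<Sum>i\<in>K. a i * a i)" if "K \<subseteq> I" for K
  proof -
    have "finite K" using that assms(1) finite_subset by blast
    then show ?thesis using that
    proof induction
      case empty
      then show ?case using pos_bound_zero[of 0] by auto
    next
      case (insert k K)
      then obtain t where "t \<ge> 0" "pos_bound t (\<Sum>i\<in>K. a i * a i)" by auto
      moreover have "pos_bound ((norm (a k))\<^sup>2 + 1) (a k * a k)"
        using insert.prems assms(2) by (intro pos_bound_square) auto
      ultimately show ?case using insert.hyps
        by (intro exI[of _ "((norm (a k))\<^sup>2 + 1) + t"]) (auto intro: pos_bound_add)
    qed
  qed
  from this[of "I - {i}"] obtain t where t: "t \<ge> 0" "pos_bound t (\<Sum>i\<in>I - {i}. a i * a i)" by auto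
  have "(\<Sum>i\<in>I - {i}. a i * a i) = - (a i * a i)"
    using assms by (simp add: sum.remove eq_neg_iff_add_eq_0 add.commute)
  then show ?thesis using pos_bound_minus_square[of "a i" t] t assms by simp
qed

text \<open>
  Real and imaginary part of \<open>w\<close>, up to the factor 2.
\<close>

lemma self_adjoint_parts:
  fixes w :: "'a::cstar_algebra"
  defines "A \<equiv> w + star w" and "B \<equiv> \<i> *\<^sub>C (w - star w)"
  shows "star A = A" "star B = B" "A * A + B * B = 2 *\<^sub>R (w * star w + star w * w)"
    "2 *\<^sub>R w = A - \<i> *\<^sub>C B"
proof -
  show "star A = A" by (simp add: A_def star_simps add.commute)
  show "star B = B" by (simp add: B_def star_simps scaleC_minus_left scaleC_diff_right)
  show "A * A + B * B = 2 *\<^sub>R (w * star w + star w * w)"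
    by (simp add: A_def B_def mult_scaleC_left mult_scaleC_right scaleC_i_i scaleR_2 algebra_simps)
  show "2 *\<^sub>R w = A - \<i> *\<^sub>C B"
    by (simp add: A_def B_def scaleC_i_i scaleR_2)
qed

text \<open>
  The products \<open>w\<^sub>k\<^sub>l = z\<^sub>k z\<^sub>l*\<close> satisfy \<open>w\<^sub>k\<^sub>l* = w\<^sub>l\<^sub>k\<close>, so that \<open>\<Sum> w w*\<close> and \<open>\<Sum> w* w\<close> agree over all
  pairs, and both vanish with \<open>\<Sum> z* z\<close>. Adding them gives a vanishing sum of squares of
  self-adjoint elements. This avoids the theorem that \<open>z* z\<close> has positive spectrum.
\<close>

lemma sum_star_mult_self_eq_0:
  assumes "finite I" "(\<Sum>i\<in>I. star (z i) * (z i :: 'a::cstar_algebra)) = 0" "i \<in> I"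
  shows "z i = 0"
proof -
  define w where "w p = z (fst p) * star (z (snd p))" for p
  define A where "A p = w p + star (w p)" for p
  define B where "B p = \<i> *\<^sub>C (w p - star (w p))" for p
  note AB = self_adjoint_parts[of "w p" for p, folded A_def B_def]
  have star_w: "star (w (k, l)) = w (l, k)" for k l by (simp add: w_def star_simps)
  have sum0: "(\<Sum>p\<in>I \<times> I. w p * star (w p)) = 0"
  proof -
    have "(\<Sum>p\<in>I \<times> I. w p * star (w p)) = (\<Sum>k\<in>I. \<Sum>l\<in>I. z k * (star (z l) * z l) * star (z k))"
      by (simp add: sum.cartesian_product w_def star_simps mult.assoc case_prod_beta)
    also have "\<dots> = (\<Sum>k\<in>I. z k * (\<Sum>l\<in>I. star (z l) * z l) * star (z k))"
      by (simp add: sum_distrib_left sum_distrib_right)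
    finally show ?thesis using assms by simp
  qed
  have "(\<Sum>p\<in>I \<times> I. star (w p) * w p) = (\<Sum>k\<in>I. \<Sum>l\<in>I. w (l, k) * star (w (l, k)))"
    by (auto simp: sum.cartesian_product star_w intro!: sum.cong)
  also have "\<dots> = (\<Sum>p\<in>I \<times> I. w p * star (w p))"
    by (subst sum.swap) (simp add: sum.cartesian_product)
  finally have sum0': "(\<Sum>p\<in>I \<times> I. star (w p) * w p) = 0" using sum0 by simp
  \<comment> \<open>Both kinds of self-adjoint parts are put into a single family.\<close>
  define C where "C q = (if snd q then A (fst q) else B (fst q))" for q
  have "(\<Sum>q\<in>(I \<times> I) \<times> UNIV. C q * C q) = (\<Sum>p\<in>I \<times> I. \<Sum>b\<in>UNIV. C (p, b) * C (p, b))"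
    by (simp add: sum.cartesian_product)
  also have "\<dots> = (\<Sum>p\<in>I \<times> I. A p * A p + B p * B p)" by (simp add: UNIV_bool C_def add.commute)
  also have "\<dots> = 2 *\<^sub>R ((\<Sum>p\<in>I \<times> I. w p * star (w p)) + (\<Sum>p\<in>I \<times> I. star (w p) * w p))"
    by (simp add: AB(3) scaleR_sum_right[symmetric] sum.distrib)
  also have "\<dots> = 0" using sum0 sum0' by simp
  finally have "C q = 0" if "q \<in> (I \<times> I) \<times> UNIV" for q
    using sum_squares_eq_0[of "(I \<times> I) \<times> UNIV" C q] that assms(1) AB by (auto simp: C_def)
  from this[of "((i, i), True)"] this[of "((i, i), False)"] have "A (i, i) = 0" "B (i, i) = 0"
    using assms by (auto simp: C_def)
  then have "w (i, i) = 0" using AB(4)[of "(i, i)"] by simp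
  then show ?thesis by (simp add: w_def mult_star_self_eq_0)
qed

lemma sum_mult_star_self_eq_0:
  assumes "finite I" "(\<Sum>i\<in>I. z i * star (z i :: 'a::cstar_algebra)) = 0" "i \<in> I"
  shows "z i = 0"
  using sum_star_mult_self_eq_0[of I "\<lambda>i. star (z i)" i] assms by (metis (no_types, lifting) star_star star_0 sum.cong)

lemma positive_add_eq_0:
  assumes "positive x" "positive y" "x + y = (0 :: 'a::cstar_algebra)"
  shows "x = 0"
proof -
  obtain u v where uv: "x = star u * u" "y = star v * v" using assms by (auto simp: positive_def)
  define z where "z b = (if b then u else v)" for b
  have "(\<Sum>b\<in>UNIV. star (z b) * z b) = 0" using assms uv by (simp add: UNIV_bool z_def add.commute)
  then have "z True = 0" using sum_star_mult_self_eq_0[of UNIV z True] by simp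
  then show ?thesis by (simp add: z_def uv)
qed

section \<open>Hereditary subalgebras and automorphisms\<close>

text \<open>
  If \<open>h\<close> is a self-adjoint element of norm less than 1, then \<open>v* (1 - h) v\<close> and \<open>v* (1 + h) v\<close> are of
  the form \<open>z* z\<close> by the square root lemma, so the first lies between \<open>0\<close> and \<open>2 v* v\<close>, hence in \<open>Y\<close>.
  The general case follows by scaling, real and imaginary parts, and polarization.
\<close>

lemma hereditary_bimodule:
  assumes Y: "hereditary_cstar_subalgebra Y" and y: "y \<in> Y" "y' \<in> Y"
  shows "y * x * y' \<in> (Y :: 'a::cstar_algebra set)"
proof -
  have sub: "csubspace Y" and star: "star v \<in> Y" and mult: "v * w \<in> Y" if "v \<in> Y" "w \<in> Y" for v w
    using Y that by (auto simp: hereditary_cstar_subalgebra_def cstar_subalgebra_def)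
  note sub = sub[OF y]
  note add = complex_space.subspace_add[OF sub] and diff = complex_space.subspace_diff[OF sub]
    and scale = complex_space.subspace_scale[OF sub]
  have small: "star v * h * v \<in> Y" if h: "star h = h" "norm h < 1" and v: "v \<in> Y" for h v
  proof -
    have pos: "positive (star v * v - star v * k * v)" if k: "star k = k" "norm k < 1" for k
    proof -
      obtain d where d: "star d = d" "d + d + d * d = - k" using sqrt_one_minus[OF k(2,1)] by blast
      have eq: "v - k * v = v + d * v + (d * v + d * (d * v))"
        using arg_cong[OF d(2), of "\<lambda>x. x * v"] by (simp add: algebra_simps)
      then have "star v * (v - k * v) = star (v + d * v) * (v + d * v)"
        unfolding eq by (simp add: star_simps d(1) algebra_simps)
      then show ?thesis unfolding positive_def by (metis right_diff_distrib mult.assoc)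
    qed
    have "positive (star v * v - star v * h * v)"
      "positive (star v * v + star v * v - (star v * v - star v * h * v))"
      using pos[of h] pos[of "- h"] h by (simp_all add: star_uminus algebra_simps)
    moreover have "star v * v \<in> Y" using v star mult by blast
    ultimately have "star v * v - star v * h * v \<in> Y"
      using Y add unfolding hereditary_cstar_subalgebra_def by blast
    then have "star v * v - (star v * v - star v * h * v) \<in> Y" using diff \<open>star v * v \<in> Y\<close> by blast
    then show ?thesis by simp
  qed
  have sa: "star v * h * v \<in> Y" if h: "star h = h" and v: "v \<in> Y" for h v
  proof -
    define r where "r = 1 / (norm h + 1)"
    have r: "0 < r" "r * norm h < 1" using norm_ge_zero[of h]
      by (auto simp: r_def field_simps add_pos_nonneg simp del: norm_ge_zero)
    have "star v * (r *\<^sub>R h) * v \<in> Y" using r h v by (intro small) (auto simp: star_scaleR)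
    then have "(1 / r) *\<^sub>R (star v * (r *\<^sub>R h) * v) \<in> Y" unfolding scaleC_eq_scaleR by (rule scale)
    then show ?thesis using r by simp
  qed
  have diag: "star v * x * v \<in> Y" if v: "v \<in> Y" for v
  proof -
    define A where "A = x + star x"
    define B where "B = \<i> *\<^sub>C (x - star x)"
    note AB = self_adjoint_parts[of x, folded A_def B_def]
    have "star v * A * v - \<i> *\<^sub>C (star v * B * v) \<in> Y"
      using AB v by (intro diff scale sa)
    then have "star v * (2 *\<^sub>R x) * v \<in> Y"
      unfolding AB(4) by (simp add: algebra_simps mult_scaleC_left mult_scaleC_right)
    then have "(1/2) *\<^sub>R (star v * (2 *\<^sub>R x) * v) \<in> Y" unfolding scaleC_eq_scaleR by (rule scale)
    then show ?thesis by simp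
  qed
  define u where "u = star y"
  have u: "u \<in> Y" using y star by (auto simp: u_def)
  \<comment> \<open>Polarization over the fourth roots of unity.\<close>
  define f where "f c = cnj c *\<^sub>C (star (u + c *\<^sub>C y') * x * (u + c *\<^sub>C y'))" for c
  have f: "f c \<in> Y" for c unfolding f_def using u y by (intro scale diag add)
  define P Q R S where "P = star u * x * u" and "Q = star u * x * y'" and "R = star y' * x * u" and "S = star y' * x * y'"
  have f_eq: "f c = cnj c *\<^sub>C P + (c * cnj c) *\<^sub>C Q + (cnj c * cnj c) *\<^sub>C R + (c * cnj c * cnj c) *\<^sub>C S" for c
    by (simp add: f_def P_def Q_def R_def S_def star_add star_scaleC distrib_left distrib_right
        scaleC_add_right mult_scaleC_left mult_scaleC_right scaleC_scaleC mult_ac[where 'a = complex])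
  have "f 1 + f (- 1) + f \<i> + f (- \<i>) = Q + Q + (Q + Q)"
    by (simp add: f_eq scaleC_one scaleC_minus_left)
  also have "\<dots> = (2 + 2) *\<^sub>R Q" unfolding scaleR_add_left scaleR_2 ..
  finally have "f 1 + f (- 1) + f \<i> + f (- \<i>) = 4 *\<^sub>R (star u * x * y')" by (simp add: Q_def)
  moreover have "f 1 + f (- 1) + f \<i> + f (- \<i>) \<in> Y" by (intro add f)
  ultimately have "(1/4) *\<^sub>R (4 *\<^sub>R (star u * x * y')) \<in> Y"
    unfolding scaleC_eq_scaleR by (metis scale)
  then show ?thesis by (simp add: u_def star_star)
qed

text \<open>
  An automorphism maps a decomposition \<open>b\<^sup>2 + (1 + d)\<^sup>2 = 1\<close> to one of the same form, so
  \<open>unitary_contractions\<close> bounds the image.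
\<close>

lemma star_automorphism_contracts_self_adjoint:
  assumes "star_automorphism f" "star a = a"
  shows "norm (f a) \<le> norm (a :: 'a::cstar_algebra)"
proof -
  have f: "f (x + y) = f x + f y" "f (c *\<^sub>C x) = c *\<^sub>C f x" "f (x * y) = f x * f y" "star (f x) = f (star x)" for x y c
    using assms(1) by (auto simp: star_automorphism_def)
  have le1: "norm (f b) \<le> 1" if b: "star b = b" "norm b < 1" for b
  proof -
    have "norm (b * b) < 1" using b by (simp add: norm_self_adjoint_square abs_square_less_1)
    then obtain d where d: "star d = d" "d + d + d * d = - (b * b)" "b * d = d * b"
      using sqrt_one_minus[of "b * b"] b by (metis star_mult mult.assoc)
    have "f b * f d = f d * f b" using d(3) by (metis f(3))
    moreover have "f d + f d + f d * f d = - (f b * f b)"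
    proof -
      have "f (- x) = - f x" for x using f(2)[of "-1" x] by (simp add: scaleC_minus_left scaleC_one)
      then show ?thesis using d(2) by (metis f(1,3))
    qed
    ultimately have "norm (f b * f b) \<le> norm (f b)"
      using b d by (intro unitary_contractions(1)[of _ "f d"]) (auto simp: f(4))
    moreover have "norm (f b * f b) = norm (f b) * norm (f b)"
      using b norm_self_adjoint_square[of "f b"] by (simp add: f(4) power2_eq_square)
    ultimately show ?thesis by (cases "norm (f b) = 0") (auto simp: mult_le_cancel_right1)
  qed
  show ?thesis
  proof (rule field_le_epsilon)
    fix e :: real assume e: "e > 0"
    define r where "r = 1 / (norm a + e)"
    have r: "r > 0" "r * norm a < 1" using e norm_ge_zero[of a]
      by (auto simp: r_def field_simps add_nonneg_pos simp del: norm_ge_zero)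
    have "norm (f (r *\<^sub>R a)) \<le> 1" using r assms(2) by (intro le1) (auto simp: star_scaleR)
    moreover have "f (r *\<^sub>R a) = r *\<^sub>R f a" unfolding scaleC_eq_scaleR by (rule f(2))
    ultimately show "norm (f a) \<le> norm a + e" using r e norm_ge_zero[of a] by (simp add: r_def field_simps add_nonneg_pos del: norm_ge_zero)
  qed
qed

section \<open>The weak topology of a dual pair\<close>

lemma continuous_map_compose_continuous_on:
  assumes "continuous_map X euclidean f" "continuous_on UNIV g"
  shows "continuous_map X euclidean (\<lambda>x. g (f x))"
  using continuous_map_compose[of X euclidean f euclidean g] assms by (simp add: o_def)

locale cstar_pair =
  fixes F :: "('a::cstar_algebra \<Rightarrow>\<^sub>L complex) set"
  assumes cstar_dual_pair: "cstar_dual_pair F"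
begin

abbreviation "W \<equiv> weak_topology F"

lemma dual_pair: "dual_pair F"
  using cstar_dual_pair by (simp add: cstar_dual_pair_def)

lemma functional_scaleC: "\<phi> \<in> F \<Longrightarrow> blinfun_apply \<phi> (c *\<^sub>C x) = c * blinfun_apply \<phi> x"
  and zero_functional: "0 \<in> F"
  and functional_add: "\<phi> \<in> F \<Longrightarrow> \<psi> \<in> F \<Longrightarrow> \<phi> + \<psi> \<in> F"
  and functional_mult: "\<phi> \<in> F \<Longrightarrow> blinfun_mult_right c o\<^sub>L \<phi> \<in> F"
  and norm_eq_SUP: "norm x = (SUP \<phi>\<in>{\<phi>\<in>F. norm \<phi> \<le> 1}. cmod (blinfun_apply \<phi> x))"
  and compact_convex_hull: "relatively_compactin W S \<Longrightarrow> relatively_compactin W (convex hull S)"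
  using dual_pair unfolding dual_pair_def by blast+

lemma continuous_star: "continuous_map W W star"
  and continuous_mult_left: "continuous_map W W (\<lambda>x. a * x)"
  and continuous_mult_right: "continuous_map W W (\<lambda>x. x * a)"
  using cstar_dual_pair unfolding cstar_dual_pair_def by blast+

lemma topspace_weak [simp]: "topspace W = UNIV"
proof -
  have "UNIV \<in> {{x. blinfun_apply \<phi> x \<in> U} | \<phi> U. \<phi> \<in> F \<and> open U}"
    using zero_functional by (intro CollectI exI[of _ 0] exI[of _ UNIV]) auto
  then show ?thesis unfolding weak_topology_def topology_generated_by_topspace by blast
qed

lemma continuous_functional:
  assumes "\<phi> \<in> F" shows "continuous_map W euclidean (blinfun_apply \<phi>)"
  unfolding continuous_map_def
proof (intro conjI allI impI)
  fix U :: "complex set" assume "openin euclidean U"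
  then have "{x. blinfun_apply \<phi> x \<in> U} \<in> {{x. blinfun_apply \<phi> x \<in> U} | \<phi> U. \<phi> \<in> F \<and> open U}"
    using assms by auto
  then have "openin W {x. blinfun_apply \<phi> x \<in> U}"
    unfolding weak_topology_def by (rule topology_generated_by_Basis)
  then show "openin W {x \<in> topspace W. blinfun_apply \<phi> x \<in> U}" by simp
qed auto

lemma continuous_functional_compose:
  "\<phi> \<in> F \<Longrightarrow> continuous_map X W f \<Longrightarrow> continuous_map X euclidean (\<lambda>x. blinfun_apply \<phi> (f x))"
  using continuous_map_compose[OF _ continuous_functional] by (simp add: o_def)

lemma continuous_map_into_weak:
  assumes "\<And>\<phi>. \<phi> \<in> F \<Longrightarrow> continuous_map X euclidean (\<lambda>x. blinfun_apply \<phi> (f x))"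
  shows "continuous_map X W f"
  unfolding weak_topology_def
proof (rule continuous_on_generated_topo)
  fix V assume "V \<in> {{x. blinfun_apply \<phi> x \<in> U} | \<phi> U. \<phi> \<in> F \<and> open U}"
  then obtain \<phi> U where V: "\<phi> \<in> F" "open U" "V = {x. blinfun_apply \<phi> x \<in> U}" by auto
  have "openin X {x \<in> topspace X. blinfun_apply \<phi> (f x) \<in> U}"
    using assms[OF V(1)] V(2) unfolding continuous_map_def by auto
  then show "openin X (f -` V \<inter> topspace X)" by (simp add: V(3) vimage_def Int_def conj_commute)
next
  show "f ` topspace X \<subseteq> \<Union> {{x. blinfun_apply \<phi> x \<in> U} | \<phi> U. \<phi> \<in> F \<and> open U}"
    using topspace_weak unfolding weak_topology_def topology_generated_by_topspace by simp
qed

lemma weak_continuous_add: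
  "continuous_map X W f \<Longrightarrow> continuous_map X W g \<Longrightarrow> continuous_map X W (\<lambda>x. f x + g x)"
  by (intro continuous_map_into_weak)
     (simp add: blinfun.add_right continuous_map_add continuous_functional_compose)

lemma weak_continuous_scaleC:
  "continuous_map X W f \<Longrightarrow> continuous_map X W (\<lambda>x. c *\<^sub>C f x)"
  using continuous_map_compose_continuous_on[OF continuous_functional_compose, of _ X f "\<lambda>z. c * z"]
  by (intro continuous_map_into_weak) (simp add: functional_scaleC continuous_intros)

lemma weak_continuous_diff:
  assumes "continuous_map X W f" "continuous_map X W g" shows "continuous_map X W (\<lambda>x. f x - g x)"
  using weak_continuous_add[OF assms(1) weak_continuous_scaleC[OF assms(2), of "-1"]]
  by (simp add: scaleC_minus_left scaleC_one)

lemma norm_le_if_functionals_le: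
  assumes "\<And>\<phi>. \<phi> \<in> F \<Longrightarrow> norm \<phi> \<le> 1 \<Longrightarrow> cmod (blinfun_apply \<phi> x) \<le> r"
  shows "norm x \<le> r"
  unfolding norm_eq_SUP[of x] using zero_functional assms by (intro cSUP_least) auto

lemma functionals_separate:
  assumes "\<And>\<phi>. \<phi> \<in> F \<Longrightarrow> blinfun_apply \<phi> x = blinfun_apply \<phi> y" shows "x = y"
  using norm_le_if_functionals_le[of "x - y" 0] assms by (simp add: blinfun.diff_right)

lemma Hausdorff_weak: "Hausdorff_space W"
  unfolding Hausdorff_space_def topspace_weak
proof safe
  fix x y :: 'a assume "x \<noteq> y"
  then obtain \<phi> where \<phi>: "\<phi> \<in> F" "blinfun_apply \<phi> x \<noteq> blinfun_apply \<phi> y"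
    using functionals_separate by blast
  then obtain U V where UV: "open U" "open V" "blinfun_apply \<phi> x \<in> U" "blinfun_apply \<phi> y \<in> V" "U \<inter> V = {}"
    using hausdorff by metis
  have "openin W {z. blinfun_apply \<phi> z \<in> U}" "openin W {z. blinfun_apply \<phi> z \<in> V}"
    using continuous_functional[OF \<phi>(1)] UV unfolding continuous_map_def by auto
  then show "\<exists>U V. openin W U \<and> openin W V \<and> x \<in> U \<and> y \<in> V \<and> disjnt U V"
    using UV by (intro exI[of _ "{z. blinfun_apply \<phi> z \<in> U}"] exI[of _ "{z. blinfun_apply \<phi> z \<in> V}"]) (auto simp: disjnt_def)
qed

lemma weak_closure_eq:
  assumes "x \<in> W closure_of S" "continuous_map W W f" "continuous_map W W g" "\<And>y. y \<in> S \<Longrightarrow> f y = g y"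
  shows "f x = g x"
  using forall_in_closure_of_eq[OF assms(1) Hausdorff_weak assms(2,3)] assms(4) by blast

lemma weakly_closed_equalizer:
  assumes "continuous_map W W f" "continuous_map W W g"
  shows "closedin W {x. f x = g x}"
  using closedin_continuous_maps_eq[OF Hausdorff_weak assms] by simp

lemma continuous_const: "continuous_map X W (\<lambda>x. c)"
  by simp

text \<open>
  Balls are weakly closed because \<open>F\<close> is norming.
\<close>

lemma weakly_closed_norm_le:
  assumes "continuous_map W W f" shows "closedin W {x. norm (f x) \<le> r}"
proof -
  have "{x. norm (f x) \<le> r} = (\<Inter>\<phi>\<in>{\<phi>\<in>F. norm \<phi> \<le> 1}. {x \<in> topspace W. blinfun_apply \<phi> (f x) \<in> cball 0 r})"
  proof safe
    fix x and \<phi> :: "'a \<Rightarrow>\<^sub>L complex" assume *: "norm (f x) \<le> r" "norm \<phi> \<le> 1"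
    have "cmod (blinfun_apply \<phi> (f x)) \<le> norm \<phi> * norm (f x)" by (rule norm_blinfun)
    also have "\<dots> \<le> 1 * r" using * by (intro mult_mono) auto
    finally show "blinfun_apply \<phi> (f x) \<in> cball 0 r" by simp
  qed (auto intro!: norm_le_if_functionals_le)
  moreover have "closedin W {x \<in> topspace W. blinfun_apply \<phi> (f x) \<in> cball 0 r}" if "\<phi> \<in> F" for \<phi>
    using continuous_functional_compose[OF that assms]
    by (intro closedin_continuous_map_preimage[of W euclidean]) auto
  ultimately show ?thesis
    using zero_functional by (auto intro!: closedin_Inter)
qed

lemma weakly_closed_imp_closed:
  assumes "closedin W S" shows "closed S"
proof -
  have "continuous_map euclidean W (\<lambda>x. x)"
    by (intro continuous_map_into_weak) (simp add: linear_continuous_on[OF blinfun.bounded_linear_right])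
  then have "closedin euclidean {x \<in> topspace euclidean. x \<in> S}"
    using assms by (rule closedin_continuous_map_preimage)
  then show ?thesis by simp
qed

lemma weak_neighbourhood:
  assumes "openin W U" "x \<in> U"
  shows "\<exists>\<Phi> \<delta>. finite \<Phi> \<and> \<Phi> \<subseteq> F \<and> \<delta> > 0 \<and> (\<forall>y. (\<forall>\<phi>\<in>\<Phi>. cmod (blinfun_apply \<phi> (y - x)) < \<delta>) \<longrightarrow> y \<in> U)"
proof -
  have "generate_topology_on {{x. blinfun_apply \<phi> x \<in> U} | \<phi> U. \<phi> \<in> F \<and> open U} U"
    using assms(1) unfolding weak_topology_def by (simp add: openin_topology_generated_by_iff)
  then show ?thesis using assms(2)
  proof (induction)
    case (Int a b)
    have x: "x \<in> a" "x \<in> b" using Int.prems by auto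
    from Int.IH(1)[OF x(1)] obtain \<Phi> \<delta> where 1: "finite \<Phi>" "\<Phi> \<subseteq> F" "\<delta> > 0"
      "\<And>y. (\<forall>\<phi>\<in>\<Phi>. cmod (blinfun_apply \<phi> (y - x)) < \<delta>) \<Longrightarrow> y \<in> a" by blast
    from Int.IH(2)[OF x(2)] obtain \<Psi> \<epsilon> where 2: "finite \<Psi>" "\<Psi> \<subseteq> F" "\<epsilon> > 0"
      "\<And>y. (\<forall>\<phi>\<in>\<Psi>. cmod (blinfun_apply \<phi> (y - x)) < \<epsilon>) \<Longrightarrow> y \<in> b" by blast
    show ?case using 1(1-3) 2(1-3)
      by (intro exI[of _ "\<Phi> \<union> \<Psi>"] exI[of _ "min \<delta> \<epsilon>"]) (auto intro!: 1(4) 2(4))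
  next
    case (UN K)
    then show ?case by (metis UnionE UnionI)
  next
    case (Basis s)
    then obtain \<phi> V where s: "s = {x. blinfun_apply \<phi> x \<in> V}" "\<phi> \<in> F" "open V" by auto
    then obtain \<delta> where "\<delta> > 0" "ball (blinfun_apply \<phi> x) \<delta> \<subseteq> V"
      using Basis.prems by (auto simp: open_contains_ball)
    then show ?case using s
      by (intro exI[of _ "{\<phi>}"] exI[of _ \<delta>]) (auto simp: blinfun.diff_right dist_norm norm_minus_commute)
  qed auto
qed

text \<open>
  A functional that vanishes on the common kernel of finitely many functionals is a combination of them.
  In the induction step either \<open>\<phi>\<close> vanishes on the common kernel of the others and can be dropped, or
  that kernel contains some \<open>v\<close> with \<open>\<phi> v \<noteq> 0\<close>, and \<open>g - (g v / \<phi> v) \<phi>\<close> vanishes on it.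
\<close>

lemma functional_in_span:
  assumes "finite \<Phi>" "\<Phi> \<subseteq> F"
    and "\<And>x y. g (x + y) = g x + (g y :: complex)" "\<And>c x. g (c *\<^sub>C x) = c * g x"
    and "\<And>x. (\<And>\<phi>. \<phi> \<in> \<Phi> \<Longrightarrow> blinfun_apply \<phi> x = 0) \<Longrightarrow> g x = 0"
  shows "\<exists>\<psi>\<in>F. \<forall>x. blinfun_apply \<psi> x = g x"
  using assms
proof (induction \<Phi> arbitrary: g)
  case empty
  then show ?case using zero_functional by (intro bexI[of _ 0]) auto
next
  case (insert \<phi> \<Phi>)
  note g = insert.prems(2,3)
  have \<phi>: "\<phi> \<in> F" and \<Phi>: "\<Phi> \<subseteq> F" using insert.prems by auto
  show ?case
  proof (cases "\<exists>v. blinfun_apply \<phi> v \<noteq> 0 \<and> (\<forall>\<psi>\<in>\<Phi>. blinfun_apply \<psi> v = 0)")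
    case True
    then obtain v where v: "blinfun_apply \<phi> v \<noteq> 0" "\<And>\<psi>. \<psi> \<in> \<Phi> \<Longrightarrow> blinfun_apply \<psi> v = 0" by blast
    define c where "c = g v / blinfun_apply \<phi> v"
    have "\<exists>\<psi>\<in>F. \<forall>x. blinfun_apply \<psi> x = g x - c * blinfun_apply \<phi> x"
    proof (rule insert.IH[OF \<Phi>])
      fix x assume x: "\<And>\<psi>. \<psi> \<in> \<Phi> \<Longrightarrow> blinfun_apply \<psi> x = 0"
      define k where "k = - (blinfun_apply \<phi> x / blinfun_apply \<phi> v)"
      have "g (x + k *\<^sub>C v) = 0"
      proof (rule insert.prems(4))
        fix \<psi> assume "\<psi> \<in> insert \<phi> \<Phi>"
        then show "blinfun_apply \<psi> (x + k *\<^sub>C v) = 0"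
          using v x \<phi> \<Phi> by (auto simp: blinfun.add_right functional_scaleC subset_iff k_def blinfun.diff_right)
      qed
      then have "g x + k * g v = 0" unfolding g .
      then show "g x - c * blinfun_apply \<phi> x = 0" using v by (simp add: c_def k_def field_simps)
    qed (simp_all add: g blinfun.add_right functional_scaleC \<phi> algebra_simps)
    then obtain \<psi> where \<psi>: "\<psi> \<in> F" "\<And>x. blinfun_apply \<psi> x = g x - c * blinfun_apply \<phi> x" by blast
    then show ?thesis
      by (intro bexI[of _ "\<psi> + (blinfun_mult_right c o\<^sub>L \<phi>)"] functional_add functional_mult \<phi>)
         (auto simp: blinfun.add_left)
  next
    case False
    then show ?thesis using insert.prems(4) by (intro insert.IH[OF \<Phi> g]) blast
  qed
qed

text \<open>
  Continuity at \<open>0\<close> bounds \<open>g\<close> on a neighbourhood that contains the common kernel of finitely many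
  functionals, so \<open>g\<close> vanishes on that kernel.
\<close>

lemma weakly_continuous_functional:
  assumes "continuous_map W euclidean g"
    and g: "\<And>x y. g (x + y) = g x + (g y :: complex)" "\<And>c x. g (c *\<^sub>C x) = c * g x"
  shows "\<exists>\<psi>\<in>F. \<forall>x. blinfun_apply \<psi> x = g x"
proof -
  have g0: "g 0 = 0" using g(2)[of 0 0] by simp
  have "openin W {x \<in> topspace W. g x \<in> ball 0 1}"
    using assms(1) by (rule openin_continuous_map_preimage) (simp flip: open_openin)
  from weak_neighbourhood[OF this, of 0] obtain \<Phi> \<delta> where \<Phi>: "finite \<Phi>" "\<Phi> \<subseteq> F" "\<delta> > 0"
    and small: "\<And>y. (\<forall>\<phi>\<in>\<Phi>. cmod (blinfun_apply \<phi> y) < \<delta>) \<Longrightarrow> cmod (g y) < 1"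
    using g0 by auto
  show ?thesis
  proof (rule functional_in_span[OF \<Phi>(1,2) g])
    fix x assume x: "\<And>\<phi>. \<phi> \<in> \<Phi> \<Longrightarrow> blinfun_apply \<phi> x = 0"
    have "cmod (g ((1 / g x) *\<^sub>C x)) < 1"
      by (rule small) (use x \<Phi> in \<open>auto simp: functional_scaleC subset_iff\<close>)
    then show "g x = 0" by (cases "g x = 0") (auto simp: g)
  qed
qed

lemma functional_compose:
  assumes "\<phi> \<in> F" "continuous_map W W f" "\<And>x y. f (x + y) = f x + f y" "\<And>c x. f (c *\<^sub>C x) = c *\<^sub>C f x"
  shows "\<exists>\<psi>\<in>F. \<forall>x. blinfun_apply \<psi> x = blinfun_apply \<phi> (f x)"
  using continuous_functional_compose[OF assms(1,2)] assms
  by (intro weakly_continuous_functional) (auto simp: blinfun.add_right functional_scaleC)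

end

section \<open>Weak integrals over a compact group\<close>

locale cstar_system = cstar_pair F
  for F :: "('a::cstar_algebra \<Rightarrow>\<^sub>L complex) set" +
  fixes G :: "('g, 'm) monoid_scheme" (structure)
    and T :: "'g topology"
    and \<alpha> :: "'g \<Rightarrow> 'a \<Rightarrow> 'a"
    and \<mu> :: "'g measure"
  assumes system: "dynamical_system F G T \<alpha>"
    and haar: "normalized_haar_measure G T \<mu>"
begin

sublocale compact_topological_group G T
  using system by (simp add: dynamical_system_def)

sublocale prob_space \<mu>
  using haar by (simp add: normalized_haar_measure_def)

lemma space_haar: "space \<mu> = carrier G"
  using haar by (simp add: normalized_haar_measure_def)

lemma sets_haar: "openin T U \<Longrightarrow> U \<in> sets \<mu>"
  using haar by (auto simp: normalized_haar_measure_def)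

lemma \<alpha>_automorphism: "g \<in> carrier G \<Longrightarrow> star_automorphism (\<alpha> g)"
  using system by (simp add: dynamical_system_def)

lemma
  assumes "g \<in> carrier G"
  shows \<alpha>_add: "\<alpha> g (x + y) = \<alpha> g x + \<alpha> g y" and \<alpha>_scaleC: "\<alpha> g (c *\<^sub>C x) = c *\<^sub>C \<alpha> g x"
    and \<alpha>_mult: "\<alpha> g (x * y) = \<alpha> g x * \<alpha> g y" and \<alpha>_star: "\<alpha> g (star x) = star (\<alpha> g x)"
    and \<alpha>_bij: "bij (\<alpha> g)"
  using \<alpha>_automorphism[OF assms] by (auto simp: star_automorphism_def)

lemma \<alpha>_0 [simp]: "g \<in> carrier G \<Longrightarrow> \<alpha> g 0 = 0"
  using \<alpha>_add[of g 0 0] by simp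

lemma \<alpha>_diff: "g \<in> carrier G \<Longrightarrow> \<alpha> g (x - y) = \<alpha> g x - \<alpha> g y"
  using \<alpha>_add[of g "x - y" y] by simp

lemma \<alpha>_sum: "g \<in> carrier G \<Longrightarrow> \<alpha> g (\<Sum>i\<in>I. f i) = (\<Sum>i\<in>I. \<alpha> g (f i))"
  by (induction I rule: infinite_finite_induct) (simp_all add: \<alpha>_add)

lemma \<alpha>_compose: "g \<in> carrier G \<Longrightarrow> h \<in> carrier G \<Longrightarrow> \<alpha> (g \<otimes> h) x = \<alpha> g (\<alpha> h x)"
  using system by (simp add: dynamical_system_def)

lemma \<alpha>_one: "\<alpha> \<one> x = x"
proof -
  have "\<alpha> \<one> (\<alpha> \<one> x) = \<alpha> \<one> x" using \<alpha>_compose[of \<one> \<one> x] by simp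
  then show ?thesis using \<alpha>_bij[of \<one>] by (simp add: bij_def inj_eq)
qed

lemma continuous_orbit: "continuous_map T W (\<lambda>g. \<alpha> g x)"
  using system by (intro continuous_map_into_weak) (simp add: dynamical_system_def)

lemma continuous_left_translation:
  assumes "g \<in> carrier G" shows "continuous_map T T (\<lambda>h. g \<otimes> h)"
proof -
  have "continuous_map T (prod_topology T T) (\<lambda>h. (g, h))"
    using assms by (intro continuous_map_pairedI) (simp_all add: topspace_carrier)
  from continuous_map_compose[OF this continuous_mult] show ?thesis by (simp add: o_def)
qed

lemma compactin_group: "compactin T (carrier G)"
  using is_compact by (simp add: compact_space_def topspace_carrier)

lemma finite_subcover_of_group:
  assumes "\<And>g. g \<in> carrier G \<Longrightarrow> openin T (U g)" "\<And>g. g \<in> carrier G \<Longrightarrow> g \<in> U g"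
  obtains H where "finite H" "H \<subseteq> carrier G" "carrier G \<subseteq> (\<Union>h\<in>H. U h)"
proof -
  have "\<exists>\<F>. finite \<F> \<and> \<F> \<subseteq> U ` carrier G \<and> carrier G \<subseteq> \<Union>\<F>"
    using assms by (intro compactinD[OF compactin_group]) auto
  then show thesis using that by (metis finite_subset_image)
qed

text \<open>
  Finitely many translates cover the group, and they have the same measure.
\<close>

lemma open_set_has_positive_measure:
  assumes "openin T U" "g \<in> U"
  shows "measure \<mu> U > 0"
proof (rule ccontr)
  assume "\<not> measure \<mu> U > 0"
  then have null: "emeasure \<mu> U = 0" by (simp add: emeasure_eq_measure zero_less_measure_iff)
  have sub: "U \<subseteq> carrier G" using openin_subset[OF assms(1)] by (simp add: topspace_carrier)
  define V where "V k = (\<lambda>h. k \<otimes> h) ` U" for k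
  have V_eq: "V k = {h \<in> topspace T. inv k \<otimes> h \<in> U}" if "k \<in> carrier G" for k
  proof safe
    fix h assume "h \<in> V k"
    then show "h \<in> topspace T" "inv k \<otimes> h \<in> U"
      using that sub by (auto simp: V_def topspace_carrier inv_solve_left' subset_iff simp flip: m_assoc)
  next
    fix h assume "h \<in> topspace T" "inv k \<otimes> h \<in> U"
    then show "h \<in> V k"
      using that unfolding V_def topspace_carrier by (intro image_eqI[of _ _ "inv k \<otimes> h"]) (simp_all flip: m_assoc)
  qed
  have V_open: "openin T (V k)" if "k \<in> carrier G" for k
    unfolding V_eq[OF that] using that
    by (intro openin_continuous_map_preimage[OF continuous_left_translation assms(1)]) simp
  have V_null: "emeasure \<mu> (V k) = 0" if "k \<in> carrier G" for k
    using haar that sets_haar[OF assms(1)] null by (simp add: normalized_haar_measure_def V_def)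
  have "k \<in> V (k \<otimes> inv g)" if "k \<in> carrier G" for k
    using that assms sub by (auto simp: V_def m_assoc subset_iff intro!: image_eqI[of _ _ g])
  moreover have shift: "k \<otimes> inv g \<in> carrier G" if "k \<in> carrier G" for k
    using that assms sub by auto
  ultimately obtain H where H: "finite H" "H \<subseteq> carrier G" "carrier G \<subseteq> (\<Union>h\<in>H. V (h \<otimes> inv g))"
    using finite_subcover_of_group[of "\<lambda>k. V (k \<otimes> inv g)"] V_open by metis
  have V_sets: "V (k \<otimes> inv g) \<in> sets \<mu>" "emeasure \<mu> (V (k \<otimes> inv g)) = 0" if "k \<in> H" for k
    using that H(2) shift V_open V_null sets_haar by blast+
  have "emeasure \<mu> (carrier G) \<le> emeasure \<mu> (\<Union>h\<in>H. V (h \<otimes> inv g))"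
    using H V_sets by (intro emeasure_mono sets.finite_UN)
  also have "\<dots> \<le> (\<Sum>h\<in>H. emeasure \<mu> (V (h \<otimes> inv g)))"
    using H V_sets by (intro emeasure_subadditive_finite) auto
  also have "\<dots> = 0" using V_sets by (intro sum.neutral) blast
  finally show False using emeasure_space_1 by (simp add: space_haar)
qed

lemma integrable_continuous:
  fixes f :: "'g \<Rightarrow> complex"
  assumes "continuous_map T euclidean f" shows "integrable \<mu> f"
proof -
  have "compact (f ` carrier G)"
    using image_compactin[OF compactin_group assms] by simp
  then obtain C where "\<And>g. g \<in> carrier G \<Longrightarrow> cmod (f g) \<le> C"
    by (metis bounded_iff compact_imp_bounded imageI)
  moreover have "f \<in> borel_measurable \<mu>"
  proof (rule borel_measurableI)
    fix S :: "complex set" assume "open S"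
    then have "openin T {x \<in> topspace T. f x \<in> S}"
      by (intro openin_continuous_map_preimage[OF assms]) (simp flip: open_openin)
    then show "f -` S \<inter> space \<mu> \<in> sets \<mu>"
      using sets_haar by (simp add: space_haar topspace_carrier vimage_def Int_def conj_commute)
  qed
  ultimately show ?thesis
    by (intro integrable_const_bound[of _ C]) (auto simp: space_haar)
qed

text \<open>
  A Riemann sum: the group is covered by finitely many open sets on which the given functionals of
  \<open>D\<close> vary by less than \<open>\<epsilon>\<close>.
\<close>

lemma weak_integral_approximation:
  assumes D: "continuous_map T W D" and e: "e \<in> carrier G" "D e = 0" and A: "A \<in> sets \<mu>"
    and \<Phi>: "finite \<Phi>" "\<Phi> \<subseteq> F" and "\<epsilon> > 0"
  shows "\<exists>y\<in>convex hull (D ` carrier G). \<forall>\<phi>\<in>\<Phi>.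
    cmod (blinfun_apply \<phi> y - (\<integral>h. indicator A h *\<^sub>R blinfun_apply \<phi> (D h) \<partial>\<mu>)) \<le> \<epsilon>"
proof -
  define U where "U k = (\<Inter>\<phi>\<in>\<Phi>. {h \<in> topspace T. blinfun_apply \<phi> (D h) \<in> ball (blinfun_apply \<phi> (D k)) \<epsilon>}) \<inter> topspace T" for k
  have cont: "continuous_map T euclidean (\<lambda>h. blinfun_apply \<phi> (D h))" if "\<phi> \<in> \<Phi>" for \<phi>
    using continuous_functional_compose D that \<Phi> by blast
  have U_open: "openin T (U k)" for k
    unfolding U_def
  proof (rule openin_INT[OF \<Phi>(1)])
    fix \<phi> assume "\<phi> \<in> \<Phi>"
    then show "openin T {h \<in> topspace T. blinfun_apply \<phi> (D h) \<in> ball (blinfun_apply \<phi> (D k)) \<epsilon>}"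
      by (intro openin_continuous_map_preimage[OF cont]) (auto simp flip: open_openin)
  qed
  have "k \<in> U k" if "k \<in> carrier G" for k using that \<open>\<epsilon> > 0\<close> by (simp add: U_def topspace_carrier)
  then obtain H where H: "finite H" "H \<subseteq> carrier G" "carrier G \<subseteq> (\<Union>h\<in>H. U h)"
    using finite_subcover_of_group[of U] U_open by metis
  obtain k n where k: "H = k ` {..<n::nat}" using H(1) by (metis finite_imp_nat_seg_image_inj_on lessThan_def)
  define B where "B i = A \<inter> disjointed (\<lambda>i. U (k i)) i" for i
  have B_sets: "B i \<in> sets \<mu>" for i
    unfolding B_def disjointed_def using A U_open sets_haar by (intro sets.Int sets.Diff sets.finite_UN) auto
  have B_sub: "B i \<subseteq> U (k i)" for i using disjointed_subset[of "\<lambda>i. U (k i)" i] by (auto simp: B_def)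
  have B_disj: "i = j" if "h \<in> B i" "h \<in> B j" for h i j
    using that disjoint_family_disjointed[of "\<lambda>i. U (k i)"] by (auto simp: B_def disjoint_family_on_def)
  have B_cover: "A = (\<Union>i<n. B i)"
  proof -
    have "A \<subseteq> (\<Union>i\<in>{0..<n}. U (k i))"
      using sets.sets_into_space[OF A] H(3) by (auto simp: space_haar k atLeast0LessThan)
    then show ?thesis
      unfolding B_def finite_UN_disjointed_eq[of "\<lambda>i. U (k i)" n, symmetric] by (auto simp: atLeast0LessThan)
  qed
  define y where "y = (\<Sum>i<n. measure \<mu> (B i) *\<^sub>R D (k i))"
  have measure_sum: "(\<Sum>i<n. measure \<mu> (B i)) = measure \<mu> A"
    unfolding B_cover using B_sets B_disj
    by (intro finite_measure_finite_Union[symmetric]) (auto simp: disjoint_family_on_def)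
  have "y \<in> convex hull (D ` carrier G)"
  proof -
    \<comment> \<open>The missing weight \<open>1 - \<mu>(A)\<close> is put on the point \<open>0\<close>, a value of \<open>D\<close>.\<close>
    define p where "p i = (if i < n then D (k i) else 0)" for i
    define u where "u i = (if i < n then measure \<mu> (B i) else 1 - measure \<mu> A)" for i
    have "(\<Sum>i\<le>n. u i *\<^sub>R p i) \<in> convex hull (D ` carrier G)"
    proof (rule convex_sum)
      show "(\<Sum>i\<le>n. u i) = 1"
        using measure_sum by (simp add: u_def lessThan_Suc_atMost[symmetric])
      fix i assume "i \<in> {..n}"
      show "p i \<in> convex hull (D ` carrier G)"
        using H k e by (auto simp: p_def intro!: hull_inc)
    qed (auto simp: u_def)
    moreover have "(\<Sum>i\<le>n. u i *\<^sub>R p i) = y"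
      by (simp add: u_def p_def y_def lessThan_Suc_atMost[symmetric])
    ultimately show ?thesis by simp
  qed
  moreover have "cmod (blinfun_apply \<phi> y - (\<integral>h. indicator A h *\<^sub>R blinfun_apply \<phi> (D h) \<partial>\<mu>)) \<le> \<epsilon>"
    if \<phi>: "\<phi> \<in> \<Phi>" for \<phi>
  proof -
    define s where "s h = (\<Sum>i<n. indicator (B i) h *\<^sub>R blinfun_apply \<phi> (D (k i)))" for h
    have "has_bochner_integral \<mu> s (\<Sum>i<n. measure \<mu> (B i) *\<^sub>R blinfun_apply \<phi> (D (k i)))"
      unfolding s_def[abs_def] using B_sets
      by (intro has_bochner_integral_sum has_bochner_integral_scaleR_left has_bochner_integral_real_indicator)
        (simp_all add: emeasure_eq_measure)
    then have s_int: "integrable \<mu> s" "integral\<^sup>L \<mu> s = blinfun_apply \<phi> y"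
      by (simp_all add: has_bochner_integral_iff y_def blinfun.sum_right blinfun.scaleR_right)
    have f_int: "integrable \<mu> (\<lambda>h. indicator A h *\<^sub>R blinfun_apply \<phi> (D h))"
      using integrable_mult_indicator[OF A integrable_continuous[OF cont[OF \<phi>]]] .
    have "cmod (s h - indicator A h *\<^sub>R blinfun_apply \<phi> (D h)) \<le> \<epsilon>" if "h \<in> space \<mu>" for h
    proof (cases "h \<in> A")
      case True
      then obtain j where j: "j < n" "h \<in> B j" using B_cover by auto
      have "s h = (\<Sum>i<n. if i = j then blinfun_apply \<phi> (D (k j)) else 0)"
        unfolding s_def using j B_disj by (intro sum.cong) (auto simp: indicator_def)
      then have "s h = blinfun_apply \<phi> (D (k j))" using j by simp
      moreover have "h \<in> U (k j)" using j B_sub by blast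
      ultimately show ?thesis using True \<phi> by (auto simp: U_def dist_norm)
    next
      case False
      then have "s h = 0" unfolding s_def B_cover by (intro sum.neutral) (auto simp: indicator_def)
      then show ?thesis using False \<open>\<epsilon> > 0\<close> by simp
    qed
    then have "(\<integral>h. cmod (s h - indicator A h *\<^sub>R blinfun_apply \<phi> (D h)) \<partial>\<mu>) \<le> (\<integral>h. \<epsilon> \<partial>\<mu>)"
      using s_int f_int by (intro integral_mono) auto
    moreover have "cmod (\<integral>h. s h - indicator A h *\<^sub>R blinfun_apply \<phi> (D h) \<partial>\<mu>) \<le> (\<integral>h. cmod (s h - indicator A h *\<^sub>R blinfun_apply \<phi> (D h)) \<partial>\<mu>)"
      by (rule integral_norm_bound)
    ultimately show ?thesis using s_int f_int by (simp add: prob_space)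
  qed
  ultimately show ?thesis by blast
qed

text \<open>
  By the convex hull axiom the closed convex hull of the compact set \<open>D ` carrier G\<close> is compact. The
  sets of points at which finitely many functionals nearly have the prescribed value meet
  it by the approximation lemma; hence so does their intersection.
\<close>

lemma weak_integral_exists:
  assumes D: "continuous_map T W D" and e: "e \<in> carrier G" "D e = 0" and A: "A \<in> sets \<mu>"
  shows "\<exists>y\<in>W closure_of (convex hull (D ` carrier G)).
    \<forall>\<phi>\<in>F. blinfun_apply \<phi> y = (\<integral>h. indicator A h *\<^sub>R blinfun_apply \<phi> (D h) \<partial>\<mu>)"
proof -
  define S where "S = D ` carrier G"
  define K where "K = W closure_of (convex hull S)"
  define I where "I \<phi> = (\<integral>h. indicator A h *\<^sub>R blinfun_apply \<phi> (D h) \<partial>\<mu>)" for \<phi> :: "'a \<Rightarrow>\<^sub>L complex"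
  define C where "C = (\<lambda>(\<phi>, \<epsilon>). {y \<in> topspace W. blinfun_apply \<phi> y \<in> cball (I \<phi>) \<epsilon>})"
  have "compactin W S" unfolding S_def by (rule image_compactin[OF compactin_group D])
  then have "relatively_compactin W S"
    using compactin_imp_closedin[OF Hausdorff_weak] by (simp add: relatively_compactin_def closure_of_closedin)
  then have "compactin W K"
    using compact_convex_hull by (simp add: K_def relatively_compactin_def)
  moreover have "closedin W B" if B: "B \<in> C ` (F \<times> {0<..})" for B
  proof -
    obtain \<phi> \<epsilon> where B: "\<phi> \<in> F" "B = {y \<in> topspace W. blinfun_apply \<phi> y \<in> cball (I \<phi>) \<epsilon>}"
      using B by (auto simp: C_def)
    show ?thesis unfolding B(2)
      by (intro closedin_continuous_map_preimage[OF continuous_functional[OF B(1)]]) simp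
  qed
  moreover have "K \<inter> \<Inter>\<F> \<noteq> {}" if \<F>: "finite \<F>" "\<F> \<subseteq> C ` (F \<times> {0<..})" for \<F>
  proof -
    obtain P where P: "P \<subseteq> F \<times> {0<..}" "finite P" "\<F> = C ` P"
      using finite_subset_image[OF \<F>] by blast
    define \<epsilon> where "\<epsilon> = Min (insert 1 (snd ` P))"
    have "\<epsilon> > 0" using P by (auto simp: \<epsilon>_def)
    have \<epsilon>_le: "\<epsilon> \<le> snd p" if "p \<in> P" for p using P that by (auto simp: \<epsilon>_def)
    obtain y where y: "y \<in> convex hull S" "\<And>\<phi>. \<phi> \<in> fst ` P \<Longrightarrow> cmod (blinfun_apply \<phi> y - I \<phi>) \<le> \<epsilon>"
      using weak_integral_approximation[OF D e A, of "fst ` P" \<epsilon>] P \<open>\<epsilon> > 0\<close> unfolding S_def I_def by force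
    have "y \<in> K" using y(1) closure_of_subset[of "convex hull S" W] by (auto simp: K_def)
    moreover have "y \<in> C p" if "p \<in> P" for p
      using y(2)[of "fst p"] \<epsilon>_le[OF that] that by (auto simp: C_def case_prod_beta dist_norm norm_minus_commute)
    ultimately show ?thesis unfolding P by blast
  qed
  ultimately have "K \<inter> \<Inter> (C ` (F \<times> {0<..})) \<noteq> {}"
    unfolding compactin_fip by blast
  then obtain y where y: "y \<in> K" "\<And>\<phi> \<epsilon>. \<phi> \<in> F \<Longrightarrow> \<epsilon> > 0 \<Longrightarrow> y \<in> C (\<phi>, \<epsilon>)" by auto
  have "blinfun_apply \<phi> y = I \<phi>" if "\<phi> \<in> F" for \<phi>
  proof -
    have "dist (I \<phi>) (blinfun_apply \<phi> y) \<le> 0 + \<epsilon>" if "\<epsilon> > 0" for \<epsilon>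
      using y(2)[OF \<open>\<phi> \<in> F\<close> that] by (simp add: C_def)
    then have "dist (I \<phi>) (blinfun_apply \<phi> y) \<le> 0" by (rule field_le_epsilon)
    then show ?thesis by simp
  qed
  then show ?thesis using y(1) unfolding K_def S_def I_def by blast
qed

end

section \<open>The fixed point algebra is weakly closed\<close>

context cstar_pair
begin

lemma closure_stable:
  assumes "continuous_map W W f" "\<And>y. y \<in> S \<Longrightarrow> f y \<in> W closure_of S" "x \<in> W closure_of S"
  shows "f x \<in> W closure_of S"
proof (rule forall_in_closure_of[OF assms(3)])
  show "closedin W {x \<in> topspace W. f x \<in> W closure_of S}"
    by (intro closedin_continuous_map_preimage[OF assms(1)] closedin_closure_of)
qed (fact assms(2))

end

context cstar_system
begin

text \<open>
  The integrals of \<open>D\<close> over a measurable set and over its complement are limits of bounded positive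
  elements, hence positive, and they sum to \<open>0\<close>. So both vanish. As this holds for every measurable set, and
  non-empty open sets have positive measure, the continuous functions \<open>\<phi> \<circ> D\<close> vanish.
\<close>

lemma positive_with_weak_integral_0_eq_0:
  assumes D: "continuous_map T W D" and e: "e \<in> carrier G" "D e = 0"
    and pos: "\<And>h. h \<in> carrier G \<Longrightarrow> star (D h) = D h" "\<And>h. h \<in> carrier G \<Longrightarrow> pos_bound t (D h)" and "t \<ge> 0"
    and zero: "\<And>\<phi>. \<phi> \<in> F \<Longrightarrow> (\<integral>h. blinfun_apply \<phi> (D h) \<partial>\<mu>) = 0"
    and h: "h \<in> carrier G"
  shows "D h = 0"
proof (rule functionals_separate)
  fix \<phi> assume \<phi>: "\<phi> \<in> F"
  note cont = continuous_functional_compose[OF _ D]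
  \<comment> \<open>The weakly closed convex set of positive elements with bound \<open>t\<close> contains all values of \<open>D\<close>.\<close>
  define N where "N = {y :: 'a. star y = y} \<inter> (\<Inter>z. {y. norm (t *\<^sub>R z - y * z) \<le> t * norm z})"
  have N_iff: "y \<in> N \<longleftrightarrow> star y = y \<and> pos_bound t y" for y by (auto simp: N_def pos_bound_def)
  have "closedin W N"
    unfolding N_def
    by (intro closedin_Int closedin_INT weakly_closed_norm_le weakly_closed_equalizer continuous_star continuous_map_id[unfolded id_def]
        weak_continuous_diff continuous_const continuous_mult_right) auto
  moreover have "convex N"
  proof (rule convexI)
    fix x y and u v :: real assume *: "x \<in> N" "y \<in> N" "0 \<le> u" "0 \<le> v" "u + v = 1"
    have "pos_bound (u * t + v * t) (u *\<^sub>R x + v *\<^sub>R y)"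
      using * by (intro pos_bound_add pos_bound_scaleR) (auto simp: N_iff)
    moreover have "u * t + v * t = t" using * by (simp flip: distrib_right)
    ultimately show "u *\<^sub>R x + v *\<^sub>R y \<in> N" using * by (simp add: N_iff star_add star_scaleR)
  qed
  moreover have "D ` carrier G \<subseteq> N" using pos by (auto simp: N_iff)
  ultimately have K: "W closure_of (convex hull (D ` carrier G)) \<subseteq> N"
    by (intro closure_of_minimal hull_minimal)
  have zero_A: "(\<integral>h. indicator A h *\<^sub>R blinfun_apply \<phi> (D h) \<partial>\<mu>) = 0" if A: "A \<in> sets \<mu>" for A
  proof -
    have A': "space \<mu> - A \<in> sets \<mu>" using A by auto
    obtain y where y: "y \<in> N" "\<And>\<phi>. \<phi> \<in> F \<Longrightarrow> blinfun_apply \<phi> y = (\<integral>h. indicator A h *\<^sub>R blinfun_apply \<phi> (D h) \<partial>\<mu>)"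
      using weak_integral_exists[OF D e A] K by blast
    obtain y' where y': "y' \<in> N" "\<And>\<phi>. \<phi> \<in> F \<Longrightarrow> blinfun_apply \<phi> y' = (\<integral>h. indicator (space \<mu> - A) h *\<^sub>R blinfun_apply \<phi> (D h) \<partial>\<mu>)"
      using weak_integral_exists[OF D e A'] K by blast
    have "y' = - y"
    proof (rule functionals_separate)
      fix \<psi> assume \<psi>: "\<psi> \<in> F"
      note int = integrable_mult_indicator[OF _ integrable_continuous[OF cont[OF \<psi>]]]
      have "blinfun_apply \<psi> y + blinfun_apply \<psi> y' =
          (\<integral>h. indicator A h *\<^sub>R blinfun_apply \<psi> (D h) + indicator (space \<mu> - A) h *\<^sub>R blinfun_apply \<psi> (D h) \<partial>\<mu>)"
        unfolding y(2)[OF \<psi>] y'(2)[OF \<psi>] by (rule Bochner_Integration.integral_add[symmetric]) (intro int A A')+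
      also have "\<dots> = (\<integral>h. blinfun_apply \<psi> (D h) \<partial>\<mu>)"
        by (intro Bochner_Integration.integral_cong) (auto simp: indicator_def)
      finally show "blinfun_apply \<psi> y' = blinfun_apply \<psi> (- y)"
        using zero[OF \<psi>] by (simp add: blinfun.minus_right eq_neg_iff_add_eq_0 add.commute)
    qed
    then have "y = 0" using y(1) y'(1) \<open>t \<ge> 0\<close> pos_bound_antisym[of y t] by (simp add: N_iff)
    then show ?thesis using y(2)[OF \<phi>] by simp
  qed
  define v where "v = blinfun_apply \<phi> (D h)"
  show "blinfun_apply \<phi> (D h) = blinfun_apply \<phi> 0"
  proof (rule ccontr)
    assume "blinfun_apply \<phi> (D h) \<noteq> blinfun_apply \<phi> 0"
    then have v: "cmod v > 0" by (simp add: v_def)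
    \<comment> \<open>On this open set of positive measure \<open>\<phi> \<circ> D\<close> stays close to \<open>v\<close>, so its integral is not zero.\<close>
    define U where "U = {k \<in> topspace T. blinfun_apply \<phi> (D k) \<in> ball v (cmod v / 2)}"
    have U: "openin T U" unfolding U_def
      by (intro openin_continuous_map_preimage[OF cont[OF \<phi>]]) (simp flip: open_openin)
    have "h \<in> U" using h v by (simp add: U_def v_def topspace_carrier)
    then have pos_U: "measure \<mu> U > 0" using open_set_has_positive_measure U by blast
    have U': "U \<in> sets \<mu>" using U by (rule sets_haar)
    have int: "integrable \<mu> (\<lambda>k. indicator U k *\<^sub>R blinfun_apply \<phi> (D k))"
      using integrable_mult_indicator[OF U' integrable_continuous[OF cont[OF \<phi>]]] .
    have v_int: "has_bochner_integral \<mu> (\<lambda>k. indicator U k *\<^sub>R v) (measure \<mu> U *\<^sub>R v)"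
      using U' by (intro has_bochner_integral_indicator) (simp_all add: emeasure_eq_measure)
    have half_int: "has_bochner_integral \<mu> (\<lambda>k. indicator U k *\<^sub>R (cmod v / 2)) (measure \<mu> U *\<^sub>R (cmod v / 2))"
      using U' by (intro has_bochner_integral_indicator) (simp_all add: emeasure_eq_measure)
    have "measure \<mu> U *\<^sub>R v = (\<integral>k. indicator U k *\<^sub>R v - indicator U k *\<^sub>R blinfun_apply \<phi> (D k) \<partial>\<mu>)"
      using v_int int zero_A[OF U'] by (simp add: has_bochner_integral_iff)
    then have "cmod (measure \<mu> U *\<^sub>R v) \<le> (\<integral>k. cmod (indicator U k *\<^sub>R v - indicator U k *\<^sub>R blinfun_apply \<phi> (D k)) \<partial>\<mu>)"
      by (metis integral_norm_bound)
    also have "\<dots> \<le> (\<integral>k. indicator U k *\<^sub>R (cmod v / 2) \<partial>\<mu>)"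
      using v_int int half_int
      by (intro integral_mono) (auto simp: has_bochner_integral_iff indicator_def U_def dist_norm)
    also have "\<dots> = measure \<mu> U * (cmod v / 2)" using half_int by (simp add: has_bochner_integral_iff)
    finally show False using v pos_U by simp
  qed
qed

lemma fixed_pointsD: "x \<in> fixed_points G \<alpha> \<Longrightarrow> g \<in> carrier G \<Longrightarrow> \<alpha> g x = x"
  by (simp add: fixed_points_def)

lemma fixed_points_0: "0 \<in> fixed_points G \<alpha>"
  and fixed_points_add: "x \<in> fixed_points G \<alpha> \<Longrightarrow> y \<in> fixed_points G \<alpha> \<Longrightarrow> x + y \<in> fixed_points G \<alpha>"
  and fixed_points_scaleC: "x \<in> fixed_points G \<alpha> \<Longrightarrow> c *\<^sub>C x \<in> fixed_points G \<alpha>"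
  and fixed_points_mult: "x \<in> fixed_points G \<alpha> \<Longrightarrow> y \<in> fixed_points G \<alpha> \<Longrightarrow> x * y \<in> fixed_points G \<alpha>"
  and fixed_points_star: "x \<in> fixed_points G \<alpha> \<Longrightarrow> star x \<in> fixed_points G \<alpha>"
  by (simp_all add: fixed_points_def \<alpha>_add \<alpha>_scaleC \<alpha>_mult \<alpha>_star)

text \<open>
  The map \<open>E\<close> is the average over the group. It is weakly continuous and fixes \<open>X\<^sup>\<alpha>\<close>, so it fixes the
  closure \<open>B\<close>, which is a *-algebra by separate continuity of the product. For a self-adjoint \<open>x\<close> in
  \<open>B\<close> the integral of \<open>(\<alpha> g x - x)\<^sup>2\<close> is
  \<open>E (x\<^sup>2) - E x x - x E x + x\<^sup>2 = 0\<close>, so \<open>\<alpha> g x = x\<close> for all \<open>g\<close>. Since \<open>\<alpha> g\<close> is not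
  assumed to be weakly continuous, there is no direct passage to the limit.
\<close>

lemma fixed_points_weakly_closed:
  assumes E: "\<And>x \<phi>. \<phi> \<in> F \<Longrightarrow> blinfun_apply \<phi> (E x) = (\<integral>g. blinfun_apply \<phi> (\<alpha> g x) \<partial>\<mu>)"
    and E_cont: "continuous_map W W E"
  shows "closedin W (fixed_points G \<alpha>)"
proof -
  define B where "B = W closure_of (fixed_points G \<alpha>)"
  have sub: "fixed_points G \<alpha> \<subseteq> B" unfolding B_def by (rule closure_of_subset) simp
  have "E y = y" if "y \<in> fixed_points G \<alpha>" for y
  proof (rule functionals_separate)
    fix \<phi> assume \<phi>: "\<phi> \<in> F"
    have "(\<integral>g. blinfun_apply \<phi> (\<alpha> g y) \<partial>\<mu>) = (\<integral>g. blinfun_apply \<phi> y \<partial>\<mu>)"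
      using that by (intro Bochner_Integration.integral_cong) (simp_all add: space_haar fixed_pointsD)
    then show "blinfun_apply \<phi> (E y) = blinfun_apply \<phi> y" using E[OF \<phi>] by (simp add: prob_space)
  qed
  then have E_B: "E x = x" if "x \<in> B" for x
    using weak_closure_eq[OF _ E_cont continuous_map_id[unfolded id_def], of x] that unfolding B_def by auto
  have B_star: "star x \<in> B" if "x \<in> B" for x
    using that unfolding B_def
    by (rule closure_stable[OF continuous_star, rotated]) (use sub in \<open>auto simp: B_def fixed_points_star\<close>)
  have B_scaleC: "c *\<^sub>C x \<in> B" if "x \<in> B" for x c
    using that unfolding B_def
    by (rule closure_stable[OF weak_continuous_scaleC[OF continuous_map_id[unfolded id_def]], rotated])
      (use sub in \<open>auto simp: B_def fixed_points_scaleC\<close>)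
  \<comment> \<open>Closure under sums and products: first with a fixed point on the right, then, by continuity in the second argument, in general.\<close>
  have B_add1: "x + y \<in> B" if "x \<in> B" "y \<in> fixed_points G \<alpha>" for x y
    using that(1) unfolding B_def
    by (rule closure_stable[OF weak_continuous_add[OF continuous_map_id[unfolded id_def] continuous_const], rotated])
      (use sub that in \<open>auto simp: B_def fixed_points_add\<close>)
  have B_add: "x + y \<in> B" if "x \<in> B" "y \<in> B" for x y
    using that(2) unfolding B_def
    by (rule closure_stable[OF weak_continuous_add[OF continuous_const continuous_map_id[unfolded id_def]], rotated])
      (use B_add1 that in \<open>auto simp: B_def\<close>)
  have B_mult1: "x * y \<in> B" if "x \<in> B" "y \<in> fixed_points G \<alpha>" for x y
    using that(1) unfolding B_def
    by (rule closure_stable[OF continuous_mult_right, rotated])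
      (use sub that in \<open>auto simp: B_def fixed_points_mult\<close>)
  have B_mult: "x * y \<in> B" if "x \<in> B" "y \<in> B" for x y
    using that(2) unfolding B_def
    by (rule closure_stable[OF continuous_mult_left, rotated]) (use B_mult1 that in \<open>auto simp: B_def\<close>)
  have sa: "\<alpha> h x = x" if x: "x \<in> B" "star x = x" and h: "h \<in> carrier G" for x h
  proof -
    define a where "a g = \<alpha> g x - x" for g
    define D where "D g = a g * a g" for g
    have a_sa: "star (a g) = a g" if "g \<in> carrier G" for g
      using that x \<alpha>_star[of g x] by (simp add: a_def star_diff)
    have a_norm: "norm (a g) \<le> 2 * norm x" if "g \<in> carrier G" for g
      using norm_triangle_ineq4[of "\<alpha> g x" x] star_automorphism_contracts_self_adjoint[OF \<alpha>_automorphism[OF that] x(2)]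
      by (simp add: a_def)
    have D_eq: "D g = \<alpha> g (x * x) - \<alpha> g x * x - x * \<alpha> g x + x * x" if "g \<in> carrier G" for g
      using that by (simp add: D_def a_def \<alpha>_mult algebra_simps)
    have D_cont: "continuous_map T W D"
    proof (rule continuous_map_eq)
      show "continuous_map T W (\<lambda>g. \<alpha> g (x * x) - \<alpha> g x * x - x * \<alpha> g x + x * x)"
        by (intro weak_continuous_add weak_continuous_diff continuous_orbit continuous_const
            continuous_map_compose[OF continuous_orbit continuous_mult_right, unfolded o_def]
            continuous_map_compose[OF continuous_orbit continuous_mult_left, unfolded o_def])
    qed (simp add: D_eq topspace_carrier)
    have "D h = 0"
    proof (rule positive_with_weak_integral_0_eq_0[OF D_cont one_closed])
      show "D \<one> = 0" by (simp add: D_def a_def \<alpha>_one)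
      show "star (D g) = D g" if "g \<in> carrier G" for g using a_sa[OF that] by (simp add: D_def star_mult)
      show "pos_bound ((2 * norm x)\<^sup>2 + 1) (D g)" if "g \<in> carrier G" for g
        unfolding D_def using a_sa[OF that] power_mono[OF a_norm[OF that], of 2]
        by (intro pos_bound_square) auto
      show "(\<integral>g. blinfun_apply \<phi> (D g) \<partial>\<mu>) = 0" if \<phi>: "\<phi> \<in> F" for \<phi>
      proof -
        obtain \<psi>1 where \<psi>1: "\<psi>1 \<in> F" "\<And>y. blinfun_apply \<psi>1 y = blinfun_apply \<phi> (y * x)"
          using functional_compose[OF \<phi> continuous_mult_right, of x] by (auto simp: distrib_right mult_scaleC_left)
        obtain \<psi>2 where \<psi>2: "\<psi>2 \<in> F" "\<And>y. blinfun_apply \<psi>2 y = blinfun_apply \<phi> (x * y)"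
          using functional_compose[OF \<phi> continuous_mult_left, of x] by (auto simp: distrib_left mult_scaleC_right)
        note int = integrable_continuous[OF continuous_functional_compose[OF _ continuous_orbit]]
        have "(\<integral>g. blinfun_apply \<phi> (D g) \<partial>\<mu>) = (\<integral>g. blinfun_apply \<phi> (\<alpha> g (x * x)) - blinfun_apply \<psi>1 (\<alpha> g x)
            - blinfun_apply \<psi>2 (\<alpha> g x) + blinfun_apply \<phi> (x * x) \<partial>\<mu>)"
          by (intro Bochner_Integration.integral_cong refl)
            (simp add: space_haar D_eq \<psi>1 \<psi>2 blinfun.add_right blinfun.diff_right)
        also have "\<dots> = blinfun_apply \<phi> (E (x * x)) - blinfun_apply \<psi>1 (E x) - blinfun_apply \<psi>2 (E x) + blinfun_apply \<phi> (x * x)"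
          using int[OF \<phi>] int[OF \<psi>1(1)] int[OF \<psi>2(1)] by (simp add: E[OF \<phi>] E[OF \<psi>1(1)] E[OF \<psi>2(1)] prob_space)
        also have "\<dots> = 0" using x by (simp add: E_B B_mult \<psi>1 \<psi>2)
        finally show ?thesis .
      qed
    qed (use h in auto)
    then have "a h = 0" using star_mult_self_eq_0[of "a h"] a_sa[OF h] by (simp add: D_def)
    then show ?thesis by (simp add: a_def)
  qed
  have "B \<subseteq> fixed_points G \<alpha>"
  proof
    fix w assume w: "w \<in> B"
    define A where "A = w + star w"
    define C where "C = \<i> *\<^sub>C (w - star w)"
    note parts = self_adjoint_parts[of w, folded A_def C_def]
    have "A \<in> B" using w by (simp add: A_def B_add B_star)
    have "w - star w = w + (-1) *\<^sub>C star w" by (simp add: scaleC_minus_left scaleC_one)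
    then have "C \<in> B" using w by (simp only: C_def) (intro B_scaleC B_add B_star)
    have "A - \<i> *\<^sub>C C \<in> fixed_points G \<alpha>"
      using sa[OF \<open>A \<in> B\<close> parts(1)] sa[OF \<open>C \<in> B\<close> parts(2)] by (simp add: fixed_points_def \<alpha>_diff \<alpha>_scaleC)
    then have "2 *\<^sub>R w \<in> fixed_points G \<alpha>" by (simp add: parts(4))
    from fixed_points_scaleC[OF this, of "complex_of_real (1/2)"] show "w \<in> fixed_points G \<alpha>"
      by (simp only: scaleC_of_real) simp
  qed
  then show ?thesis using sub closedin_closure_of[of W "fixed_points G \<alpha>"] by (simp add: B_def)
qed

end

section \<open>Matrices over the algebra\<close>

lemma index_mult_mat_sum:
  assumes "A \<in> carrier_mat n m" "B \<in> carrier_mat m p" "i < n" "j < p"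
  shows "(A * B) $$ (i, j) = (\<Sum>k<m. A $$ (i, k) * B $$ (k, j))"
  using assms by (auto simp: scalar_prod_def atLeast0LessThan)

lemma mat_star_carrier: "A \<in> carrier_mat n m \<Longrightarrow> mat_star A \<in> carrier_mat m n"
  by (auto simp: mat_star_def)

lemma mat_rmult_carrier: "a \<in> carrier_mat n m \<Longrightarrow> U \<in> carrier_mat m p \<Longrightarrow> mat_rmult a U \<in> carrier_mat n p"
  and mat_lmult_carrier: "U \<in> carrier_mat n m \<Longrightarrow> a \<in> carrier_mat m p \<Longrightarrow> mat_lmult U a \<in> carrier_mat n p"
  by (auto simp: mat_rmult_def mat_lmult_def)

lemma index_mat_star: "A \<in> carrier_mat n m \<Longrightarrow> i < m \<Longrightarrow> j < n \<Longrightarrow> mat_star A $$ (i, j) = star (A $$ (j, i))"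
  by (auto simp: mat_star_def)

lemma index_mat_rmult:
  "a \<in> carrier_mat n m \<Longrightarrow> U \<in> carrier_mat m p \<Longrightarrow> i < n \<Longrightarrow> j < p \<Longrightarrow>
    mat_rmult a U $$ (i, j) = (\<Sum>k<m. (U $$ (k, j)) *\<^sub>C (a $$ (i, k)))"
  by (auto simp: mat_rmult_def)

lemma index_mat_lmult:
  "U \<in> carrier_mat n m \<Longrightarrow> a \<in> carrier_mat m p \<Longrightarrow> i < n \<Longrightarrow> j < p \<Longrightarrow>
    mat_lmult U a $$ (i, j) = (\<Sum>k<m. (U $$ (i, k)) *\<^sub>C (a $$ (k, j)))"
  by (auto simp: mat_lmult_def)

lemmas mat_carriers = mult_carrier_mat mat_star_carrier mat_rmult_carrier mat_lmult_carrier

lemma mat_eqI: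
  assumes "A \<in> carrier_mat n m" "B \<in> carrier_mat n m"
    "\<And>i j. i < n \<Longrightarrow> j < m \<Longrightarrow> A $$ (i, j) = B $$ (i, j)"
  shows "A = B"
  using assms by (intro eq_matI) auto

lemma mat_star_mult:
  fixes A B :: "'a::cstar_algebra mat"
  assumes A: "A \<in> carrier_mat n m" and B: "B \<in> carrier_mat m p"
  shows "mat_star (A * B) = mat_star B * mat_star A"
proof (rule mat_eqI)
  fix i j assume ij: "i < p" "j < n"
  have "(mat_star B * mat_star A) $$ (i, j) = (\<Sum>k<m. mat_star B $$ (i, k) * mat_star A $$ (k, j))"
    by (rule index_mult_mat_sum[OF mat_star_carrier[OF B] mat_star_carrier[OF A] ij])
  then show "mat_star (A * B) $$ (i, j) = (mat_star B * mat_star A) $$ (i, j)"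
    using ij by (simp add: index_mat_star[OF mult_carrier_mat[OF A B]] index_mat_star[OF A] index_mat_star[OF B]
        index_mult_mat_sum[OF A B] star_sum star_mult)
qed (use A B in \<open>auto intro!: mat_carriers\<close>)

lemma mat_star_star: "A \<in> carrier_mat n m \<Longrightarrow> mat_star (mat_star A) = A"
  by (intro mat_eqI[of _ n m] mat_carriers) (auto simp: mat_star_def star_star)

lemma mat_star_zero: "mat_star (0\<^sub>m n m) = 0\<^sub>m m n"
  by (intro mat_eqI[of _ m n] mat_carriers) (auto simp: mat_star_def)

lemma mat_rmult_assoc:
  assumes a: "a \<in> carrier_mat n m" and U: "U \<in> carrier_mat m p" and V: "V \<in> carrier_mat p q"
  shows "mat_rmult (mat_rmult a U) V = mat_rmult a (U * V)"
proof (rule mat_eqI)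
  fix i j assume ij: "i < n" "j < q"
  have "mat_rmult (mat_rmult a U) V $$ (i, j) = (\<Sum>k<p. \<Sum>l<m. (V $$ (k, j) * U $$ (l, k)) *\<^sub>C (a $$ (i, l)))"
    using ij by (simp add: index_mat_rmult[OF mat_rmult_carrier[OF a U] V] index_mat_rmult[OF a U] scaleC_sum_right scaleC_scaleC)
  also have "\<dots> = (\<Sum>l<m. \<Sum>k<p. (V $$ (k, j) * U $$ (l, k)) *\<^sub>C (a $$ (i, l)))" by (rule sum.swap)
  also have "\<dots> = mat_rmult a (U * V) $$ (i, j)"
    using ij by (simp add: index_mat_rmult[OF a mult_carrier_mat[OF U V]] index_mult_mat_sum[OF U V] scaleC_sum_left mult.commute)
  finally show "mat_rmult (mat_rmult a U) V $$ (i, j) = mat_rmult a (U * V) $$ (i, j)" .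
qed (rule a U V mat_carriers)+

lemma mat_lmult_assoc:
  assumes U: "U \<in> carrier_mat n m" and V: "V \<in> carrier_mat m p" and a: "a \<in> carrier_mat p q"
  shows "mat_lmult U (mat_lmult V a) = mat_lmult (U * V) a"
proof (rule mat_eqI)
  fix i j assume ij: "i < n" "j < q"
  have "mat_lmult U (mat_lmult V a) $$ (i, j) = (\<Sum>k<m. \<Sum>l<p. (U $$ (i, k) * V $$ (k, l)) *\<^sub>C (a $$ (l, j)))"
    using ij by (simp add: index_mat_lmult[OF U mat_lmult_carrier[OF V a]] index_mat_lmult[OF V a] scaleC_sum_right scaleC_scaleC)
  also have "\<dots> = (\<Sum>l<p. \<Sum>k<m. (U $$ (i, k) * V $$ (k, l)) *\<^sub>C (a $$ (l, j)))" by (rule sum.swap)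
  also have "\<dots> = mat_lmult (U * V) a $$ (i, j)"
    using ij by (simp add: index_mat_lmult[OF mult_carrier_mat[OF U V] a] index_mult_mat_sum[OF U V] scaleC_sum_left)
  finally show "mat_lmult U (mat_lmult V a) $$ (i, j) = mat_lmult (U * V) a $$ (i, j)" .
qed (rule a U V mat_carriers)+

lemma mat_lmult_rmult:
  assumes U: "U \<in> carrier_mat n m" and a: "a \<in> carrier_mat m p" and V: "V \<in> carrier_mat p q"
  shows "mat_rmult (mat_lmult U a) V = mat_lmult U (mat_rmult a V)"
proof (rule mat_eqI)
  fix i j assume ij: "i < n" "j < q"
  have "mat_rmult (mat_lmult U a) V $$ (i, j) = (\<Sum>k<p. \<Sum>l<m. (V $$ (k, j) * U $$ (i, l)) *\<^sub>C (a $$ (l, k)))"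
    using ij by (simp add: index_mat_rmult[OF mat_lmult_carrier[OF U a] V] index_mat_lmult[OF U a] scaleC_sum_right scaleC_scaleC)
  also have "\<dots> = (\<Sum>l<m. \<Sum>k<p. (V $$ (k, j) * U $$ (i, l)) *\<^sub>C (a $$ (l, k)))" by (rule sum.swap)
  also have "\<dots> = mat_lmult U (mat_rmult a V) $$ (i, j)"
    using ij by (simp add: index_mat_lmult[OF U mat_rmult_carrier[OF a V]] index_mat_rmult[OF a V] scaleC_sum_right scaleC_scaleC mult.commute)
  finally show "mat_rmult (mat_lmult U a) V $$ (i, j) = mat_lmult U (mat_rmult a V) $$ (i, j)" .
qed (rule a U V mat_carriers)+

lemma mat_rmult_mult:
  fixes a b :: "'a::cstar_algebra mat"
  assumes a: "a \<in> carrier_mat n m" and U: "U \<in> carrier_mat m p" and b: "b \<in> carrier_mat p q"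
  shows "mat_rmult a U * b = a * mat_lmult U b"
proof (rule mat_eqI)
  fix i j assume ij: "i < n" "j < q"
  have "(mat_rmult a U * b) $$ (i, j) = (\<Sum>k<p. \<Sum>l<m. U $$ (l, k) *\<^sub>C (a $$ (i, l) * b $$ (k, j)))"
    using ij by (simp add: index_mult_mat_sum[OF mat_rmult_carrier[OF a U] b] index_mat_rmult[OF a U] sum_distrib_right mult_scaleC_left)
  also have "\<dots> = (\<Sum>l<m. \<Sum>k<p. U $$ (l, k) *\<^sub>C (a $$ (i, l) * b $$ (k, j)))" by (rule sum.swap)
  also have "\<dots> = (a * mat_lmult U b) $$ (i, j)"
    using ij by (simp add: index_mult_mat_sum[OF a mat_lmult_carrier[OF U b]] index_mat_lmult[OF U b] sum_distrib_left mult_scaleC_right)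
  finally show "(mat_rmult a U * b) $$ (i, j) = (a * mat_lmult U b) $$ (i, j)" .
qed (rule a U b mat_carriers)+

lemma mat_lmult_mult:
  fixes a b :: "'a::cstar_algebra mat"
  assumes U: "U \<in> carrier_mat n m" and a: "a \<in> carrier_mat m p" and b: "b \<in> carrier_mat p q"
  shows "mat_lmult U a * b = mat_lmult U (a * b)"
proof (rule mat_eqI)
  fix i j assume ij: "i < n" "j < q"
  have "(mat_lmult U a * b) $$ (i, j) = (\<Sum>k<p. \<Sum>l<m. U $$ (i, l) *\<^sub>C (a $$ (l, k) * b $$ (k, j)))"
    using ij by (simp add: index_mult_mat_sum[OF mat_lmult_carrier[OF U a] b] index_mat_lmult[OF U a] sum_distrib_right mult_scaleC_left)
  also have "\<dots> = (\<Sum>l<m. \<Sum>k<p. U $$ (i, l) *\<^sub>C (a $$ (l, k) * b $$ (k, j)))" by (rule sum.swap)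
  also have "\<dots> = mat_lmult U (a * b) $$ (i, j)"
    using ij by (simp add: index_mat_lmult[OF U mult_carrier_mat[OF a b]] index_mult_mat_sum[OF a b] scaleC_sum_right)
  finally show "(mat_lmult U a * b) $$ (i, j) = mat_lmult U (a * b) $$ (i, j)" .
qed (rule a U b mat_carriers)+

lemma mult_mat_rmult:
  fixes a b :: "'a::cstar_algebra mat"
  assumes a: "a \<in> carrier_mat n m" and b: "b \<in> carrier_mat m p" and U: "U \<in> carrier_mat p q"
  shows "a * mat_rmult b U = mat_rmult (a * b) U"
proof (rule mat_eqI)
  fix i j assume ij: "i < n" "j < q"
  have "(a * mat_rmult b U) $$ (i, j) = (\<Sum>k<m. \<Sum>l<p. U $$ (l, j) *\<^sub>C (a $$ (i, k) * b $$ (k, l)))"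
    using ij by (simp add: index_mult_mat_sum[OF a mat_rmult_carrier[OF b U]] index_mat_rmult[OF b U] sum_distrib_left mult_scaleC_right)
  also have "\<dots> = (\<Sum>l<p. \<Sum>k<m. U $$ (l, j) *\<^sub>C (a $$ (i, k) * b $$ (k, l)))" by (rule sum.swap)
  also have "\<dots> = mat_rmult (a * b) U $$ (i, j)"
    using ij by (simp add: index_mat_rmult[OF mult_carrier_mat[OF a b] U] index_mult_mat_sum[OF a b] scaleC_sum_right)
  finally show "(a * mat_rmult b U) $$ (i, j) = mat_rmult (a * b) U $$ (i, j)" .
qed (rule a U b mat_carriers)+

lemma mat_adjoint_carrier: "U \<in> carrier_mat n m \<Longrightarrow> mat_adjoint U \<in> carrier_mat m n"
  and index_mat_adjoint: "U \<in> carrier_mat n m \<Longrightarrow> i < m \<Longrightarrow> j < n \<Longrightarrow> mat_adjoint U $$ (i, j) = cnj (U $$ (j, i))"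
  by (auto simp: mat_adjoint_def mat_of_rows_def)

lemma mat_star_rmult:
  assumes a: "a \<in> carrier_mat n m" and U: "U \<in> carrier_mat m p"
  shows "mat_star (mat_rmult a U) = mat_lmult (mat_adjoint U) (mat_star a)"
  by (rule mat_eqI[OF mat_star_carrier[OF mat_rmult_carrier[OF a U]] mat_lmult_carrier[OF mat_adjoint_carrier[OF U] mat_star_carrier[OF a]]])
    (simp add: index_mat_star[OF mat_rmult_carrier[OF a U]] index_mat_rmult[OF a U] index_mat_star[OF a] index_mat_adjoint[OF U]
      index_mat_lmult[OF mat_adjoint_carrier[OF U] mat_star_carrier[OF a]] star_sum star_scaleC)

lemma mat_star_lmult:
  assumes U: "U \<in> carrier_mat n m" and a: "a \<in> carrier_mat m p"
  shows "mat_star (mat_lmult U a) = mat_rmult (mat_star a) (mat_adjoint U)"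
  by (rule mat_eqI[OF mat_star_carrier[OF mat_lmult_carrier[OF U a]] mat_rmult_carrier[OF mat_star_carrier[OF a] mat_adjoint_carrier[OF U]]])
    (simp add: index_mat_star[OF mat_lmult_carrier[OF U a]] index_mat_lmult[OF U a] index_mat_star[OF a] index_mat_adjoint[OF U]
      index_mat_rmult[OF mat_star_carrier[OF a] mat_adjoint_carrier[OF U]] star_sum star_scaleC)

lemma mat_lmult_one: "a \<in> carrier_mat n m \<Longrightarrow> mat_lmult (1\<^sub>m n) a = a"
  by (intro mat_eqI[of _ n m] mat_lmult_carrier[of _ n n])
    (auto simp: index_mat_lmult[of _ n n _ m] scaleC_one if_distrib[of "\<lambda>c. c *\<^sub>C _"] cong: if_cong)

lemma mat_rmult_one: "a \<in> carrier_mat n m \<Longrightarrow> mat_rmult a (1\<^sub>m m) = a"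
  by (intro mat_eqI[of _ n m] mat_rmult_carrier[of _ n m])
    (auto simp: index_mat_rmult[of _ n m _ m] scaleC_one if_distrib[of "\<lambda>c. c *\<^sub>C _"] cong: if_cong)

text \<open>
  The diagonal entries of \<open>M* M\<close> are sums of elements \<open>z* z\<close>.
\<close>

lemma mat_star_mult_self_eq_0:
  fixes M :: "'a::cstar_algebra mat"
  assumes M: "M \<in> carrier_mat n m" and zero: "mat_star M * M = 0\<^sub>m m m"
  shows "M = 0\<^sub>m n m"
proof (rule mat_eqI[OF M zero_carrier_mat])
  fix i j assume ij: "i < n" "j < m"
  have "(\<Sum>k<n. star (M $$ (k, j)) * M $$ (k, j)) = 0"
    using arg_cong[OF zero, of "\<lambda>A. A $$ (j, j)"] ij
    by (simp add: index_mult_mat_sum[OF mat_star_carrier[OF M] M] index_mat_star[OF M])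
  then show "M $$ (i, j) = 0\<^sub>m n m $$ (i, j)"
    using sum_star_mult_self_eq_0[of "{..<n}" "\<lambda>k. M $$ (k, j)" i] ij by simp
qed

lemma mat_mult_star_self_eq_0:
  fixes M :: "'a::cstar_algebra mat"
  assumes M: "M \<in> carrier_mat n m" and zero: "M * mat_star M = 0\<^sub>m n n"
  shows "M = 0\<^sub>m n m"
  using mat_star_mult_self_eq_0[OF mat_star_carrier[OF M]] zero mat_star_star[OF M] mat_star_zero by metis

lemma mult_smult_mat_right:
  fixes a b :: "'a::cstar_algebra mat"
  assumes a: "a \<in> carrier_mat n m" and b: "b \<in> carrier_mat m p"
  shows "a * (k \<cdot>\<^sub>m b) = map_mat (\<lambda>x. x * k) a * b"
  using assms by (intro mat_eqI[of _ n p]) (auto simp: scalar_prod_def mult.assoc)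

lemma smult_mat_mult:
  fixes a b :: "'a::cstar_algebra mat"
  assumes a: "a \<in> carrier_mat n m" and b: "b \<in> carrier_mat m p"
  shows "(k \<cdot>\<^sub>m a) * b = k \<cdot>\<^sub>m (a * b)"
  using assms by (intro mat_eqI[of _ n p]) (auto simp: scalar_prod_def mult.assoc sum_distrib_left)

section \<open>Spectral subspaces\<close>

locale unitary_system = cstar_system F G T \<alpha> \<mu>
  for F :: "('a::cstar_algebra \<Rightarrow>\<^sub>L complex) set"
    and G :: "('g, 'm) monoid_scheme" (structure)
    and T :: "'g topology" and \<alpha> :: "'g \<Rightarrow> 'a \<Rightarrow> 'a" and \<mu> :: "'g measure" +
  fixes \<pi> :: "'g \<Rightarrow> complex mat"
  assumes unitary: "unitary_rep G T \<pi>" and dim_pos: "rep_dim G \<pi> > 0"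
begin

abbreviation "d \<equiv> rep_dim G \<pi>"
abbreviation "Fix \<equiv> fixed_points G \<alpha>"
abbreviation "X2 \<equiv> spectral_subspace G \<alpha> \<pi>"
abbreviation "AF \<equiv> ad_fixed_algebra G \<alpha> \<pi>"

lemma \<pi>_carrier: "g \<in> carrier G \<Longrightarrow> \<pi> g \<in> carrier_mat d d"
  and \<pi>_unitary: "g \<in> carrier G \<Longrightarrow> \<pi> g * mat_adjoint (\<pi> g) = 1\<^sub>m d"
    "g \<in> carrier G \<Longrightarrow> mat_adjoint (\<pi> g) * \<pi> g = 1\<^sub>m d"
  and \<pi>_mult: "g \<in> carrier G \<Longrightarrow> h \<in> carrier G \<Longrightarrow> \<pi> (g \<otimes> h) = \<pi> g * \<pi> h"
  using unitary by (auto simp: unitary_rep_def unitary_mat_def)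

lemma \<pi>_one: "\<pi> \<one> = 1\<^sub>m d"
proof -
  note c = \<pi>_carrier[OF one_closed]
  have "\<pi> \<one> = \<pi> \<one> * (\<pi> \<one> * mat_adjoint (\<pi> \<one>))"
    using c by (simp add: \<pi>_unitary)
  also have "\<dots> = (\<pi> \<one> * \<pi> \<one>) * mat_adjoint (\<pi> \<one>)"
    by (rule assoc_mult_mat[symmetric, OF c c mat_adjoint_carrier[OF c]])
  also have "\<pi> \<one> * \<pi> \<one> = \<pi> \<one>" using \<pi>_mult[of \<one> \<one>] by simp
  finally show ?thesis by (simp add: \<pi>_unitary)
qed

lemma \<pi>_inv: "g \<in> carrier G \<Longrightarrow> \<pi> (inv g) * \<pi> g = 1\<^sub>m d" "g \<in> carrier G \<Longrightarrow> \<pi> g * \<pi> (inv g) = 1\<^sub>m d"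
  using \<pi>_mult[of "inv g" g] \<pi>_mult[of g "inv g"] by (simp_all add: \<pi>_one)

lemma \<pi>_adjoint:
  assumes g: "g \<in> carrier G" shows "mat_adjoint (\<pi> g) = \<pi> (inv g)"
proof -
  note c = \<pi>_carrier[OF g] and c' = \<pi>_carrier[OF inv_closed[OF g]]
  have "mat_adjoint (\<pi> g) = mat_adjoint (\<pi> g) * (\<pi> g * \<pi> (inv g))"
    using mat_adjoint_carrier[OF c] by (simp add: \<pi>_inv g)
  also have "\<dots> = (mat_adjoint (\<pi> g) * \<pi> g) * \<pi> (inv g)"
    by (rule assoc_mult_mat[symmetric, OF mat_adjoint_carrier[OF c] c c'])
  finally show ?thesis using c' by (simp add: \<pi>_unitary g)
qed

lemma X2_carrier: "a \<in> X2 \<Longrightarrow> a \<in> carrier_mat d d"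
  and X2_\<alpha>: "a \<in> X2 \<Longrightarrow> g \<in> carrier G \<Longrightarrow> map_mat (\<alpha> g) a = mat_rmult a (\<pi> g)"
  by (simp_all add: spectral_subspace_def)

text \<open>
  The defining equation \<open>\<pi>\<^sub>g \<alpha>\<^sub>g(b) \<pi>\<^sub>g\<^sup>-\<^sup>1 = b\<close>, solved for \<open>\<alpha>\<^sub>g(b)\<close>.
\<close>

lemma ad_fixed_iff:
  "b \<in> AF Y \<longleftrightarrow> b \<in> mats_over d Y \<and>
    (\<forall>g\<in>carrier G. map_mat (\<alpha> g) b = mat_lmult (\<pi> (inv g)) (mat_rmult b (\<pi> g)))"
proof -
  have "ad_action G \<alpha> \<pi> g b = b \<longleftrightarrow> map_mat (\<alpha> g) b = mat_lmult (\<pi> (inv g)) (mat_rmult b (\<pi> g))"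
    if b: "b \<in> carrier_mat d d" and g: "g \<in> carrier G" for g
  proof -
    define c where "c = map_mat (\<alpha> g) b"
    have c: "c \<in> carrier_mat d d" using b by (simp add: c_def)
    note p = \<pi>_carrier[OF g] and q = \<pi>_carrier[OF inv_closed[OF g]]
    have act: "ad_action G \<alpha> \<pi> g b = mat_lmult (\<pi> g) (mat_rmult c (\<pi> (inv g)))"
      unfolding ad_action_def c_def[symmetric] by (rule mat_lmult_rmult[OF p c q])
    have "mat_lmult (\<pi> (inv g)) (mat_rmult (mat_lmult (\<pi> g) (mat_rmult c (\<pi> (inv g)))) (\<pi> g)) = c"
      using mat_lmult_rmult[OF p mat_rmult_carrier[OF c q] p] mat_lmult_assoc[OF q p, of "mat_rmult (mat_rmult c (\<pi> (inv g))) (\<pi> g)" d]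
        mat_rmult_assoc[OF c q p] c g by (simp add: \<pi>_inv mat_rmult_one mat_lmult_one)
    moreover have "mat_lmult (\<pi> g) (mat_rmult (mat_lmult (\<pi> (inv g)) (mat_rmult b (\<pi> g))) (\<pi> (inv g))) = b"
      using mat_lmult_rmult[OF q mat_rmult_carrier[OF b p] q] mat_lmult_assoc[OF p q, of "mat_rmult (mat_rmult b (\<pi> g)) (\<pi> (inv g))" d]
        mat_rmult_assoc[OF b p q] b g by (simp add: \<pi>_inv mat_rmult_one mat_lmult_one)
    ultimately show ?thesis unfolding act c_def[symmetric] by metis
  qed
  then show ?thesis unfolding ad_fixed_algebra_def by (auto simp: mats_over_def)
qed

lemma AF_carrier: "b \<in> AF Y \<Longrightarrow> b \<in> carrier_mat d d"
  and AF_entry: "b \<in> AF Y \<Longrightarrow> i < d \<Longrightarrow> j < d \<Longrightarrow> b $$ (i, j) \<in> Y"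
  and AF_\<alpha>: "b \<in> AF Y \<Longrightarrow> g \<in> carrier G \<Longrightarrow> map_mat (\<alpha> g) b = mat_lmult (\<pi> (inv g)) (mat_rmult b (\<pi> g))"
  and AF_mono: "b \<in> AF Y \<Longrightarrow> (\<And>i j. i < d \<Longrightarrow> j < d \<Longrightarrow> b $$ (i, j) \<in> Z) \<Longrightarrow> b \<in> AF Z"
  by (auto simp: ad_fixed_iff mats_over_def)

lemma map_\<alpha>_mult:
  assumes "g \<in> carrier G" "a \<in> carrier_mat n m" "b \<in> carrier_mat m p"
  shows "map_mat (\<alpha> g) (a * b) = map_mat (\<alpha> g) a * map_mat (\<alpha> g) b"
  using assms by (intro mat_eqI[of _ n p]) (auto simp: scalar_prod_def \<alpha>_sum \<alpha>_mult)

lemma map_\<alpha>_star: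
  assumes "g \<in> carrier G" "a \<in> carrier_mat n m"
  shows "map_mat (\<alpha> g) (mat_star a) = mat_star (map_mat (\<alpha> g) a)"
  using assms by (intro mat_eqI[of _ m n]) (auto simp: mat_star_def \<alpha>_star)

text \<open>
  From \<open>\<alpha>\<^sub>g(a) = a \<pi>\<^sub>g\<close> and \<open>\<alpha>\<^sub>g(b) = \<pi>\<^sub>g\<^sup>-\<^sup>1 b \<pi>\<^sub>g\<close> one gets \<open>\<alpha>\<^sub>g(a b) = a b \<pi>\<^sub>g\<close>.
\<close>

lemma X2_mult_AF:
  assumes a: "a \<in> X2" and b: "b \<in> AF Y" shows "a * b \<in> X2"
proof -
  note ac = X2_carrier[OF a] and bc = AF_carrier[OF b]
  have "map_mat (\<alpha> g) (a * b) = mat_rmult (a * b) (\<pi> g)" if g: "g \<in> carrier G" for g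
  proof -
    note p = \<pi>_carrier[OF g] and q = \<pi>_carrier[OF inv_closed[OF g]]
    have "map_mat (\<alpha> g) (a * b) = mat_rmult a (\<pi> g) * mat_lmult (\<pi> (inv g)) (mat_rmult b (\<pi> g))"
      using map_\<alpha>_mult[OF g ac bc] X2_\<alpha>[OF a g] AF_\<alpha>[OF b g] by simp
    also have "\<dots> = a * mat_lmult (\<pi> g) (mat_lmult (\<pi> (inv g)) (mat_rmult b (\<pi> g)))"
      by (rule mat_rmult_mult[OF ac p mat_lmult_carrier[OF q mat_rmult_carrier[OF bc p]]])
    also have "\<dots> = a * mat_rmult b (\<pi> g)"
      using mat_lmult_assoc[OF p q mat_rmult_carrier[OF bc p]] mat_rmult_carrier[OF bc p] g
      by (simp add: \<pi>_inv mat_lmult_one)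
    also have "\<dots> = mat_rmult (a * b) (\<pi> g)" by (rule mult_mat_rmult[OF ac bc p])
    finally show ?thesis .
  qed
  then show ?thesis using ac bc by (simp add: spectral_subspace_def)
qed

lemma X2_smult:
  assumes a: "a \<in> X2" and k: "k \<in> Fix"
  shows "k \<cdot>\<^sub>m a \<in> X2" and "map_mat (\<lambda>x. x * k) a \<in> X2"
proof -
  note ac = X2_carrier[OF a]
  have entry: "\<alpha> g (a $$ (i, j)) = mat_rmult a (\<pi> g) $$ (i, j)" if "g \<in> carrier G" "i < d" "j < d" for g i j
    using arg_cong[OF X2_\<alpha>[OF a that(1)], of "\<lambda>A. A $$ (i, j)"] that ac by simp
  have "map_mat (\<alpha> g) (k \<cdot>\<^sub>m a) = mat_rmult (k \<cdot>\<^sub>m a) (\<pi> g)" if g: "g \<in> carrier G" for g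
  proof (rule mat_eqI)
    fix i j assume ij: "i < d" "j < d"
    have kc: "k \<cdot>\<^sub>m a \<in> carrier_mat d d" using ac by simp
    show "map_mat (\<alpha> g) (k \<cdot>\<^sub>m a) $$ (i, j) = mat_rmult (k \<cdot>\<^sub>m a) (\<pi> g) $$ (i, j)"
      using ij ac entry[OF g ij] fixed_pointsD[OF k g]
      by (simp add: index_mat_rmult[OF kc \<pi>_carrier[OF g]] index_mat_rmult[OF ac \<pi>_carrier[OF g]] \<alpha>_mult[OF g]
          sum_distrib_left mult_scaleC_right)
  qed (use ac \<pi>_carrier[OF g] in \<open>auto intro!: mat_rmult_carrier\<close>)
  moreover have "map_mat (\<alpha> g) (map_mat (\<lambda>x. x * k) a) = mat_rmult (map_mat (\<lambda>x. x * k) a) (\<pi> g)" if g: "g \<in> carrier G" for g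
  proof (rule mat_eqI)
    fix i j assume ij: "i < d" "j < d"
    have kc: "map_mat (\<lambda>x. x * k) a \<in> carrier_mat d d" using ac by simp
    show "map_mat (\<alpha> g) (map_mat (\<lambda>x. x * k) a) $$ (i, j) = mat_rmult (map_mat (\<lambda>x. x * k) a) (\<pi> g) $$ (i, j)"
      using ij ac entry[OF g ij] fixed_pointsD[OF k g]
      by (simp add: index_mat_rmult[OF kc \<pi>_carrier[OF g]] index_mat_rmult[OF ac \<pi>_carrier[OF g]] \<alpha>_mult[OF g]
          sum_distrib_right mult_scaleC_left)
  qed (use ac \<pi>_carrier[OF g] in \<open>auto intro!: mat_rmult_carrier\<close>)
  ultimately show "k \<cdot>\<^sub>m a \<in> X2" "map_mat (\<lambda>x. x * k) a \<in> X2"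
    using ac by (simp_all add: spectral_subspace_def)
qed

text \<open>
  These are the diagonal entries of \<open>M M*\<close>, and \<open>\<alpha>\<^sub>g(M M*) = M \<pi>\<^sub>g \<pi>\<^sub>g* M* = M M*\<close>.
\<close>

lemma X2_row_fixed:
  assumes M: "M \<in> X2" and i: "i < d"
  shows "(\<Sum>l<d. M $$ (i, l) * star (M $$ (i, l))) \<in> Fix"
proof -
  note Mc = X2_carrier[OF M]
  have eq: "(M * mat_star M) $$ (i, i) = (\<Sum>l<d. M $$ (i, l) * star (M $$ (i, l)))"
    using i by (simp add: index_mult_mat_sum[OF Mc mat_star_carrier[OF Mc]] index_mat_star[OF Mc])
  have "map_mat (\<alpha> g) (M * mat_star M) = M * mat_star M" if g: "g \<in> carrier G" for g
  proof -
    note p = \<pi>_carrier[OF g] and q = \<pi>_carrier[OF inv_closed[OF g]]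
    have "map_mat (\<alpha> g) (M * mat_star M) = mat_rmult M (\<pi> g) * mat_lmult (\<pi> (inv g)) (mat_star M)"
      using map_\<alpha>_mult[OF g Mc mat_star_carrier[OF Mc]] map_\<alpha>_star[OF g Mc] X2_\<alpha>[OF M g] mat_star_rmult[OF Mc p]
      by (simp add: \<pi>_adjoint g)
    also have "\<dots> = M * mat_lmult (\<pi> g) (mat_lmult (\<pi> (inv g)) (mat_star M))"
      by (rule mat_rmult_mult[OF Mc p mat_lmult_carrier[OF q mat_star_carrier[OF Mc]]])
    also have "\<dots> = M * mat_star M"
      using mat_lmult_assoc[OF p q mat_star_carrier[OF Mc]] mat_star_carrier[OF Mc] g by (simp add: \<pi>_inv mat_lmult_one)
    finally show ?thesis .
  qed
  moreover define N where "N = M * mat_star M"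
  moreover have "N \<in> carrier_mat d d" unfolding N_def by (rule mult_carrier_mat[OF Mc mat_star_carrier[OF Mc]])
  ultimately have "\<alpha> g (N $$ (i, i)) = N $$ (i, i)" if "g \<in> carrier G" for g
    using that i by (metis carrier_matD index_map_mat(1))
  then show ?thesis unfolding eq[symmetric] N_def by (simp add: fixed_points_def)
qed

lemma AF_star:
  assumes b: "b \<in> AF Y" shows "mat_star b \<in> AF UNIV"
  unfolding ad_fixed_iff
proof (intro conjI ballI)
  note bc = AF_carrier[OF b]
  fix g assume g: "g \<in> carrier G"
  note p = \<pi>_carrier[OF g] and q = \<pi>_carrier[OF inv_closed[OF g]]
  have "map_mat (\<alpha> g) (mat_star b) = mat_star (mat_lmult (\<pi> (inv g)) (mat_rmult b (\<pi> g)))"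
    using map_\<alpha>_star[OF g bc] AF_\<alpha>[OF b g] by simp
  also have "\<dots> = mat_rmult (mat_lmult (\<pi> (inv g)) (mat_star b)) (\<pi> g)"
    using mat_star_lmult[OF q mat_rmult_carrier[OF bc p]] mat_star_rmult[OF bc p] g
      \<pi>_adjoint[OF g] \<pi>_adjoint[OF inv_closed[OF g]] by simp
  also have "\<dots> = mat_lmult (\<pi> (inv g)) (mat_rmult (mat_star b) (\<pi> g))"
    by (rule mat_lmult_rmult[OF q mat_star_carrier[OF bc] p])
  finally show "map_mat (\<alpha> g) (mat_star b) = mat_lmult (\<pi> (inv g)) (mat_rmult (mat_star b) (\<pi> g))" .
qed (use mat_star_carrier[OF AF_carrier[OF b]] in \<open>simp add: mats_over_def\<close>)

lemma AF_mult:
  assumes b: "b \<in> AF Y" and c: "c \<in> AF Z" shows "b * c \<in> AF UNIV"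
  unfolding ad_fixed_iff
proof (intro conjI ballI)
  note bc = AF_carrier[OF b] and cc = AF_carrier[OF c]
  fix g assume g: "g \<in> carrier G"
  note p = \<pi>_carrier[OF g] and q = \<pi>_carrier[OF inv_closed[OF g]]
  have "map_mat (\<alpha> g) (b * c) = mat_lmult (\<pi> (inv g)) (mat_rmult b (\<pi> g)) * mat_lmult (\<pi> (inv g)) (mat_rmult c (\<pi> g))"
    using map_\<alpha>_mult[OF g bc cc] AF_\<alpha>[OF b g] AF_\<alpha>[OF c g] by simp
  also have "\<dots> = mat_lmult (\<pi> (inv g)) (mat_rmult b (\<pi> g) * mat_lmult (\<pi> (inv g)) (mat_rmult c (\<pi> g)))"
    by (rule mat_lmult_mult[OF q mat_rmult_carrier[OF bc p] mat_lmult_carrier[OF q mat_rmult_carrier[OF cc p]]])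
  also have "mat_rmult b (\<pi> g) * mat_lmult (\<pi> (inv g)) (mat_rmult c (\<pi> g)) = b * mat_lmult (\<pi> g) (mat_lmult (\<pi> (inv g)) (mat_rmult c (\<pi> g)))"
    by (rule mat_rmult_mult[OF bc p mat_lmult_carrier[OF q mat_rmult_carrier[OF cc p]]])
  also have "\<dots> = b * mat_rmult c (\<pi> g)"
    using mat_lmult_assoc[OF p q mat_rmult_carrier[OF cc p]] mat_rmult_carrier[OF cc p] g by (simp add: \<pi>_inv mat_lmult_one)
  also have "\<dots> = mat_rmult (b * c) (\<pi> g)" by (rule mult_mat_rmult[OF bc cc p])
  finally show "map_mat (\<alpha> g) (b * c) = mat_lmult (\<pi> (inv g)) (mat_rmult (b * c) (\<pi> g))" .
qed (use AF_carrier[OF b] AF_carrier[OF c] in \<open>simp add: mats_over_def\<close>)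

lemma AF_smult:
  assumes b: "b \<in> AF Y" and k: "k \<in> Fix" shows "k \<cdot>\<^sub>m b \<in> AF UNIV"
  unfolding ad_fixed_iff
proof (intro conjI ballI)
  note bc = AF_carrier[OF b]
  have kc: "k \<cdot>\<^sub>m b \<in> carrier_mat d d" using bc by simp
  then show "k \<cdot>\<^sub>m b \<in> mats_over d UNIV" by (simp add: mats_over_def)
  fix g assume g: "g \<in> carrier G"
  note p = \<pi>_carrier[OF g] and q = \<pi>_carrier[OF inv_closed[OF g]]
  show "map_mat (\<alpha> g) (k \<cdot>\<^sub>m b) = mat_lmult (\<pi> (inv g)) (mat_rmult (k \<cdot>\<^sub>m b) (\<pi> g))"
  proof (rule mat_eqI)
    fix i j assume ij: "i < d" "j < d"
    have "\<alpha> g (b $$ (i, j)) = mat_lmult (\<pi> (inv g)) (mat_rmult b (\<pi> g)) $$ (i, j)"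
      using arg_cong[OF AF_\<alpha>[OF b g], of "\<lambda>A. A $$ (i, j)"] ij bc by simp
    then show "map_mat (\<alpha> g) (k \<cdot>\<^sub>m b) $$ (i, j) = mat_lmult (\<pi> (inv g)) (mat_rmult (k \<cdot>\<^sub>m b) (\<pi> g)) $$ (i, j)"
      using ij bc fixed_pointsD[OF k g]
      by (simp add: \<alpha>_mult[OF g] index_mat_lmult[OF q mat_rmult_carrier[OF kc p]] index_mat_rmult[OF kc p]
          index_mat_lmult[OF q mat_rmult_carrier[OF bc p]] index_mat_rmult[OF bc p]
          sum_distrib_left mult_scaleC_right)
  qed (use kc p q in \<open>auto intro!: mat_rmult_carrier mat_lmult_carrier\<close>)
qed

text \<open>
  The trace does not change under conjugation by the scalar matrix \<open>\<pi>\<^sub>g\<close>, although the entries of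
  \<open>b\<close> do not commute.
\<close>

lemma AF_trace_fixed:
  assumes b: "b \<in> AF Y" shows "(\<Sum>i<d. b $$ (i, i)) \<in> Fix"
  unfolding fixed_points_def
proof safe
  note bc = AF_carrier[OF b]
  fix g assume g: "g \<in> carrier G"
  note p = \<pi>_carrier[OF g] and q = \<pi>_carrier[OF inv_closed[OF g]]
  have "\<alpha> g (b $$ (i, i)) = mat_rmult (mat_lmult (\<pi> (inv g)) b) (\<pi> g) $$ (i, i)" if "i < d" for i
    using arg_cong[OF AF_\<alpha>[OF b g], of "\<lambda>A. A $$ (i, i)"] that bc mat_lmult_rmult[OF q bc p] by simp
  then have "\<alpha> g (\<Sum>i<d. b $$ (i, i)) = (\<Sum>i<d. \<Sum>k<d. \<Sum>l<d. (\<pi> g $$ (k, i) * \<pi> (inv g) $$ (i, l)) *\<^sub>C b $$ (l, k))"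
    using g by (simp add: \<alpha>_sum index_mat_rmult[OF mat_lmult_carrier[OF q bc] p] index_mat_lmult[OF q bc]
        scaleC_sum_right scaleC_scaleC)
  also have "\<dots> = (\<Sum>k<d. \<Sum>i<d. \<Sum>l<d. (\<pi> g $$ (k, i) * \<pi> (inv g) $$ (i, l)) *\<^sub>C b $$ (l, k))" by (rule sum.swap)
  also have "\<dots> = (\<Sum>k<d. \<Sum>l<d. \<Sum>i<d. (\<pi> g $$ (k, i) * \<pi> (inv g) $$ (i, l)) *\<^sub>C b $$ (l, k))"
    by (intro sum.cong refl sum.swap)
  also have "\<dots> = (\<Sum>k<d. \<Sum>l<d. (\<pi> g * \<pi> (inv g)) $$ (k, l) *\<^sub>C b $$ (l, k))"
    by (intro sum.cong refl) (simp add: index_mult_mat_sum[OF p q] scaleC_sum_left)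
  also have "\<dots> = (\<Sum>k<d. \<Sum>l<d. if k = l then b $$ (l, k) else 0)"
    using g by (intro sum.cong refl) (simp add: \<pi>_inv scaleC_one)
  also have "\<dots> = (\<Sum>k<d. b $$ (k, k))" by simp
  finally show "\<alpha> g (\<Sum>i<d. b $$ (i, i)) = (\<Sum>i<d. b $$ (i, i))" .
qed

lemma AF_square_sum_fixed:
  assumes b: "b \<in> AF Y" shows "(\<Sum>i<d. \<Sum>l<d. b $$ (i, l) * star (b $$ (i, l))) \<in> Fix"
proof -
  note bc = AF_carrier[OF b]
  have "(\<Sum>i<d. (b * mat_star b) $$ (i, i)) \<in> Fix"
    by (rule AF_trace_fixed[OF AF_mult[OF b AF_star[OF b]]])
  moreover have "(\<Sum>i<d. (b * mat_star b) $$ (i, i)) = (\<Sum>i<d. \<Sum>l<d. b $$ (i, l) * star (b $$ (i, l)))"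
    by (intro sum.cong refl) (simp add: index_mult_mat_sum[OF bc mat_star_carrier[OF bc]] index_mat_star[OF bc])
  ultimately show ?thesis by simp
qed

lemma matrix_eq_0_if_square_sum_eq_0:
  assumes b: "b \<in> carrier_mat d d" and "(\<Sum>i<d. \<Sum>l<d. b $$ (i, l) * star (b $$ (i, l))) = 0"
  shows "b = 0\<^sub>m d d"
proof (rule mat_eqI[OF b zero_carrier_mat])
  fix i j assume "i < d" "j < d"
  then show "b $$ (i, j) = 0\<^sub>m d d $$ (i, j)"
    using sum_mult_star_self_eq_0[of "{..<d} \<times> {..<d}" "\<lambda>p. b $$ p" "(i, j)"] assms(2)
    by (simp add: sum.cartesian_product)
qed

text \<open>
  Let \<open>e\<close> be a diagonal entry of \<open>M M*\<close>. It is self-adjoint, and if it annihilates its row of \<open>M\<close> then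
  \<open>e\<^sup>2 = 0\<close>.
\<close>

lemma matrix_eq_0_if_rows_annihilate:
  assumes M: "M \<in> carrier_mat d d"
    and zero: "\<And>i l. i < d \<Longrightarrow> l < d \<Longrightarrow> (\<Sum>l<d. M $$ (i, l) * star (M $$ (i, l))) * M $$ (i, l) = 0"
  shows "M = 0\<^sub>m d d"
proof (rule mat_eqI[OF M zero_carrier_mat])
  fix i j assume ij: "i < d" "j < d"
  define e where "e = (\<Sum>l<d. M $$ (i, l) * star (M $$ (i, l)))"
  have "e * e = (\<Sum>l<d. e * M $$ (i, l) * star (M $$ (i, l)))"
    by (subst (2) e_def) (simp add: sum_distrib_left mult.assoc)
  also have "\<dots> = 0" using zero ij by (intro sum.neutral) (simp add: e_def)
  finally have "e = 0"
    using star_mult_self_eq_0[of e] by (simp add: e_def star_sum star_mult star_star)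
  then show "M $$ (i, j) = 0\<^sub>m d d $$ (i, j)"
    using sum_mult_star_self_eq_0[of "{..<d}" "\<lambda>l. M $$ (i, l)" j] ij by (simp add: e_def)
qed

section \<open>Essential ideals and annihilating matrices\<close>

text \<open>
  The second equation is the first one for \<open>b*\<close>. Together they say that \<open>b\<close> annihilates the ideal
  generated by all \<open>a* a'\<close> from both sides.
\<close>

definition annihilates :: "'a set \<Rightarrow> 'a mat \<Rightarrow> bool" where
  "annihilates Y b \<longleftrightarrow> (\<forall>a\<in>X2 \<inter> mats_over d Y. a * b = 0\<^sub>m d d \<and> b * mat_star a = 0\<^sub>m d d)"

abbreviation "MW \<equiv> mat_weak_topology d F"

lemma topspace_mat_weak: "topspace MW = carrier_mat d d"
proof -
  have "carrier_mat d d \<in> {{a \<in> carrier_mat d d. blinfun_apply \<phi> (a $$ (i, j)) \<in> U} | \<phi> i j U.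
        \<phi> \<in> F \<and> i < d \<and> j < d \<and> open U}"
    using zero_functional dim_pos by (intro CollectI exI[of _ 0] exI[of _ UNIV]) auto
  then show ?thesis unfolding mat_weak_topology_def topology_generated_by_topspace by blast
qed

lemma continuous_entry:
  assumes "i < d" "j < d" shows "continuous_map MW W (\<lambda>a. a $$ (i, j))"
proof (rule continuous_map_into_weak)
  fix \<phi> assume \<phi>: "\<phi> \<in> F"
  show "continuous_map MW euclidean (\<lambda>a. blinfun_apply \<phi> (a $$ (i, j)))"
    unfolding continuous_map_def
  proof (intro conjI allI impI)
    fix U :: "complex set" assume "openin euclidean U"
    then have "{a \<in> carrier_mat d d. blinfun_apply \<phi> (a $$ (i, j)) \<in> U} \<in>
      {{a \<in> carrier_mat d d. blinfun_apply \<phi> (a $$ (i, j)) \<in> U} | \<phi> i j U. \<phi> \<in> F \<and> i < d \<and> j < d \<and> open U}"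
      using \<phi> assms by auto
    then have "openin MW {a \<in> carrier_mat d d. blinfun_apply \<phi> (a $$ (i, j)) \<in> U}"
      unfolding mat_weak_topology_def by (rule topology_generated_by_Basis)
    then show "openin MW {a \<in> topspace MW. blinfun_apply \<phi> (a $$ (i, j)) \<in> U}" by (simp add: topspace_mat_weak)
  qed auto
qed

lemma weak_continuous_sum:
  "(\<And>k. k \<in> K \<Longrightarrow> continuous_map X W (f k)) \<Longrightarrow> continuous_map X W (\<lambda>x. \<Sum>k\<in>K. f k x)"
  by (induction K rule: infinite_finite_induct) (simp_all add: weak_continuous_add)

lemma mat_closure_annihilates:
  assumes m: "m \<in> MW closure_of S" and S: "S \<subseteq> carrier_mat d d" and b: "b \<in> carrier_mat d d"
    and zero: "\<And>s. s \<in> S \<Longrightarrow> s * b = 0\<^sub>m d d \<and> b * s = 0\<^sub>m d d"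
  shows "m * b = 0\<^sub>m d d \<and> b * m = 0\<^sub>m d d"
proof -
  have mc: "m \<in> carrier_mat d d" using m closure_of_subset_topspace[of MW S] by (auto simp: topspace_mat_weak)
  have entries: "(m * b) $$ (i, j) = 0 \<and> (b * m) $$ (i, j) = 0" if ij: "i < d" "j < d" for i j
  proof -
    have "(\<Sum>k<d. m $$ (i, k) * b $$ (k, j)) = 0"
    proof (rule forall_in_closure_of_eq[OF m Hausdorff_weak])
      show "continuous_map MW W (\<lambda>m. \<Sum>k<d. m $$ (i, k) * b $$ (k, j))"
        using ij by (intro weak_continuous_sum continuous_map_compose[OF continuous_entry continuous_mult_right, unfolded o_def]) auto
      fix s assume s: "s \<in> S"
      show "(\<Sum>k<d. s $$ (i, k) * b $$ (k, j)) = 0"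
        using zero[OF s] S s b ij index_mult_mat_sum[of s d d b d i j] by (auto simp: subset_iff)
    qed simp
    moreover have "(\<Sum>k<d. b $$ (i, k) * m $$ (k, j)) = 0"
    proof (rule forall_in_closure_of_eq[OF m Hausdorff_weak])
      show "continuous_map MW W (\<lambda>m. \<Sum>k<d. b $$ (i, k) * m $$ (k, j))"
        using ij by (intro weak_continuous_sum continuous_map_compose[OF continuous_entry continuous_mult_left, unfolded o_def]) auto
      fix s assume s: "s \<in> S"
      show "(\<Sum>k<d. b $$ (i, k) * s $$ (k, j)) = 0"
        using zero[OF s] S s b ij index_mult_mat_sum[of b d d s d i j] by (auto simp: subset_iff)
    qed simp
    ultimately show ?thesis using mc b ij by (simp add: index_mult_mat_sum del: index_mult_mat)
  qed
  show ?thesis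
    using entries mc b by (intro conjI mat_eqI[of _ d d]) (auto simp del: index_mult_mat(1))
qed

lemma mat_span_carrier:
  assumes "S \<subseteq> carrier_mat d d" shows "mat_span d S \<subseteq> carrier_mat d d"
proof
  fix m assume "m \<in> mat_span d S"
  then show "m \<in> carrier_mat d d" by induction (use assms in auto)
qed

lemma mat_span_annihilates:
  fixes S :: "'a mat set"
  assumes "m \<in> mat_span d S" and S: "S \<subseteq> carrier_mat d d" and b: "b \<in> carrier_mat d d"
    and zero: "\<And>s. s \<in> S \<Longrightarrow> s * b = 0\<^sub>m d d \<and> b * s = 0\<^sub>m d d"
  shows "m \<in> carrier_mat d d \<and> m * b = 0\<^sub>m d d \<and> b * m = 0\<^sub>m d d"
  using assms(1)
proof induction
  case zero
  then show ?case using b by simp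
next
  case (step A B c)
  have A: "A \<in> carrier_mat d d" "A * b = 0\<^sub>m d d" "b * A = 0\<^sub>m d d" using step.hyps S zero by auto
  have "map_mat (scaleC c) A * b = map_mat (scaleC c) (A * b)"
    using A(1) b by (intro mat_eqI[of _ d d]) (auto simp: scalar_prod_def scaleC_sum_right intro!: sum.cong mult_scaleC_left)
  moreover have "b * map_mat (scaleC c) A = map_mat (scaleC c) (b * A)"
    using A(1) b by (intro mat_eqI[of _ d d]) (auto simp: scalar_prod_def scaleC_sum_right intro!: sum.cong mult_scaleC_right)
  moreover have "map_mat (scaleC c) (0\<^sub>m d d) = (0\<^sub>m d d :: 'a mat)" by (intro mat_eqI[of _ d d]) auto
  moreover have "map_mat (scaleC c) A \<in> carrier_mat d d" using A by simp
  ultimately show ?case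
    using A b step.IH add_mult_distrib_mat[of "map_mat (scaleC c) A" d d B b d] mult_add_distrib_mat[of b d d "map_mat (scaleC c) A" d B]
    by simp
qed

text \<open>
  If \<open>a* a b = 0\<close> then \<open>(a b)* (a b) = 0\<close>, so \<open>a b = 0\<close>; the other side is similar. Conversely, annihilating
  a set of matrices is inherited by linear span and, as multiplication is separately
  continuous, by the closure.
\<close>

lemma annihilates_iff:
  assumes b: "b \<in> carrier_mat d d"
  shows "(\<forall>m\<in>MW closure_of mat_span d {mat_star a * a' | a a'. a \<in> X2 \<inter> mats_over d Y \<and> a' \<in> X2 \<inter> mats_over d Y}.
      m * b = 0\<^sub>m d d \<and> b * m = 0\<^sub>m d d) \<longleftrightarrow> annihilates Y b" (is "(\<forall>m\<in>MW closure_of mat_span d ?S. _) \<longleftrightarrow> _")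
proof
  have S: "?S \<subseteq> carrier_mat d d"
    using mult_carrier_mat[OF mat_star_carrier[OF X2_carrier] X2_carrier] by blast
  {
    assume *: "\<forall>m\<in>MW closure_of mat_span d ?S. m * b = 0\<^sub>m d d \<and> b * m = 0\<^sub>m d d"
    show "annihilates Y b"
      unfolding annihilates_def
    proof
      fix a assume a: "a \<in> X2 \<inter> mats_over d Y"
      then have ac: "a \<in> carrier_mat d d" using X2_carrier by auto
      note asc = mat_star_carrier[OF ac]
      have sub: "mat_span d ?S \<subseteq> topspace MW"
        unfolding topspace_mat_weak by (rule mat_span_carrier[OF S])
      have "map_mat (scaleC 1) (mat_star a * a) + 0\<^sub>m d d \<in> mat_span d ?S"
        using a by (intro mat_span.intros) auto
      moreover have "map_mat (scaleC 1) (mat_star a * a) + 0\<^sub>m d d = mat_star a * a"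
        using ac asc by (intro mat_eqI[of _ d d]) (auto simp: scaleC_one)
      ultimately have "mat_star a * a \<in> MW closure_of mat_span d ?S"
        using closure_of_subset[OF sub] by auto
      then have zero: "mat_star a * a * b = 0\<^sub>m d d" "b * (mat_star a * a) = 0\<^sub>m d d" using * by auto
      have ab: "a * b \<in> carrier_mat d d" using ac b by simp
      have bas: "b * mat_star a \<in> carrier_mat d d" using asc b by simp
      note bs = mat_star_carrier[OF b]
      have "mat_star (a * b) * (a * b) = mat_star b * (mat_star a * (a * b))"
        using mat_star_mult[OF ac b] assoc_mult_mat[OF bs asc ab] by simp
      also have "mat_star a * (a * b) = 0\<^sub>m d d" using zero assoc_mult_mat[OF asc ac b] by simp
      also have "mat_star b * 0\<^sub>m d d = 0\<^sub>m d d" using bs by simp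
      finally have "a * b = 0\<^sub>m d d" by (rule mat_star_mult_self_eq_0[OF ab])
      moreover have "b * mat_star a * mat_star (b * mat_star a) = b * mat_star a * (a * mat_star b)"
        using mat_star_mult[OF b asc] mat_star_star[OF ac] by simp
      then have "b * mat_star a * mat_star (b * mat_star a) = b * mat_star a * a * mat_star b"
        using assoc_mult_mat[OF bas ac bs] by simp
      then have "b * mat_star a * mat_star (b * mat_star a) = 0\<^sub>m d d"
        using zero assoc_mult_mat[OF b asc ac] bs by simp
      then have "b * mat_star a = 0\<^sub>m d d" by (rule mat_mult_star_self_eq_0[OF bas])
      ultimately show "a * b = 0\<^sub>m d d \<and> b * mat_star a = 0\<^sub>m d d" by blast
    qed
  }
  {
    assume ann: "annihilates Y b"
    have zero: "s * b = 0\<^sub>m d d \<and> b * s = 0\<^sub>m d d" if s': "s \<in> ?S" for s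
    proof -
      obtain a a' where s: "s = mat_star a * a'" "a \<in> X2 \<inter> mats_over d Y" "a' \<in> X2 \<inter> mats_over d Y"
        using s' by blast
      then have ac: "a \<in> carrier_mat d d" "a' \<in> carrier_mat d d" using X2_carrier by auto
      show ?thesis
        using ann s assoc_mult_mat[OF mat_star_carrier[OF ac(1)] ac(2) b] assoc_mult_mat[OF b mat_star_carrier[OF ac(1)] ac(2)]
          mat_star_carrier[OF ac(1)] ac by (simp add: annihilates_def)
    qed
    show "\<forall>m\<in>MW closure_of mat_span d ?S. m * b = 0\<^sub>m d d \<and> b * m = 0\<^sub>m d d"
    proof
      fix m assume m: "m \<in> MW closure_of mat_span d ?S"
      show "m * b = 0\<^sub>m d d \<and> b * m = 0\<^sub>m d d"
        using mat_span_annihilates[OF _ S b zero] by (intro mat_closure_annihilates[OF m mat_span_carrier[OF S] b]) blast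
    qed
  }
qed

lemma essential_iff:
  assumes "0 \<in> Y"
  shows "essential_in (MW closure_of mat_span d {mat_star a * a' | a a'. a \<in> X2 \<inter> mats_over d Y \<and> a' \<in> X2 \<inter> mats_over d Y})
      d (AF Y) \<longleftrightarrow> (\<forall>b\<in>AF Y. annihilates Y b \<longrightarrow> b = 0\<^sub>m d d)"
proof -
  have z: "0\<^sub>m d d \<in> AF Y"
  proof -
    have "mat_rmult (0\<^sub>m d d) (\<pi> g) = (0\<^sub>m d d :: 'a mat)" "mat_lmult (\<pi> (inv g)) (0\<^sub>m d d) = (0\<^sub>m d d :: 'a mat)"
      "map_mat (\<alpha> g) (0\<^sub>m d d) = 0\<^sub>m d d" if "g \<in> carrier G" for g
      using that \<pi>_carrier[OF that] \<pi>_carrier[OF inv_closed[OF that]]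
      by (auto intro!: mat_eqI[of _ d d] mat_rmult_carrier mat_lmult_carrier simp: index_mat_rmult[of _ d d _ d] index_mat_lmult[of _ d d _ d])
    then show ?thesis using assms by (auto simp: ad_fixed_iff mats_over_def)
  qed
  have "annihilates Y (0\<^sub>m d d)"
    using right_mult_zero_mat[OF X2_carrier] left_mult_zero_mat[OF mat_star_carrier[OF X2_carrier]]
    by (simp add: annihilates_def)
  then have "0\<^sub>m d d \<in> {b \<in> AF Y. annihilates Y b}" using z by simp
  moreover have "{b \<in> AF Y. \<forall>m\<in>MW closure_of mat_span d {mat_star a * a' | a a'. a \<in> X2 \<inter> mats_over d Y \<and> a' \<in> X2 \<inter> mats_over d Y}.
      m * b = 0\<^sub>m d d \<and> b * m = 0\<^sub>m d d} = {b \<in> AF Y. annihilates Y b}"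
    using annihilates_iff AF_carrier by (intro Collect_cong conj_cong refl) blast
  ultimately show ?thesis unfolding essential_in_def by auto
qed

end

section \<open>Annihilators in the fixed point algebra\<close>

context cstar_system
begin

text \<open>
  The annihilator, inside \<open>X\<^sup>\<alpha>\<close>, of the ideal of \<open>X\<^sup>\<alpha>\<close> generated by \<open>K\<close>.
\<close>

definition ideal_annihilator :: "'a set \<Rightarrow> 'a set" where
  "ideal_annihilator K = {s \<in> fixed_points G \<alpha>. \<forall>x\<in>fixed_points G \<alpha>. \<forall>k\<in>K. s * x * k = 0 \<and> k * x * s = 0}"

definition perp :: "'a set \<Rightarrow> 'a set" where
  "perp S = {x. \<forall>s\<in>S. s * x = 0 \<and> x * s = 0}"

lemma ideal_annihilator_fixed: "s \<in> ideal_annihilator K \<Longrightarrow> s \<in> fixed_points G \<alpha>"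
  and ideal_annihilator_left: "s \<in> ideal_annihilator K \<Longrightarrow> x \<in> fixed_points G \<alpha> \<Longrightarrow> k \<in> K \<Longrightarrow> s * x * k = 0"
  and ideal_annihilator_right: "s \<in> ideal_annihilator K \<Longrightarrow> x \<in> fixed_points G \<alpha> \<Longrightarrow> k \<in> K \<Longrightarrow> k * x * s = 0"
  by (simp_all add: ideal_annihilator_def)

lemma ideal_annihilator_mult:
  assumes "s \<in> ideal_annihilator K" "x \<in> fixed_points G \<alpha>"
  shows "s * x \<in> ideal_annihilator K" "x * s \<in> ideal_annihilator K"
proof -
  have "s * x * z * k = 0" "k * z * (s * x) = 0" "x * s * z * k = 0" "k * z * (x * s) = 0"
    if "z \<in> fixed_points G \<alpha>" "k \<in> K" for z k
    using ideal_annihilator_left[OF assms(1) fixed_points_mult[OF assms(2) that(1)] that(2)]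
      ideal_annihilator_left[OF assms(1) that]
      ideal_annihilator_right[OF assms(1) fixed_points_mult[OF that(1) assms(2)] that(2)]
      ideal_annihilator_right[OF assms(1) that]
    by (auto simp: mult.assoc) (metis mult.assoc mult_zero_left)
  then show "s * x \<in> ideal_annihilator K" "x * s \<in> ideal_annihilator K"
    using fixed_points_mult ideal_annihilator_fixed[OF assms(1)] assms(2) by (simp_all add: ideal_annihilator_def)
qed

text \<open>
  With \<open>w = s* x k\<close>, the product \<open>w w*\<close> contains the factor \<open>k (k* x*) s = 0\<close>. In this
  form the statement applies to an ideal \<open>J\<close> of \<open>X\<^sup>\<alpha>\<close>, which is not given as a *-subalgebra.
\<close>

lemma ideal_annihilator_star:
  assumes K: "K \<subseteq> fixed_points G \<alpha>" and s: "s \<in> ideal_annihilator K"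
  shows "star s \<in> ideal_annihilator K"
proof -
  have "star s * x * k = 0" "k * x * star s = 0" if x: "x \<in> fixed_points G \<alpha>" and k: "k \<in> K" for x k
  proof -
    have fx: "star k * star x \<in> fixed_points G \<alpha>" "star x * star k \<in> fixed_points G \<alpha>"
      using K x k by (auto intro!: fixed_points_mult fixed_points_star)
    have "(star s * x * k) * star (star s * x * k) = star s * x * (k * (star k * star x) * s)"
      by (simp add: star_simps mult.assoc)
    then show "star s * x * k = 0"
      using ideal_annihilator_right[OF s fx(1) k] mult_star_self_eq_0[of "star s * x * k"] by simp
    have "star (k * x * star s) * (k * x * star s) = (s * (star x * star k) * k) * x * star s"
      by (simp add: star_simps mult.assoc)
    then show "k * x * star s = 0"
      using ideal_annihilator_left[OF s fx(2) k] star_mult_self_eq_0[of "k * x * star s"] by simp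
  qed
  then show ?thesis using fixed_points_star ideal_annihilator_fixed[OF s] by (simp add: ideal_annihilator_def)
qed

text \<open>
  With \<open>w = s k\<close>, the product \<open>w* w w* w\<close> contains the factor \<open>s (k k* s* s) k = 0\<close>; this replaces
  the unit that \<open>X\<^sup>\<alpha>\<close> may lack.
\<close>

lemma ideal_annihilator_annihilates:
  assumes K: "K \<subseteq> fixed_points G \<alpha>" and s: "s \<in> ideal_annihilator K" and k: "k \<in> K"
  shows "s * k = 0" "k * s = 0"
proof -
  have fx: "k \<in> fixed_points G \<alpha>" "s \<in> fixed_points G \<alpha>" using K k ideal_annihilator_fixed[OF s] by auto
  have *: "w = 0" if "star w * w * (star w * w) = 0" for w :: 'a
    using that star_mult_self_eq_0[of "star w * w"] star_mult_self_eq_0[of w] by (simp add: star_mult star_star)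
  have "star (s * k) * (s * k) * (star (s * k) * (s * k)) = star (s * k) * (s * (k * star k * star s * s) * k)"
    by (simp add: star_simps mult.assoc)
  moreover have "k * star k * star s * s \<in> fixed_points G \<alpha>" using fx by (intro fixed_points_mult fixed_points_star)
  ultimately have "star (s * k) * (s * k) * (star (s * k) * (s * k)) = 0"
    using ideal_annihilator_left[OF s _ k] by simp
  then show "s * k = 0" by (rule *)
  have "star (k * s) * (k * s) * (star (k * s) * (k * s)) = star (k * s) * (k * (s * star s * star k * k) * s)"
    by (simp add: star_simps mult.assoc)
  moreover have "s * star s * star k * k \<in> fixed_points G \<alpha>" using fx by (intro fixed_points_mult fixed_points_star)
  ultimately have "star (k * s) * (k * s) * (star (k * s) * (k * s)) = 0"
    using ideal_annihilator_right[OF s _ k] by simp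
  then show "k * s = 0" by (rule *)
qed

text \<open>
  For a self-adjoint \<open>e\<close> one of the two conditions suffices: with \<open>w = e x k\<close>, the product \<open>w w*\<close>
  contains the factor \<open>k (k* x*) e = 0\<close>.
\<close>

lemma ideal_annihilatorI:
  assumes K: "K \<subseteq> fixed_points G \<alpha>" and e: "e \<in> fixed_points G \<alpha>" "star e = e"
    and zero: "\<And>x k. x \<in> fixed_points G \<alpha> \<Longrightarrow> k \<in> K \<Longrightarrow> k * x * e = 0"
  shows "e \<in> ideal_annihilator K"
proof -
  have "e * x * k = 0" if x: "x \<in> fixed_points G \<alpha>" and k: "k \<in> K" for x k
  proof -
    have "star k * star x \<in> fixed_points G \<alpha>" using K x k by (auto intro!: fixed_points_mult fixed_points_star)
    moreover have "(e * x * k) * star (e * x * k) = e * x * (k * (star k * star x) * e)"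
      using e by (simp add: star_simps mult.assoc)
    ultimately show ?thesis using zero k mult_star_self_eq_0[of "e * x * k"] by simp
  qed
  then show ?thesis using e zero by (simp add: ideal_annihilator_def)
qed

lemma ideal_annihilator_nonempty: "ideal_annihilator K \<noteq> {}"
  using fixed_points_0 by (auto simp: ideal_annihilator_def)

lemma perp_weakly_closed: assumes "S \<noteq> {}" shows "closedin W (perp S)"
proof -
  have "perp S = (\<Inter>s\<in>S. {x. s * x = 0} \<inter> {x. x * s = 0})" by (auto simp: perp_def)
  then show ?thesis
    using assms by (auto intro!: closedin_INT closedin_Int weakly_closed_equalizer continuous_mult_left continuous_mult_right)
qed

lemma perp_subspace: "csubspace (perp S)"
  by (rule complex_space.subspaceI)
    (auto simp: perp_def distrib_left distrib_right mult_scaleC_left mult_scaleC_right)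

text \<open>
  For heredity let \<open>x = z* z\<close> and \<open>y - x = w* w\<close> with \<open>y\<close> annihilated by \<open>s\<close>. Then
  \<open>(z s)* (z s) + (w s)* (w s) = s* y s = 0\<close>, so \<open>z s = 0\<close>. Invariance holds since \<open>S\<close> consists of
  fixed points.
\<close>

lemma perp_invariant_hereditary:
  assumes S: "S \<subseteq> fixed_points G \<alpha>" "\<And>s. s \<in> S \<Longrightarrow> star s \<in> S" "S \<noteq> {}" and "perp S \<noteq> {0}"
  shows "perp S \<in> invariant_hereditary_subalgebras F G \<alpha>"
proof -
  have star: "star x \<in> perp S" if x: "x \<in> perp S" for x
  proof -
    have "s * star x = star (x * star s)" "star x * s = star (star s * x)" for s by (simp_all add: star_simps)
    then show ?thesis using x S(2) by (simp add: perp_def)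
  qed
  have "x \<in> perp S" if y: "y \<in> perp S" and pos: "positive x" "positive (y - x)" for x y
  proof -
    obtain z w where z: "x = star z * z" and w: "y - x = star w * w" using pos by (auto simp: positive_def)
    have right: "x * s = 0" if s: "s \<in> S" for s
    proof -
      have "star (z * s) * (z * s) + star (w * s) * (w * s) = star s * (y * s)"
        using arg_cong2[OF z w, of "\<lambda>u v. star s * (u + v) * s"] by (simp add: star_simps distrib_left distrib_right mult.assoc)
      also have "\<dots> = 0" using y s by (simp add: perp_def)
      finally have "star (z * s) * (z * s) = 0"
        by (rule positive_add_eq_0[rotated 2]) (auto simp: positive_def)
      then have "z * s = 0" by (simp add: star_mult_self_eq_0)
      then show ?thesis by (simp add: z mult.assoc)
    qed
    have "s * x = 0" if s: "s \<in> S" for s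
    proof -
      have "s * x = star (x * star s)" by (simp add: z star_simps mult.assoc)
      then show ?thesis using right[OF S(2)[OF s]] by simp
    qed
    then show ?thesis using right by (simp add: perp_def)
  qed
  moreover have "cstar_subalgebra (perp S)"
    unfolding cstar_subalgebra_def
    using perp_subspace weakly_closed_imp_closed[OF perp_weakly_closed[OF S(3)]] star
    by (auto simp: perp_def mult.assoc) (metis mult.assoc mult_zero_left)
  moreover have "\<alpha> g ` perp S = perp S" if g: "g \<in> carrier G" for g
  proof -
    have sub: "\<alpha> h x \<in> perp S" if h: "h \<in> carrier G" and x: "x \<in> perp S" for h x
    proof -
      have "s * \<alpha> h x = \<alpha> h (s * x)" "\<alpha> h x * s = \<alpha> h (x * s)" if "s \<in> S" for s
        using fixed_pointsD[of s h] that S(1) h by (auto simp: \<alpha>_mult)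
      then show ?thesis using x h by (simp add: perp_def)
    qed
    have "x \<in> \<alpha> g ` perp S" if "x \<in> perp S" for x
      using sub[OF inv_closed[OF g] that] \<alpha>_compose[OF g inv_closed[OF g], of x] g by (auto simp: \<alpha>_one intro!: image_eqI)
    then show ?thesis using sub g by blast
  qed
  ultimately show ?thesis
    using assms(4) perp_weakly_closed[OF S(3)]
    by (simp add: invariant_hereditary_subalgebras_def hereditary_cstar_subalgebra_def) blast
qed

lemma generated_hereditary_subset_perp:
  assumes "J \<subseteq> perp S" "S \<noteq> {}" shows "generated_hereditary F J \<subseteq> perp S"
  unfolding generated_hereditary_def
proof (rule closure_of_minimal[OF _ perp_weakly_closed[OF assms(2)]])
  show "cspan {j * x * k |j x k. j \<in> J \<and> k \<in> J} \<subseteq> perp S"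
  proof (rule complex_space.span_minimal[OF _ perp_subspace])
    show "{j * x * k |j x k. j \<in> J \<and> k \<in> J} \<subseteq> perp S"
    proof
      fix y assume "y \<in> {j * x * k |j x k. j \<in> J \<and> k \<in> J}"
      then obtain j x k where y: "y = j * x * k" "j \<in> perp S" "k \<in> perp S" using assms by blast
      have "s * y = (s * j) * x * k" "y * s = j * x * (k * s)" for s by (simp_all add: y mult.assoc)
      then show "y \<in> perp S" using y by (simp add: perp_def)
    qed
  qed
qed

lemma generated_hereditaryI: "j \<in> J \<Longrightarrow> k \<in> J \<Longrightarrow> j * x * k \<in> generated_hereditary F J"
proof -
  assume "j \<in> J" "k \<in> J"
  then have "j * x * k \<in> cspan {j * x * k |j x k. j \<in> J \<and> k \<in> J}" by (intro complex_space.span_base) blast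
  moreover have "cspan {j * x * k |j x k. j \<in> J \<and> k \<in> J} \<subseteq> generated_hereditary F J"
    unfolding generated_hereditary_def by (rule closure_of_subset) simp
  ultimately show ?thesis by (rule rev_subsetD)
qed

lemma zero_in_generated_hereditary: "0 \<in> generated_hereditary F J"
proof -
  have "0 \<in> cspan {j * x * k |j x k. j \<in> J \<and> k \<in> J}" by (rule complex_space.span_zero)
  moreover have "cspan {j * x * k |j x k. j \<in> J \<and> k \<in> J} \<subseteq> generated_hereditary F J"
    unfolding generated_hereditary_def by (rule closure_of_subset) simp
  ultimately show ?thesis by (rule rev_subsetD)
qed

lemma perp_ideal:
  assumes closed: "closedin W (fixed_points G \<alpha>)" and nonzero: "t \<in> fixed_points G \<alpha> \<inter> perp (ideal_annihilator K)" "t \<noteq> 0"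
  shows "fixed_points G \<alpha> \<inter> perp (ideal_annihilator K) \<in> closed_fixed_ideals F G \<alpha>"
proof -
  have "csubspace (fixed_points G \<alpha>)"
    by (rule complex_space.subspaceI) (simp_all add: fixed_points_0 fixed_points_add fixed_points_scaleC)
  then have "csubspace (fixed_points G \<alpha> \<inter> perp (ideal_annihilator K))"
    using perp_subspace by (rule complex_space.subspace_inter)
  moreover have "x * y \<in> perp (ideal_annihilator K)" "y * x \<in> perp (ideal_annihilator K)"
    if "x \<in> fixed_points G \<alpha>" "y \<in> perp (ideal_annihilator K)" for x y
  proof -
    have "s * (x * y) = (s * x) * y" "x * y * s = x * (y * s)" "s * (y * x) = (s * y) * x" "y * x * s = y * (x * s)" for s
      by (simp_all add: mult.assoc)
    then show "x * y \<in> perp (ideal_annihilator K)" "y * x \<in> perp (ideal_annihilator K)"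
      using that ideal_annihilator_mult[OF _ that(1)] by (simp_all add: perp_def)
  qed
  moreover have "closedin W (fixed_points G \<alpha> \<inter> perp (ideal_annihilator K))"
    using closed perp_weakly_closed[OF ideal_annihilator_nonempty] by (intro closedin_Int) auto
  ultimately show ?thesis
    using nonzero fixed_points_mult by (auto simp: closed_fixed_ideals_def)
qed

end

section \<open>Comparison of the two families of subalgebras\<close>

context unitary_system
begin

text \<open>
  A diagonal entry \<open>e\<close> of \<open>(a b) (a b)*\<close> is a fixed point with \<open>K X\<^sup>\<alpha> e = 0\<close>, so it belongs to the annihilator of
  \<open>K\<close> and annihilates \<open>a\<close>, hence its row of \<open>a b\<close>.
\<close>

lemma product_eq_0:
  assumes K: "K \<subseteq> Fix" and a: "a \<in> X2" and b: "b \<in> AF U"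
    and perp: "\<And>i l s. i < d \<Longrightarrow> l < d \<Longrightarrow> s \<in> ideal_annihilator K \<Longrightarrow> s * a $$ (i, l) = 0"
    and zero: "\<And>i l k x. i < d \<Longrightarrow> l < d \<Longrightarrow> x \<in> Fix \<Longrightarrow> k \<in> K \<Longrightarrow> k * x * (a * b) $$ (i, l) = 0"
  shows "a * b = 0\<^sub>m d d"
proof -
  define M where "M = a * b"
  have M: "M \<in> X2" unfolding M_def by (rule X2_mult_AF[OF a b])
  note ac = X2_carrier[OF a] and bc = AF_carrier[OF b] and Mc = X2_carrier[OF M]
  have "M = 0\<^sub>m d d"
  proof (rule matrix_eq_0_if_rows_annihilate[OF Mc])
    fix i l assume il: "i < d" "l < d"
    define e where "e = (\<Sum>l<d. M $$ (i, l) * star (M $$ (i, l)))"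
    have "e \<in> ideal_annihilator K"
    proof (rule ideal_annihilatorI[OF K])
      show "e \<in> Fix" unfolding e_def by (rule X2_row_fixed[OF M il(1)])
      show "star e = e" by (simp add: e_def star_sum star_mult star_star)
      fix x k assume xk: "x \<in> Fix" "k \<in> K"
      have "k * x * e = (\<Sum>l<d. (k * x * M $$ (i, l)) * star (M $$ (i, l)))"
        by (simp add: e_def sum_distrib_left mult.assoc)
      also have "\<dots> = 0" using zero[OF il(1) _ xk] by (intro sum.neutral) (simp add: M_def)
      finally show "k * x * e = 0" .
    qed
    then have "e * a $$ (i, m) = 0" if "m < d" for m using perp il that by blast
    moreover have "e * M $$ (i, l) = (\<Sum>m<d. (e * a $$ (i, m)) * b $$ (m, l))"
      unfolding M_def index_mult_mat_sum[OF ac bc il] by (simp add: sum_distrib_left mult.assoc)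
    ultimately show "(\<Sum>l<d. M $$ (i, l) * star (M $$ (i, l))) * M $$ (i, l) = 0" by (simp add: e_def)
  qed
  then show ?thesis by (simp add: M_def)
qed

text \<open>
  The same argument with the trace of \<open>b b*\<close> in place of the diagonal entries.
\<close>

lemma AF_eq_0:
  assumes K: "K \<subseteq> Fix" and b: "b \<in> AF U"
    and perp: "\<And>i l s. i < d \<Longrightarrow> l < d \<Longrightarrow> s \<in> ideal_annihilator K \<Longrightarrow> s * b $$ (i, l) = 0"
    and zero: "\<And>i l k x. i < d \<Longrightarrow> l < d \<Longrightarrow> x \<in> Fix \<Longrightarrow> k \<in> K \<Longrightarrow> k * x * b $$ (i, l) = 0"
  shows "b = 0\<^sub>m d d"
proof -
  define e where "e = (\<Sum>i<d. \<Sum>l<d. b $$ (i, l) * star (b $$ (i, l)))"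
  have star_e: "star e = e" by (simp add: e_def star_sum star_mult star_star)
  have dist: "y * e = (\<Sum>i<d. \<Sum>l<d. (y * b $$ (i, l)) * star (b $$ (i, l)))" for y
    by (simp add: e_def sum_distrib_left mult.assoc)
  have "e \<in> ideal_annihilator K"
  proof (rule ideal_annihilatorI[OF K _ star_e])
    show "e \<in> Fix" unfolding e_def by (rule AF_square_sum_fixed[OF b])
    fix x k assume "x \<in> Fix" "k \<in> K"
    then show "k * x * e = 0" unfolding dist using zero by (intro sum.neutral ballI) simp
  qed
  then have "e * e = 0" unfolding dist[of e] using perp by (intro sum.neutral ballI) simp
  then have "e = 0" using star_mult_self_eq_0[of e] star_e by simp
  then show ?thesis by (intro matrix_eq_0_if_square_sum_eq_0 AF_carrier[OF b]) (simp add: e_def)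
qed

lemma annihilates_square:
  assumes c: "c \<in> AF U" and zero: "\<And>a. a \<in> X2 \<inter> mats_over d V \<Longrightarrow> a * c = 0\<^sub>m d d"
  shows "annihilates V (c * mat_star c)"
  unfolding annihilates_def
proof
  fix a assume a: "a \<in> X2 \<inter> mats_over d V"
  then have ac: "a \<in> carrier_mat d d" using X2_carrier by auto
  note cc = AF_carrier[OF c] and csc = mat_star_carrier[OF AF_carrier[OF c]]
  have sq: "c * mat_star c \<in> carrier_mat d d" by (rule mult_carrier_mat[OF cc csc])
  have "a * (c * mat_star c) = 0\<^sub>m d d"
    using zero[OF a] assoc_mult_mat[OF ac cc csc] csc by simp
  moreover have "c * mat_star c * mat_star a = mat_star (a * (c * mat_star c))"
    using mat_star_mult[OF ac sq] mat_star_mult[OF cc csc] mat_star_star[OF cc] by simp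
  ultimately show "a * (c * mat_star c) = 0\<^sub>m d d \<and> c * mat_star c * mat_star a = 0\<^sub>m d d"
    by (simp add: mat_star_zero)
qed

lemma index_square:
  assumes "c \<in> carrier_mat d d" "i < d" "j < d"
  shows "(c * mat_star c) $$ (i, j) = (\<Sum>l<d. c $$ (i, l) * star (c $$ (j, l)))"
  using assms by (simp add: index_mult_mat_sum[OF assms(1) mat_star_carrier[OF assms(1)]] index_mat_star[OF assms(1)] del: index_mult_mat)

text \<open>
  This carries the spectrum from the double annihilator of \<open>J\<close> down to the smaller algebra that
  \<open>J\<close> generates.
\<close>

lemma essential_if_perp_essential:
  assumes J: "J \<in> closed_fixed_ideals F G \<alpha>"
    and ess: "\<And>b. b \<in> AF (perp (ideal_annihilator J)) \<Longrightarrow> annihilates (perp (ideal_annihilator J)) b \<Longrightarrow> b = 0\<^sub>m d d"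
    and b: "b \<in> AF (generated_hereditary F J)" and ann: "annihilates (generated_hereditary F J) b"
  shows "b = 0\<^sub>m d d"
proof -
  let ?S = "ideal_annihilator J" and ?Z = "generated_hereditary F J"
  have JF: "J \<subseteq> Fix" and ideal: "\<And>x j. x \<in> Fix \<Longrightarrow> j \<in> J \<Longrightarrow> x * j \<in> J \<and> j * x \<in> J"
    using J by (auto simp: closed_fixed_ideals_def)
  have "J \<subseteq> perp ?S" using ideal_annihilator_annihilates[OF JF] by (auto simp: perp_def)
  then have Z: "?Z \<subseteq> perp ?S" using ideal_annihilator_nonempty by (intro generated_hereditary_subset_perp) auto
  note bc = AF_carrier[OF b]
  have kb: "k \<cdot>\<^sub>m b = 0\<^sub>m d d" if k: "k \<in> J" for k
  proof -
    have kF: "k \<in> Fix" using k JF by auto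
    define c where "c = k \<cdot>\<^sub>m b"
    have c: "c \<in> AF UNIV" unfolding c_def by (rule AF_smult[OF b kF])
    note cc = AF_carrier[OF c]
    have "a * c = 0\<^sub>m d d" if a: "a \<in> X2 \<inter> mats_over d (perp ?S)" for a
    proof (rule product_eq_0[OF JF _ c])
      show aX: "a \<in> X2" using a by simp
      note ac = X2_carrier[OF aX]
      show "s * a $$ (i, l) = 0" if "i < d" "l < d" "s \<in> ?S" for i l s
        using a that by (auto simp: mats_over_def perp_def)
      show "j * x * (a * c) $$ (i, l) = 0" if il: "i < d" "l < d" and x: "x \<in> Fix" and j: "j \<in> J" for i l j x
      proof -
        have jx: "j * x \<in> J" using ideal[OF x j] by simp
        \<comment> \<open>The matrix \<open>a'\<close> has entries in \<open>J X J\<close>.\<close>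
        define a' where "a' = (j * x) \<cdot>\<^sub>m map_mat (\<lambda>x. x * k) a"
        have "a' \<in> X2" unfolding a'_def using jx JF by (intro X2_smult aX kF) auto
        moreover have "a' \<in> mats_over d ?Z"
          using ac generated_hereditaryI[OF jx k] by (auto simp: mats_over_def a'_def simp flip: mult.assoc)
        ultimately have "a' * b = 0\<^sub>m d d" using ann by (simp add: annihilates_def)
        moreover have "a' * b = (j * x) \<cdot>\<^sub>m (a * c)"
          unfolding a'_def c_def mult_smult_mat_right[OF ac bc]
          by (rule smult_mat_mult[OF _ bc]) (use ac in simp)
        ultimately have "((j * x) \<cdot>\<^sub>m (a * c)) $$ (i, l) = 0" using il by simp
        then show ?thesis using il mult_carrier_mat[OF ac cc] by (metis carrier_matD index_smult_mat(1))
      qed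
    qed
    then have "annihilates (perp ?S) (c * mat_star c)" by (intro annihilates_square[OF c])
    moreover have "c * mat_star c \<in> AF (perp ?S)"
    proof (rule AF_mono[OF AF_mult[OF c AF_star[OF c]]])
      fix i m assume im: "i < d" "m < d"
      have ck: "c $$ (i, l) = k * b $$ (i, l)" if "i < d" "l < d" for i l using that bc by (simp add: c_def)
      have "s * k = 0" "star k * s = 0" if s: "s \<in> ?S" for s
      proof -
        show "s * k = 0" by (rule ideal_annihilator_annihilates(1)[OF JF s k])
        have "star s * k = 0" using ideal_annihilator_annihilates(1)[OF JF ideal_annihilator_star[OF JF s] k] .
        then have "star (star s * k) = 0" by simp
        then show "star k * s = 0" by (simp add: star_simps)
      qed
      then have "s * (k * u * star (k * v)) = 0" "k * u * star (k * v) * s = 0" if "s \<in> ?S" for s u v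
        using that by (simp_all add: star_mult mult.assoc) (metis mult.assoc mult_zero_left)
      then show "(c * mat_star c) $$ (i, m) \<in> perp ?S"
        using im by (simp add: index_square[OF cc] ck perp_def sum_distrib_left sum_distrib_right del: index_mult_mat)
    qed
    ultimately have "c * mat_star c = 0\<^sub>m d d" by (intro ess)
    then have "c = 0\<^sub>m d d" by (rule mat_mult_star_self_eq_0[OF cc])
    then show ?thesis by (simp add: c_def)
  qed
  show ?thesis
  proof (rule AF_eq_0[OF JF b])
    fix i l assume il: "i < d" "l < d"
    show "s * b $$ (i, l) = 0" if "s \<in> ?S" for s
      using AF_entry[OF b il] Z that by (auto simp: perp_def)
    show "k * x * b $$ (i, l) = 0" if "x \<in> Fix" "k \<in> J" for x k
    proof -
      have "((k * x) \<cdot>\<^sub>m b) $$ (i, l) = 0" using kb[of "k * x"] ideal[OF that] il by simp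
      then show ?thesis using il bc by simp
    qed
  qed
qed

text \<open>
  The ideal \<open>J\<close> depends on \<open>Y\<close> alone; \<open>b\<close> enters through the trace \<open>t\<close> of \<open>b b*\<close>, which is an element of
  \<open>J\<close> and shows that \<open>J\<close> is not zero.
\<close>

lemma essential_if_ideals_essential:
  assumes closed: "closedin W Fix" and Y: "Y \<in> invariant_hereditary_subalgebras F G \<alpha>"
    and ess: "\<And>J b. J \<in> closed_fixed_ideals F G \<alpha> \<Longrightarrow> b \<in> AF (generated_hereditary F J) \<Longrightarrow>
      annihilates (generated_hereditary F J) b \<Longrightarrow> b = 0\<^sub>m d d"
    and b: "b \<in> AF Y" and ann: "annihilates Y b"
  shows "b = 0\<^sub>m d d"
proof (rule ccontr)
  assume nonzero: "b \<noteq> 0\<^sub>m d d"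
  note bc = AF_carrier[OF b]
  have her: "hereditary_cstar_subalgebra Y" using Y by (simp add: invariant_hereditary_subalgebras_def)
  then have sub: "csubspace Y" and mult: "\<And>x y. x \<in> Y \<Longrightarrow> y \<in> Y \<Longrightarrow> x * y \<in> Y" and star: "\<And>x. x \<in> Y \<Longrightarrow> star x \<in> Y"
    by (auto simp: hereditary_cstar_subalgebra_def cstar_subalgebra_def)
  define K where "K = Y \<inter> Fix"
  define t where "t = (\<Sum>i<d. \<Sum>l<d. b $$ (i, l) * star (b $$ (i, l)))"
  define J where "J = Fix \<inter> perp (ideal_annihilator K)"
  have KF: "K \<subseteq> Fix" by (simp add: K_def)
  have tF: "t \<in> Fix" unfolding t_def by (rule AF_square_sum_fixed[OF b])
  have tY: "t \<in> Y"
    unfolding t_def using AF_entry[OF b] star mult by (intro complex_space.subspace_sum[OF sub]) auto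
  have star_t: "star t = t" by (simp add: t_def star_sum star_mult star_star)
  have tJ: "t \<in> J"
    using ideal_annihilator_annihilates[OF KF] tF tY by (auto simp: J_def perp_def K_def)
  have "t \<noteq> 0" using nonzero matrix_eq_0_if_square_sum_eq_0[OF bc] by (auto simp: t_def)
  then have J: "J \<in> closed_fixed_ideals F G \<alpha>"
    unfolding J_def using tJ by (intro perp_ideal[OF closed]) (simp_all add: J_def)
  let ?Z = "generated_hereditary F J"
  have Z: "?Z \<subseteq> perp (ideal_annihilator K)"
    using ideal_annihilator_nonempty by (intro generated_hereditary_subset_perp) (auto simp: J_def)
  define c where "c = t \<cdot>\<^sub>m b"
  have c: "c \<in> AF UNIV" unfolding c_def by (rule AF_smult[OF b tF])
  note cc = AF_carrier[OF c]
  have "a * c = 0\<^sub>m d d" if a: "a \<in> X2 \<inter> mats_over d ?Z" for a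
  proof (rule product_eq_0[OF KF _ c])
    show aX: "a \<in> X2" using a by simp
    note ac = X2_carrier[OF aX]
    show "s * a $$ (i, l) = 0" if "i < d" "l < d" "s \<in> ideal_annihilator K" for i l s
      using a Z that by (auto simp: mats_over_def perp_def)
    show "k * x * (a * c) $$ (i, l) = 0" if il: "i < d" "l < d" and x: "x \<in> Fix" and k: "k \<in> K" for i l k x
    proof -
      \<comment> \<open>The matrix \<open>a'\<close> has entries in \<open>Y X Y \<subseteq> Y\<close>.\<close>
      define a' where "a' = (k * x) \<cdot>\<^sub>m map_mat (\<lambda>x. x * t) a"
      have "a' \<in> X2" unfolding a'_def using k x by (intro X2_smult aX tF fixed_points_mult) (auto simp: K_def)
      moreover have "k * x * (y * t) \<in> Y" for y
        using hereditary_bimodule[OF her _ tY, of k "x * y"] k by (simp add: K_def mult.assoc)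
      then have "a' \<in> mats_over d Y" using ac by (auto simp: mats_over_def a'_def)
      ultimately have "a' * b = 0\<^sub>m d d" using ann by (simp add: annihilates_def)
      moreover have "a' * b = (k * x) \<cdot>\<^sub>m (a * c)"
        unfolding a'_def c_def mult_smult_mat_right[OF ac bc]
        by (rule smult_mat_mult[OF _ bc]) (use ac in simp)
      ultimately have "((k * x) \<cdot>\<^sub>m (a * c)) $$ (i, l) = 0" using il by simp
      then show ?thesis using il mult_carrier_mat[OF ac cc] by (metis carrier_matD index_smult_mat(1))
    qed
  qed
  then have "annihilates ?Z (c * mat_star c)" by (intro annihilates_square[OF c])
  moreover have "c * mat_star c \<in> AF ?Z"
  proof (rule AF_mono[OF AF_mult[OF c AF_star[OF c]]])
    fix i m assume im: "i < d" "m < d"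
    have ct: "c $$ (i, l) = t * b $$ (i, l)" if "i < d" "l < d" for i l using that bc by (simp add: c_def)
    have "(c * mat_star c) $$ (i, m) = t * (\<Sum>l<d. b $$ (i, l) * star (b $$ (m, l))) * t"
      using im by (simp add: index_square[OF cc] ct star_mult star_t sum_distrib_left sum_distrib_right mult.assoc del: index_mult_mat)
    then show "(c * mat_star c) $$ (i, m) \<in> ?Z" using generated_hereditaryI[OF tJ tJ] by simp
  qed
  ultimately have "c * mat_star c = 0\<^sub>m d d" by (intro ess[OF J])
  then have c0: "c = 0\<^sub>m d d" by (rule mat_mult_star_self_eq_0[OF cc])
  have "b $$ (j, m) = 0" if jm: "j < d" "m < d" for j m
  proof -
    define z where "z p = star (b $$ p) * b $$ (j, m)" for p
    have "t * b $$ (j, m) = 0" using arg_cong[OF c0, of "\<lambda>A. A $$ (j, m)"] jm bc by (simp add: c_def)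
    then have "star (b $$ (j, m)) * t * b $$ (j, m) = 0" by (simp add: mult.assoc)
    moreover have "star (b $$ (j, m)) * t * b $$ (j, m) = (\<Sum>p\<in>{..<d} \<times> {..<d}. star (z p) * z p)"
      by (simp add: t_def sum.cartesian_product z_def star_simps sum_distrib_left sum_distrib_right mult.assoc case_prod_beta)
    ultimately have "z (j, m) = 0"
      using sum_star_mult_self_eq_0[of "{..<d} \<times> {..<d}" z "(j, m)"] jm by simp
    then show ?thesis by (simp add: z_def star_mult_self_eq_0)
  qed
  then have "b = 0\<^sub>m d d" using bc by (intro mat_eqI[of _ d d]) auto
  then show False using nonzero by simp
qed

end

section \<open>The trivial representation\<close>

context cstar_system
begin

lemma trivial_irreducible: "irreducible_rep G T (\<lambda>g. 1\<^sub>m 1)"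
proof -
  have dim: "rep_dim G (\<lambda>g. 1\<^sub>m 1) = 1" by (simp add: rep_dim_def)
  have adj: "mat_adjoint (1\<^sub>m 1) = (1\<^sub>m 1 :: complex mat)"
    by (rule mat_eqI[of _ 1 1]) (auto simp: mat_adjoint_carrier index_mat_adjoint[of _ 1 1])
  have "unitary_rep G T (\<lambda>g. 1\<^sub>m 1)"
    unfolding unitary_rep_def unitary_mat_def dim adj by simp
  moreover have "V = {0\<^sub>v 1} \<or> V = carrier_vec 1" if V: "subspace_vec 1 V" for V
  proof (rule disjCI)
    assume "V \<noteq> carrier_vec 1"
    show "V = {0\<^sub>v 1}"
    proof (rule ccontr)
      assume "V \<noteq> {0\<^sub>v 1}"
      then obtain v where v: "v \<in> V" "v \<noteq> 0\<^sub>v 1" using V by (auto simp: subspace_vec_def)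
      then have vc: "v \<in> carrier_vec 1" using V by (auto simp: subspace_vec_def)
      then have v0: "v $ 0 \<noteq> 0" using v by (metis (no_types, lifting) carrier_vecD eq_vecI index_zero_vec less_one)
      have "w \<in> V" if w: "w \<in> carrier_vec 1" for w
      proof -
        have "w = (w $ 0 / v $ 0) \<cdot>\<^sub>v v" using w vc v0 by (intro eq_vecI) auto
        moreover have "(w $ 0 / v $ 0) \<cdot>\<^sub>v v \<in> V" using V v by (simp add: subspace_vec_def)
        ultimately show ?thesis by simp
      qed
      then have "V = carrier_vec 1" using V by (auto simp: subspace_vec_def)
      then show False using \<open>V \<noteq> carrier_vec 1\<close> by simp
    qed
  qed
  ultimately show ?thesis unfolding irreducible_rep_def dim by blast
qed

lemma trivial_class:
  defines "c \<equiv> unitary_equivalence G T `` {\<lambda>g. 1\<^sub>m 1}"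
  shows "c \<in> dual_group G T" and "\<rho> \<in> c \<Longrightarrow> rep_dim G \<rho> = 1" and "\<rho> \<in> c \<Longrightarrow> g \<in> carrier G \<Longrightarrow> \<rho> g = 1\<^sub>m 1"
proof -
  show "c \<in> dual_group G T"
    unfolding dual_group_def c_def using trivial_irreducible by (intro quotientI) simp
  have dim: "rep_dim G (\<lambda>g. 1\<^sub>m 1) = 1" by (simp add: rep_dim_def)
  show "rep_dim G \<rho> = 1" if "\<rho> \<in> c" using that unfolding c_def unitary_equivalence_def by (simp add: dim[unfolded One_nat_def])
  show "\<rho> g = 1\<^sub>m 1" if "\<rho> \<in> c" "g \<in> carrier G"
    using that unfolding c_def unitary_equivalence_def unitary_mat_def by (auto simp: dim[unfolded One_nat_def])
qed

end

section \<open>The Connes spectrum\<close>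

theorem theorem4p1:
  fixes F :: "('a::cstar_algebra \<Rightarrow>\<^sub>L complex) set"
    and G :: "('g, 'm) monoid_scheme"
    and T :: "'g topology"
    and \<alpha> :: "'g \<Rightarrow> 'a \<Rightarrow> 'a"
    and \<mu> :: "'g measure"
    and rep :: "('g \<Rightarrow> complex mat) set \<Rightarrow> 'g \<Rightarrow> complex mat"
  assumes system: "dynamical_system F G T \<alpha>"
    and haar: "normalized_haar_measure G T \<mu>"
    and rep: "\<And>c. c \<in> dual_group G T \<Longrightarrow> rep c \<in> c"
    and spectral_maps: "\<And>c i j. c \<in> dual_group G T \<Longrightarrow>
          i < rep_dim G (rep c) \<Longrightarrow> j < rep_dim G (rep c) \<Longrightarrow>
          \<exists>P. is_spectral_map F \<mu> \<alpha> (rep c) i j P \<and>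
              continuous_map (weak_topology F) (weak_topology F) P"
  shows "connes_spectrum F G T \<alpha> rep =
    dual_group G T \<inter>
      (\<Inter>J\<in>closed_fixed_ideals F G \<alpha>. action_spectrum F G T \<alpha> rep (generated_hereditary F J))"
proof -
  interpret cstar_system F G T \<alpha> \<mu>
    using system haar by unfold_locales (simp_all add: dynamical_system_def)
  \<comment> \<open>For the trivial representation the spectral map is the average over the group.\<close>
  have closed: "closedin (weak_topology F) (fixed_points G \<alpha>)"
  proof -
    define c where "c = unitary_equivalence G T `` {\<lambda>g. 1\<^sub>m 1}"
    note c = trivial_class[folded c_def]
    have one: "rep_dim G (rep c) = 1" "\<And>g. g \<in> carrier G \<Longrightarrow> rep c g = 1\<^sub>m 1"
      using c(2,3)[OF rep[OF c(1)]] by auto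
    obtain P where P: "is_spectral_map F \<mu> \<alpha> (rep c) 0 0 P" "continuous_map (weak_topology F) (weak_topology F) P"
      using spectral_maps[OF c(1), of 0 0] one by auto
    have "blinfun_apply \<phi> (P x) = (\<integral>g. blinfun_apply \<phi> (\<alpha> g x) \<partial>\<mu>)" if "\<phi> \<in> F" for x \<phi>
    proof -
      have "blinfun_apply \<phi> (P x) = (\<integral>g. blinfun_apply \<phi> (cnj (rep c g $$ (0, 0)) *\<^sub>C \<alpha> g x) \<partial>\<mu>)"
        using P(1) that by (simp add: is_spectral_map_def)
      also have "\<dots> = (\<integral>g. blinfun_apply \<phi> (\<alpha> g x) \<partial>\<mu>)"
        by (intro Bochner_Integration.integral_cong) (simp_all add: space_haar one scaleC_one)
      finally show ?thesis .
    qed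
    then show ?thesis using P(2) by (rule fixed_points_weakly_closed)
  qed
  have unitary: "unitary_system F G T \<alpha> \<mu> (rep c)" if c: "c \<in> dual_group G T" for c
  proof -
    obtain \<rho> where "c = unitary_equivalence G T `` {\<rho>}" using c unfolding dual_group_def by (rule quotientE)
    then have "(\<rho>, rep c) \<in> unitary_equivalence G T" using rep[OF c] by blast
    then have "irreducible_rep G T (rep c)" by (simp add: unitary_equivalence_def)
    then show ?thesis by unfold_locales (simp_all add: irreducible_rep_def)
  qed
  have spectrum_iff: "c \<in> action_spectrum F G T \<alpha> rep Y \<longleftrightarrow>
      (\<forall>b\<in>ad_fixed_algebra G \<alpha> (rep c) Y. unitary_system.annihilates G \<alpha> (rep c) Y b \<longrightarrow> b = 0\<^sub>m (rep_dim G (rep c)) (rep_dim G (rep c)))"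
    if c: "c \<in> dual_group G T" and Y: "0 \<in> Y" for c Y
    using unitary_system.essential_iff[OF unitary[OF c] Y] c by (simp add: action_spectrum_def Let_def)
  have zero_Y: "0 \<in> Y" if "Y \<in> invariant_hereditary_subalgebras F G \<alpha>" for Y
    using that complex_space.subspace_0
    by (auto simp: invariant_hereditary_subalgebras_def hereditary_cstar_subalgebra_def cstar_subalgebra_def)
  have "(\<forall>Y\<in>invariant_hereditary_subalgebras F G \<alpha>. c \<in> action_spectrum F G T \<alpha> rep Y) \<longleftrightarrow>
      (\<forall>J\<in>closed_fixed_ideals F G \<alpha>. c \<in> action_spectrum F G T \<alpha> rep (generated_hereditary F J))"
    if c: "c \<in> dual_group G T" for c
  proof -
    interpret unitary_system F G T \<alpha> \<mu> "rep c" by (rule unitary[OF c])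
    show ?thesis
    proof (intro iffI ballI)
      fix J assume J: "J \<in> closed_fixed_ideals F G \<alpha>"
        and all: "\<forall>Y\<in>invariant_hereditary_subalgebras F G \<alpha>. c \<in> action_spectrum F G T \<alpha> rep Y"
      define V where "V = perp (ideal_annihilator J)"
      have JF: "J \<subseteq> fixed_points G \<alpha>" and "J \<noteq> {0}" "0 \<in> J"
        using J complex_space.subspace_0 by (auto simp: closed_fixed_ideals_def)
      then obtain j where j: "j \<in> J" "j \<noteq> 0" by blast
      have "j \<in> V" unfolding V_def using ideal_annihilator_annihilates[OF JF _ j(1)] by (simp add: perp_def)
      then have V: "V \<in> invariant_hereditary_subalgebras F G \<alpha>"
        unfolding V_def
        using j(2) ideal_annihilator_fixed ideal_annihilator_star[OF JF] ideal_annihilator_nonempty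
        by (intro perp_invariant_hereditary) (auto simp: V_def)
      then show "c \<in> action_spectrum F G T \<alpha> rep (generated_hereditary F J)"
        using all essential_if_perp_essential[OF J] spectrum_iff[OF c zero_Y[OF V]]
          spectrum_iff[OF c zero_in_generated_hereditary] unfolding V_def by blast
    next
      fix Y assume Y: "Y \<in> invariant_hereditary_subalgebras F G \<alpha>"
        and all: "\<forall>J\<in>closed_fixed_ideals F G \<alpha>. c \<in> action_spectrum F G T \<alpha> rep (generated_hereditary F J)"
      then show "c \<in> action_spectrum F G T \<alpha> rep Y"
        using essential_if_ideals_essential[OF closed Y] spectrum_iff[OF c zero_Y[OF Y]]
          spectrum_iff[OF c zero_in_generated_hereditary] by blast
    qed
  qed
  then show ?thesis unfolding connes_spectrum_def by auto
qed

end
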